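(* Let $N \ge 2$ and let $A \neq \mathrm{Id}$ be an $N\times N$ diagonal matrix with diagonal entries $1 = a_1 \le a_2 \le \dots \le a_N$. Let $\Gamma_A(x) := \left(\sum_{i=1}^N \frac{x_i^2}{a_i}\right)^{\frac{2-N}{2}}$. There exists an exponent $\nu_{A,N} \in (0,2)$, depending on $A$ and on $N$, such that the following holds. Let $u,v \in H^1_{\mathrm{loc}}(B_R)$ be such that $$u,v \ge 0, \qquad -\mathrm{div}(A\nabla u) \le 0, \qquad -\Delta v \le 0, \qquad u\cdot v \equiv 0 \qquad \text{in } B_R \subset \mathbb{R}^N .$$ Then, for every $x_0 \in B_R$, the functional $$r \mapsto J(u,v,x_0,r) = \frac{1}{r^{2\nu_{A,N}}} \int_{B_r(x_0)} \langle A\nabla u, \nabla u\rangle\, \Gamma_A(x-x_0)\,dx \int_{B_r(x_0)} \frac{|\nabla v|^2}{|x-x_0|^{N-2}}\,dx$$ is monotone non-decreasing for $0<r<\mathrm{dist}(x_0,\partial B_R)$.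
   Context: $B_r(x_0)$ is the Euclidean ball in $\mathbb{R}^N$ with center $x_0$ and radius $r>0$, and $B_R = B_R(0)$. $\langle\cdot,\cdot\rangle$ is the Euclidean scalar product. Differential inequalities are understood in the weak sense. *)

theory Defs
  imports "HOL-Analysis.Analysis"
begin

section \<open>Smooth test functions\<close>

definition partial_deriv :: "'n \<Rightarrow> (real^'n \<Rightarrow> real) \<Rightarrow> real^'n \<Rightarrow> real" where
  "partial_deriv i f x = frechet_derivative f (at x) (axis i 1)"

definition grad :: "(real^'n \<Rightarrow> real) \<Rightarrow> real^'n \<Rightarrow> real^'n" where
  "grad f x = (\<chi> i. partial_deriv i f x)"

primrec Ck :: "nat \<Rightarrow> (real^'n \<Rightarrow> real) \<Rightarrow> bool" where
  "Ck 0 f \<longleftrightarrow> continuous_on UNIV f"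
| "Ck (Suc k) f \<longleftrightarrow> (\<forall>x. f differentiable (at x)) \<and> (\<forall>i. Ck k (partial_deriv i f))"

definition test_functions :: "(real^'n) set \<Rightarrow> (real^'n \<Rightarrow> real) set" where
  "test_functions S =
     {\<phi>. (\<forall>k. Ck k \<phi>) \<and> compact (closure {x. \<phi> x \<noteq> 0}) \<and> closure {x. \<phi> x \<noteq> 0} \<subseteq> S}"

section \<open>The local Sobolev space \<open>H\<^sup>1\<close>\<close>

text \<open>Elements of the function spaces are represented by functions on the whole space whose
  values outside the open set \<open>S\<close> are irrelevant, and which matter only up to null sets.\<close>

definition L2_loc :: "(real^'n) set \<Rightarrow> (real^'n \<Rightarrow> 'b::euclidean_space) set" where
  "L2_loc S = {f. f \<in> borel_measurable (lebesgue_on S) \<and>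
     (\<forall>K. compact K \<and> K \<subseteq> S \<longrightarrow> integrable (lebesgue_on K) (\<lambda>x. (norm (f x))\<^sup>2))}"

definition has_weak_gradient ::
    "(real^'n) set \<Rightarrow> (real^'n \<Rightarrow> real) \<Rightarrow> (real^'n \<Rightarrow> real^'n) \<Rightarrow> bool" where
  "has_weak_gradient S u G \<longleftrightarrow>
     (\<forall>\<phi> \<in> test_functions S. \<forall>i.
        (LINT x:S|lebesgue. u x * partial_deriv i \<phi> x) = - (LINT x:S|lebesgue. G x $ i * \<phi> x))"

definition H1_loc :: "(real^'n) set \<Rightarrow> (real^'n \<Rightarrow> real) set" where
  "H1_loc S = {u. u \<in> L2_loc S \<and> (\<exists>G. G \<in> L2_loc S \<and> has_weak_gradient S u G)}"

text \<open>The weak gradient is unique up to null sets; the choice picks a representative.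
  It is meaningful for \<open>u \<in> H1_loc S\<close> only.\<close>

definition weak_gradient :: "(real^'n) set \<Rightarrow> (real^'n \<Rightarrow> real) \<Rightarrow> real^'n \<Rightarrow> real^'n" where
  "weak_gradient S u = (SOME G. G \<in> L2_loc S \<and> has_weak_gradient S u G)"

lemma weak_gradient_H1_loc:
  assumes "u \<in> H1_loc S"
  shows "weak_gradient S u \<in> L2_loc S" and "has_weak_gradient S u (weak_gradient S u)"
proof -
  have "\<exists>G. G \<in> L2_loc S \<and> has_weak_gradient S u G"
    using assms by (auto simp: H1_loc_def)
  from someI_ex[OF this] show "weak_gradient S u \<in> L2_loc S"
    and "has_weak_gradient S u (weak_gradient S u)"
    by (simp_all add: weak_gradient_def)
qed

text \<open>The inequality \<open>- div (A \<nabla>u) \<le> 0\<close> in \<open>S\<close>, in the weak sense.  The case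
  \<open>A = mat 1\<close> is \<open>- \<Delta>u \<le> 0\<close>.\<close>

definition weak_subsolution :: "(real^'n) set \<Rightarrow> real^'n^'n \<Rightarrow> (real^'n \<Rightarrow> real) \<Rightarrow> bool" where
  "weak_subsolution S A u \<longleftrightarrow>
     (\<forall>\<phi> \<in> test_functions S. (\<forall>x. \<phi> x \<ge> 0) \<longrightarrow>
        (LINT x:S|lebesgue. (A *v weak_gradient S u x) \<bullet> grad \<phi> x) \<le> 0)"

section \<open>The monotonicity functional\<close>

text \<open>With HOL's conventions the value of the kernels at the singularity is \<open>0\<close> (or \<open>1\<close>);
  this concerns a single point and does not affect the integrals below.\<close>

definition Gamma_A :: "real^'n^'n \<Rightarrow> real^'n \<Rightarrow> real" where
  "Gamma_A A x = (\<Sum>i\<in>UNIV. (x $ i)\<^sup>2 / A $ i $ i) powr ((2 - real CARD('n)) / 2)"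

text \<open>The integrands are nonnegative when \<open>A\<close> is positive semidefinite with positive diagonal, so
  the integrals are taken in \<open>[0, \<infinity>]\<close>.  The set \<open>S\<close> is the domain
  on which \<open>u\<close> and \<open>v\<close> are defined.\<close>

definition J_functional ::
    "real^'n^'n \<Rightarrow> real \<Rightarrow> (real^'n) set \<Rightarrow> (real^'n \<Rightarrow> real) \<Rightarrow> (real^'n \<Rightarrow> real) \<Rightarrow> real^'n \<Rightarrow> real
      \<Rightarrow> ennreal" where
  "J_functional A \<nu> S u v x\<^sub>0 r =
     ennreal (1 / r powr (2 * \<nu>)) *
     (\<integral>\<^sup>+ x \<in> ball x\<^sub>0 r.
        ennreal (((A *v weak_gradient S u x) \<bullet> weak_gradient S u x) * Gamma_A A (x - x\<^sub>0)) \<partial>lebesgue) *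
     (\<integral>\<^sup>+ x \<in> ball x\<^sub>0 r.
        ennreal ((norm (weak_gradient S v x))\<^sup>2 / norm (x - x\<^sub>0) ^ (CARD('n) - 2)) \<partial>lebesgue)"

end

theory Submission
  imports Defs
begin

text \<open>
  The exponent may be as small as one likes, so every estimate below is allowed to lose a constant
  that depends on the dimension \<open>N\<close> and on \<open>A\<close>. Put the centre at the
  origin and let \<open>F s\<close>, \<open>E s\<close> be the two weighted energies of the ball of radius \<open>s\<close>, with radial
  densities \<open>f\<close>, \<open>e\<close>, so that \<open>F t = F s + \<integral> f\<close> over \<open>[s, t)\<close> and likewise for \<open>E\<close>. The heart of
  the proof is that, with a constant \<open>K\<close>, for almost every \<open>s\<close>
  \<open>F s \<le> K * s * f s\<close> or \<open>E s \<le> K * s * e s\<close>.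
  As \<open>F\<close> and \<open>E\<close> are nondecreasing, this alternative gives
  \<open>F t * E t \<ge> (1 + (t - s) / (K * t)) * (F s * E s)\<close> for \<open>s \<le> t\<close> (\<open>two_phase_growth\<close>), and
  for \<open>t\<close> at most \<open>exp 1 * s\<close> the factor is at least \<open>(t / s) powr (1 / (4 * K))\<close>. Chaining such
  steps shows that \<open>F s * E s\<close> divided by \<open>s powr (1 / (4 * K))\<close> is nondecreasing
  (\<open>weighted_mono_from_growth\<close>), which is the claim with \<open>\<nu> = 1 / (8 * K)\<close>. Only values in
  \<open>[0, \<infinity>]\<close> are compared and \<open>F\<close>, \<open>E\<close> are never differentiated, so infinite energies need no
  separate treatment.

  The alternative rests on two inequalities for one function. Since \<open>u \<ge> 0\<close> is a subsolution,
  \<open>div (A \<nabla>(u\<^sup>2)) \<ge> 2 \<langle>A \<nabla>u, \<nabla>u\<rangle>\<close>; integrating this against the kernel, which is a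
  supersolution, over a ball bounds the energy by boundary terms:
  \<open>F s\<close> is at most a constant times \<open>\<integral> u(s \<theta>)\<^sup>2 + s\<^sup>2 \<integral> \<bar>\<nabla>u(s \<theta>)\<bar>\<^sup>2\<close>, integrals over the unit sphere
  (\<open>energy_le_slice\<close>). If \<open>u\<close> vanishes on at least half of the sphere of radius \<open>s\<close>, the
  Poincare inequality (\<open>weak_sphere_poincare\<close>) absorbs the first integral into the second, which
  is at most a constant times \<open>s * f s\<close> (\<open>one_phase_estimate\<close>). As \<open>u * v = 0\<close>, on almost every sphere at
  least one of \<open>u\<close>, \<open>v\<close> vanishes on half of it.

  Three devices make this elementary. Integration over a sphere is replaced by integration over a
  shell of functions that are constant along rays, so that polar coordinates (\<open>polar_nn_integral\<close>)
  follow from Fubini and scaling. As the coefficients are constant, mollifying a weak subsolution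
  gives a smooth function that satisfies the differential inequality pointwise
  (\<open>mollified_subsolution\<close>); it serves both the integration by parts and the Poincare inequality.
  Finally, boundary terms are obtained by testing with radial cutoffs whose derivative is \<open>- w\<close>
  for an arbitrary nonnegative continuous weight \<open>w\<close>, and a pointwise inequality for almost every radius is recovered
  from the weighted ones (\<open>AE_le_from_continuous_weights\<close>).
\<close>

section \<open>Almost everywhere inequalities from continuous weights\<close>

lemma negligible_imp_AE_lborel:
  assumes "negligible N" shows "AE x in lborel. x \<notin> N"
  using AE_not_in[of N lebesgue] assms unfolding negligible_iff_null_sets AE_completion_iff by simp

text \<open>The indicator of the exceptional set \<open>{Q < F}\<close> is an almost everywhere limit of continuous
  weights. Fatou's lemma on the left and dominated convergence on the right carry the weighted
  inequality over to this indicator, so the set is null. The margin \<open>d\<close> leaves room for the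
  continuous weights to decay outside the interval.\<close>

lemma AE_le_from_continuous_weights_Icc:
  fixes F Q :: "real \<Rightarrow> ennreal"
  assumes [measurable]: "F \<in> borel_measurable borel" "Q \<in> borel_measurable borel"
    and le: "\<And>w. continuous_on UNIV w \<Longrightarrow> (\<And>s. 0 \<le> w s) \<Longrightarrow> (\<And>s. w s \<le> 1) \<Longrightarrow>
        (\<And>s. w s \<noteq> 0 \<Longrightarrow> a - d \<le> s \<and> s \<le> b + d) \<Longrightarrow>
        (\<integral>\<^sup>+s. ennreal (w s) * F s \<partial>lborel) \<le> (\<integral>\<^sup>+s. ennreal (w s) * Q s \<partial>lborel)"
    and fin: "(\<integral>\<^sup>+s. indicator {a-d..b+d} s * Q s \<partial>lborel) < \<infinity>" and d: "d > 0"
  shows "AE s in lborel. a \<le> s \<and> s \<le> b \<longrightarrow> F s \<le> Q s"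
proof -
  define E where "E = {s. a \<le> s \<and> s \<le> b \<and> Q s < F s}"
  have [measurable]: "E \<in> sets borel" unfolding E_def by measurable
  have "indicat_real E measurable_on UNIV"
    by (intro lebesgue_measurable_imp_measurable_on_real borel_measurable_indicator) auto
  then obtain N g where N: "negligible N" and g: "\<And>n. continuous_on UNIV (g n)"
    and lim: "\<And>x. x \<notin> N \<Longrightarrow> (\<lambda>n. g n x) \<longlonglongrightarrow> indicat_real E x"
    unfolding measurable_on_def by auto
  define cutoff where "cutoff s = max 0 (min 1 (1 + min ((s-a)/d) ((b-s)/d)))" for s :: real
  define w where "w n s = max 0 (min 1 (g n s)) * cutoff s" for n s
  have tzc: "continuous_on UNIV cutoff" unfolding cutoff_def by (intro continuous_intros) (use d in auto)
  have tzb: "0 \<le> cutoff s" "cutoff s \<le> 1" for s by (auto simp: cutoff_def)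
  have tzs: "a - d \<le> s \<and> s \<le> b + d" if "cutoff s \<noteq> 0" for s
  proof -
    have "0 < 1 + min ((s-a)/d) ((b-s)/d)" using that by (auto simp: cutoff_def)
    hence "- 1 < (s-a)/d" "-1 < (b-s)/d" by (auto simp: min_def split: if_splits)
    thus ?thesis using d by (auto simp: field_simps)
  qed
  have tz1: "cutoff s = 1" if "a \<le> s" "s \<le> b" for s
    using that d by (auto simp: cutoff_def min_def)
  have wc: "continuous_on UNIV (w n)" for n
    unfolding w_def by (intro continuous_intros g tzc)
  have w0: "0 \<le> w n s" "w n s \<le> 1" for n s
    unfolding w_def using tzb[of s] by (auto intro!: mult_le_one)
  have ws: "a - d \<le> s \<and> s \<le> b + d" if "w n s \<noteq> 0" for n s
    using that tzs by (auto simp: w_def)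
  have [measurable]: "w n \<in> borel_measurable borel" for n
    using wc by (rule borel_measurable_continuous_onI)
  have wlim: "(\<lambda>n. w n s) \<longlonglongrightarrow> indicator E s" if "s \<notin> N" for s
  proof -
    have "(\<lambda>n. w n s) \<longlonglongrightarrow> max 0 (min 1 (indicat_real E s)) * cutoff s"
      unfolding w_def by (intro tendsto_intros lim that)
    also have "max 0 (min 1 (indicat_real E s)) * cutoff s = indicator E s"
      using tz1[of s] by (auto simp: indicator_def E_def)
    finally show ?thesis .
  qed
  have AEN: "AE s in lborel. s \<notin> N"
    by (rule negligible_imp_AE_lborel[OF N])
  have limF: "indicator E s * F s \<le> liminf (\<lambda>n. ennreal (w n s) * F s)" if "s \<notin> N" for s
  proof (cases "s \<in> E")
    case True
    have "(\<lambda>n. ennreal (w n s)) \<longlonglongrightarrow> ennreal (indicator E s)"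
      by (intro tendsto_ennrealI wlim that)
    hence "(\<lambda>n. ennreal (w n s) * F s) \<longlonglongrightarrow> indicator E s * F s"
      using True tendsto_mult_ennreal[OF _ tendsto_const[of "F s"]] by fastforce
    thus ?thesis by (simp add: lim_imp_Liminf)
  qed auto
  have "AE s in lborel. indicator {a-d..b+d} s * Q s \<noteq> \<infinity>"
    using fin by (intro nn_integral_PInf_AE) auto
  hence limQ: "AE s in lborel. (\<lambda>n. ennreal (w n s) * Q s) \<longlonglongrightarrow> indicator E s * Q s"
    using AEN
  proof eventually_elim
    case (elim s)
    show ?case
    proof (cases "a - d \<le> s \<and> s \<le> b + d")
      case True
      hence "Q s \<noteq> top" using elim by (auto simp: indicator_def)
      moreover have "(\<lambda>n. ennreal (w n s)) \<longlonglongrightarrow> ennreal (indicator E s)"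
        by (intro tendsto_ennrealI wlim elim)
      ultimately show ?thesis
        using tendsto_mult_ennreal[OF _ tendsto_const[of "Q s"], of "\<lambda>n. ennreal (w n s)" "ennreal (indicator E s)"]
        by (auto simp: indicator_def split: if_splits)
    next
      case False
      hence "w n s = 0" for n using ws by blast
      moreover have "s \<notin> E" using False d by (auto simp: E_def)
      ultimately show ?thesis by simp
    qed
  qed
  have "(\<integral>\<^sup>+s. indicator E s * F s \<partial>lborel) \<le> (\<integral>\<^sup>+s. liminf (\<lambda>n. ennreal (w n s) * F s) \<partial>lborel)"
    using AEN limF by (intro nn_integral_mono_AE) auto
  also have "\<dots> \<le> liminf (\<lambda>n. \<integral>\<^sup>+s. ennreal (w n s) * F s \<partial>lborel)"
    by (intro nn_integral_liminf) auto
  also have "\<dots> \<le> liminf (\<lambda>n. \<integral>\<^sup>+s. ennreal (w n s) * Q s \<partial>lborel)"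
    by (intro Liminf_mono always_eventually allI le wc w0) (use ws in auto)
  also have "(\<lambda>n. \<integral>\<^sup>+s. ennreal (w n s) * Q s \<partial>lborel) \<longlonglongrightarrow> (\<integral>\<^sup>+s. indicator E s * Q s \<partial>lborel)"
  proof (rule nn_integral_dominated_convergence[where w="\<lambda>s. indicator {a-d..b+d} s * Q s"])
    fix n show "AE s in lborel. ennreal (w n s) * Q s \<le> indicator {a-d..b+d} s * Q s"
    proof (intro AE_I2)
      fix s
      have "ennreal (w n s) \<le> indicator {a-d..b+d} s"
        using w0[of n s] ws[of n s] by (cases "w n s = 0") (auto simp: indicator_def)
      thus "ennreal (w n s) * Q s \<le> indicator {a-d..b+d} s * Q s" by (rule mult_right_mono) simp
    qed
  qed (use limQ fin in auto)
  hence "liminf (\<lambda>n. \<integral>\<^sup>+s. ennreal (w n s) * Q s \<partial>lborel) = (\<integral>\<^sup>+s. indicator E s * Q s \<partial>lborel)"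
    by (intro lim_imp_Liminf) auto
  finally have leE: "(\<integral>\<^sup>+s. indicator E s * F s \<partial>lborel) \<le> (\<integral>\<^sup>+s. indicator E s * Q s \<partial>lborel)" .
  have finE: "(\<integral>\<^sup>+s. indicator E s * Q s \<partial>lborel) < \<infinity>"
    by (rule le_less_trans[OF nn_integral_mono fin]) (use d in \<open>auto simp: indicator_def E_def\<close>)
  have "(\<integral>\<^sup>+s. (indicator E s * F s - indicator E s * Q s) \<partial>lborel)
      = (\<integral>\<^sup>+s. indicator E s * F s \<partial>lborel) - (\<integral>\<^sup>+s. indicator E s * Q s \<partial>lborel)"
    using finE by (intro nn_integral_diff AE_I2) (auto simp: indicator_def E_def)
  also have "\<dots> = 0" using leE finE by (intro diff_eq_0_ennreal) auto
  finally have "AE s in lborel. indicator E s * F s - indicator E s * Q s = 0"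
    by (subst (asm) nn_integral_0_iff_AE) auto
  thus ?thesis
  proof eventually_elim
    case (elim s)
    show ?case
    proof (rule ccontr)
      assume "\<not> ?case"
      hence "s \<in> E" by (auto simp: E_def)
      hence "F s - Q s = 0" "Q s < F s" using elim by (auto simp: E_def)
      thus False using diff_gr0_ennreal by fastforce
    qed
  qed
qed

text \<open>Closed intervals with rational endpoints exhaust the open interval and there are only countably
  many of them.\<close>

lemma AE_le_from_continuous_weights:
  fixes F Q :: "real \<Rightarrow> ennreal"
  assumes F: "F \<in> borel_measurable borel" and Q: "Q \<in> borel_measurable borel"
    and le: "\<And>w a b. continuous_on UNIV w \<Longrightarrow> (\<And>s. 0 \<le> w s) \<Longrightarrow> (\<And>s. w s \<le> 1) \<Longrightarrow>
        lo < a \<Longrightarrow> a < b \<Longrightarrow> b < hi \<Longrightarrow> (\<And>s. w s \<noteq> 0 \<Longrightarrow> a \<le> s \<and> s \<le> b) \<Longrightarrow>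
        (\<integral>\<^sup>+s. ennreal (w s) * F s \<partial>lborel) \<le> (\<integral>\<^sup>+s. ennreal (w s) * Q s \<partial>lborel)"
    and fin: "\<And>a b. lo < a \<Longrightarrow> b < hi \<Longrightarrow> (\<integral>\<^sup>+s. indicator {a..b} s * Q s \<partial>lborel) < \<infinity>"
  shows "AE s in lborel. lo < s \<and> s < hi \<longrightarrow> F s \<le> Q s"
proof -
  have "AE s in lborel. \<forall>a\<in>\<rat>. \<forall>b\<in>\<rat>. lo < a \<longrightarrow> b < hi \<longrightarrow> a \<le> s \<and> s \<le> b \<longrightarrow> F s \<le> Q s"
  proof (subst AE_ball_countable[OF countable_rat], intro ballI, subst AE_ball_countable[OF countable_rat], intro ballI)
    fix a b :: real
    show "AE s in lborel. lo < a \<longrightarrow> b < hi \<longrightarrow> a \<le> s \<and> s \<le> b \<longrightarrow> F s \<le> Q s"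
    proof (cases "lo < a \<and> b < hi \<and> a \<le> b")
      case True
      define d where "d = min (a - lo) (hi - b) / 2"
      have d: "d > 0" "lo < a - d" "b + d < hi" using True by (auto simp: d_def min_def field_simps)
      have "AE s in lborel. a \<le> s \<and> s \<le> b \<longrightarrow> F s \<le> Q s"
        by (rule AE_le_from_continuous_weights_Icc[OF F Q le fin d(1)]) (use d True in auto)
      thus ?thesis by eventually_elim auto
    qed auto
  qed
  thus ?thesis
  proof eventually_elim
    case (elim s)
    show ?case
    proof
      assume "lo < s \<and> s < hi"
      then obtain a b where "a \<in> \<rat>" "b \<in> \<rat>" "lo < a" "a < s" "s < b" "b < hi"
        using Rats_dense_in_real by (metis (full_types))
      thus "F s \<le> Q s" using elim by auto
    qed
  qed
qed

section \<open>Polar coordinates\<close>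

lemma nn_integral_lborel_affine:
  fixes t :: "'a::euclidean_space" and f :: "'a \<Rightarrow> ennreal"
  assumes [measurable]: "f \<in> borel_measurable borel" and c: "c \<noteq> 0"
  shows "(\<integral>\<^sup>+x. f x \<partial>lborel) = ennreal (\<bar>c\<bar> ^ DIM('a)) * (\<integral>\<^sup>+x. f (t + c *\<^sub>R x) \<partial>lborel)"
  by (subst lborel_affine[OF c, of t])
     (simp add: nn_integral_density nn_integral_distr nn_integral_cmult)

definition shell :: "real \<Rightarrow> real \<Rightarrow> ('a::euclidean_space) set" where
  "shell \<alpha> \<beta> = {x. \<alpha> \<le> norm x \<and> norm x \<le> \<beta>}"

lemma shell_measurable [measurable]: "shell \<alpha> \<beta> \<in> sets borel"
  unfolding shell_def by measurable

text \<open>The substitute for the integral of \<open>h\<close> over the sphere of radius \<open>s\<close>: up to a constant that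
  depends on the shell, it is the integral of \<open>\<theta> \<mapsto> h (s *\<^sub>R \<theta>)\<close> over the unit sphere, but it needs no
  surface measure. Two shells are used below because the segments in the proof of the Poincare
  inequality leave the shell in which they start.\<close>

definition sphere_integral :: "real \<Rightarrow> real \<Rightarrow> (('a::euclidean_space) \<Rightarrow> ennreal) \<Rightarrow> real \<Rightarrow> ennreal" where
  "sphere_integral \<alpha> \<beta> h s = (\<integral>\<^sup>+x. indicator (shell \<alpha> \<beta>) x * h ((s / norm x) *\<^sub>R x) \<partial>lborel)"

lemma sphere_integral_measurable [measurable]:
  assumes [measurable]: "h \<in> borel_measurable borel"
  shows "sphere_integral \<alpha> \<beta> h \<in> borel_measurable borel"
  unfolding sphere_integral_def[abs_def] by measurable

text \<open>The value is \<open>(\<beta> ^ N - \<alpha> ^ N) / N\<close> with \<open>N\<close> the dimension; what matters is that it is positive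
  and finite.\<close>

definition polar_const :: "'a::euclidean_space itself \<Rightarrow> real \<Rightarrow> real \<Rightarrow> real" where
  "polar_const _ \<alpha> \<beta> = enn2real (\<integral>\<^sup>+\<tau>. indicator {1/\<beta>..1/\<alpha>} \<tau> * ennreal (1 / \<tau> ^ Suc DIM('a)) \<partial>lborel)"

lemma polar_const_ennreal:
  assumes "0 < \<alpha>" "\<alpha> < \<beta>"
  shows "ennreal (polar_const TYPE('a::euclidean_space) \<alpha> \<beta>) =
     (\<integral>\<^sup>+\<tau>. indicator {1/\<beta>..1/\<alpha>} \<tau> * ennreal (1 / \<tau> ^ Suc DIM('a)) \<partial>lborel)" (is ?t1)
   and "0 < polar_const TYPE('a::euclidean_space) \<alpha> \<beta>" (is ?t2)
proof -
  let ?I = "\<integral>\<^sup>+\<tau>. indicator {1/\<beta>..1/\<alpha>} \<tau> * ennreal (1 / \<tau> ^ Suc DIM('a)) \<partial>lborel"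
  have ab: "1/\<beta> < 1/\<alpha>" "0 < 1/\<beta>" using assms by (auto simp: field_simps)
  have "?I \<le> (\<integral>\<^sup>+\<tau>. indicator {1/\<beta>..1/\<alpha>} \<tau> * ennreal (\<beta> ^ Suc DIM('a)) \<partial>lborel)"
  proof (intro nn_integral_mono, goal_cases)
    case (1 \<tau>)
    have "1 / \<tau> ^ Suc DIM('a) \<le> \<beta> ^ Suc DIM('a)" if "1/\<beta> \<le> \<tau>"
    proof -
      have "(1/\<tau>) ^ Suc DIM('a) \<le> \<beta> ^ Suc DIM('a)"
      proof (rule power_mono)
        have "\<tau> > 0" using that ab by linarith
        thus "1 / \<tau> \<le> \<beta>" "0 \<le> 1 / \<tau>" using that assms by (auto simp: field_simps)
      qed
      thus ?thesis by (simp add: power_divide)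
    qed
    thus ?case by (auto simp: indicator_def intro!: ennreal_leI)
  qed
  also have "\<dots> < \<infinity>"
    using ab by (subst nn_integral_multc) (auto simp: ennreal_mult_less_top)
  finally have fin: "?I < \<infinity>" .
  have "(\<integral>\<^sup>+\<tau>. indicator {1/\<beta>..1/\<alpha>} \<tau> * ennreal (\<alpha> ^ Suc DIM('a)) \<partial>lborel) \<le> ?I"
  proof (intro nn_integral_mono, goal_cases)
    case (1 \<tau>)
    have "\<alpha> ^ Suc DIM('a) \<le> 1 / \<tau> ^ Suc DIM('a)" if "\<tau> \<le> 1/\<alpha>" "1/\<beta> \<le> \<tau>"
    proof -
      have "\<tau> > 0" using that ab by linarith
      hence "\<alpha> \<le> 1/\<tau>" using that assms by (simp add: field_simps)
      hence "\<alpha> ^ Suc DIM('a) \<le> (1/\<tau>) ^ Suc DIM('a)"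
        using assms by (intro power_mono) auto
      thus ?thesis by (simp add: power_divide)
    qed
    thus ?case by (auto simp: indicator_def intro!: ennreal_leI)
  qed
  moreover have "(\<integral>\<^sup>+\<tau>. indicator {1/\<beta>..1/\<alpha>} \<tau> * ennreal (\<alpha> ^ Suc DIM('a)) \<partial>lborel) > 0"
    using ab assms by (subst nn_integral_multc) (auto simp: ennreal_zero_less_mult_iff)
  ultimately have pos: "?I > 0" by auto
  show ?t1 using fin by (simp add: polar_const_def)
  show ?t2 using fin pos by (simp add: polar_const_def enn2real_positive_iff)
qed

text \<open>Substituting \<open>s = norm x * t\<close> for fixed \<open>x\<close> removes the normalisation of \<open>x\<close>; after Fubini,
  \<open>y = t *\<^sub>R x\<close> for fixed \<open>t\<close> makes \<open>h\<close> depend on \<open>y\<close> alone, and after another Fubini the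
  substitution \<open>t = norm y * \<tau>\<close> shows that the remaining integral over the shell does not depend
  on \<open>y\<close>.\<close>

lemma polar_nn_integral:
  fixes h :: "'a::euclidean_space \<Rightarrow> ennreal"
  assumes [measurable]: "h \<in> borel_measurable borel" and ab: "0 < \<alpha>" "\<alpha> < \<beta>"
  shows "(\<integral>\<^sup>+s. indicator {0<..} s * ennreal (s ^ (DIM('a) - 1)) * sphere_integral \<alpha> \<beta> h s \<partial>lborel)
       = ennreal (polar_const TYPE('a) \<alpha> \<beta>) * (\<integral>\<^sup>+x. h x \<partial>lborel)"
proof -
  let ?K = "shell \<alpha> \<beta> :: 'a set"
  obtain m where m: "DIM('a) = Suc m"
    using DIM_positive[where 'a='a] gr0_implies_Suc by blast
  have AE0: "AE x::'a in lborel. x \<noteq> 0" by (rule AE_lborel_singleton)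
  have "(\<integral>\<^sup>+s. indicator {0<..} s * ennreal (s ^ (DIM('a) - 1)) * sphere_integral \<alpha> \<beta> h s \<partial>lborel)
     = (\<integral>\<^sup>+s. (\<integral>\<^sup>+x. indicator {0<..} s * ennreal (s ^ m) * indicator ?K x * h ((s / norm x) *\<^sub>R x) \<partial>lborel) \<partial>lborel)"
    unfolding sphere_integral_def m by (simp add: nn_integral_cmult[symmetric] mult.assoc)
  also have "\<dots> = (\<integral>\<^sup>+x. (\<integral>\<^sup>+s. indicator {0<..} s * ennreal (s ^ m) * indicator ?K x * h ((s / norm x) *\<^sub>R x) \<partial>lborel) \<partial>lborel)"
    by (rule lborel_pair.Fubini') measurable
  also have "\<dots> = (\<integral>\<^sup>+x. (\<integral>\<^sup>+t. indicator {0<..} t * ennreal (t ^ m) * (indicator ?K x * ennreal (norm x ^ Suc m)) * h (t *\<^sub>R x) \<partial>lborel) \<partial>lborel)"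
  proof (rule nn_integral_cong_AE, use AE0 in eventually_elim)
    case (elim x)
    hence x: "norm x > 0" by simp
    show ?case
      apply (subst nn_integral_real_affine[where c="norm x" and t=0])
      subgoal by measurable
      subgoal using x by simp
      apply (subst nn_integral_cmult[symmetric])
      subgoal by measurable
      apply (rule nn_integral_cong)
      using x by (auto simp: indicator_def zero_less_mult_iff power_mult_distrib ennreal_mult mult_ac split: if_splits)
  qed
  also have "\<dots> = (\<integral>\<^sup>+t. (\<integral>\<^sup>+x. indicator {0<..} t * ennreal (t ^ m) * (indicator ?K x * ennreal (norm x ^ Suc m)) * h (t *\<^sub>R x) \<partial>lborel) \<partial>lborel)"
    by (rule lborel_pair.Fubini') measurable
  also have "\<dots> = (\<integral>\<^sup>+t. (\<integral>\<^sup>+y. indicator {0<..} t * ennreal (1/t) * (indicator ?K ((1/t) *\<^sub>R y) * ennreal ((norm y / t) ^ Suc m)) * h y \<partial>lborel) \<partial>lborel)"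
  proof (rule nn_integral_cong, goal_cases)
    case (1 t)
    show ?case
    proof (cases "t > 0")
      case True
      show ?thesis
        apply (subst nn_integral_lborel_affine[where c="1/t" and t=0 and f="\<lambda>x. indicator {0<..} t * ennreal (t ^ m) * (indicator ?K x * ennreal (norm x ^ Suc m)) * h (t *\<^sub>R x)"])
        subgoal by measurable
        subgoal using True by simp
        apply (subst nn_integral_cmult[symmetric])
        subgoal by measurable
      proof (rule nn_integral_cong, goal_cases)
        case (1 y)
        have "(1/t) ^ Suc m * t ^ m = 1/t" using True by (simp add: power_divide)
        hence "ennreal (\<bar>1/t\<bar> ^ DIM('a)) * ennreal (t ^ m) = ennreal (1/t)"
          using True by (subst ennreal_mult[symmetric]) (simp_all add: m)
        hence A: "ennreal (\<bar>1/t\<bar> ^ DIM('a)) * (1 * ennreal (t ^ m) * X) = 1 * ennreal (1/t) * X" for X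
          by (metis mult.assoc mult.left_neutral)
        have "norm ((1/t) *\<^sub>R y) = norm y / t" using True by simp
        thus ?case using True A by (simp add: mult.assoc)
      qed
    qed auto
  qed
  also have "\<dots> = (\<integral>\<^sup>+y. (\<integral>\<^sup>+t. indicator {0<..} t * ennreal (1/t) * (indicator ?K ((1/t) *\<^sub>R y) * ennreal ((norm y / t) ^ Suc m)) * h y \<partial>lborel) \<partial>lborel)"
    by (rule lborel_pair.Fubini') measurable
  also have "\<dots> = (\<integral>\<^sup>+y. (\<integral>\<^sup>+\<tau>. indicator {1/\<beta>..1/\<alpha>} \<tau> * ennreal (1 / \<tau> ^ Suc DIM('a)) * h y \<partial>lborel) \<partial>lborel)"
  proof (rule nn_integral_cong_AE, use AE0 in eventually_elim)
    case (elim y)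
    hence y: "norm y > 0" by simp
    have K: "(1/(norm y * \<tau>)) *\<^sub>R y \<in> ?K \<longleftrightarrow> \<tau> \<in> {1/\<beta>..1/\<alpha>}" if "\<tau> > 0" for \<tau>
    proof -
      have "norm ((1/(norm y * \<tau>)) *\<^sub>R y) = 1/\<tau>" using y that by (simp add: abs_mult)
      thus ?thesis unfolding shell_def using that ab by (auto simp: field_simps)
    qed
    show ?case
      apply (subst nn_integral_real_affine[where c="norm y" and t=0])
      subgoal by measurable
      subgoal using y by simp
      apply (subst nn_integral_cmult[symmetric])
      subgoal by measurable
    proof (rule nn_integral_cong, goal_cases)
      case (1 \<tau>)
      show ?case
      proof (cases "\<tau> > 0")
        case True
        have "norm y * (1/(norm y * \<tau>) * (norm y / (norm y * \<tau>)) ^ Suc m) = 1/\<tau> ^ Suc DIM('a)"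
          using True y by (simp add: m power_divide)
        hence "ennreal (norm y) * (ennreal (1/(norm y * \<tau>)) * ennreal ((norm y / (norm y * \<tau>)) ^ Suc m)) = ennreal (1 / \<tau> ^ Suc DIM('a))"
          using True y by (subst ennreal_mult[symmetric], simp, simp)+ simp
        thus ?thesis using True y K[OF True] by (auto simp: indicator_def mult_ac zero_less_mult_iff)
      next
        case False
        have "1/\<beta> > 0" using ab by simp
        hence "\<not> (1/\<beta> \<le> \<tau>)" using False by linarith
        thus ?thesis using False y by (auto simp: indicator_def zero_less_mult_iff)
      qed
    qed
  qed
  also have "\<dots> = (\<integral>\<^sup>+y. ennreal (polar_const TYPE('a) \<alpha> \<beta>) * h y \<partial>lborel)"
    by (subst nn_integral_multc) (simp_all add: polar_const_ennreal[OF ab])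
  also have "\<dots> = ennreal (polar_const TYPE('a) \<alpha> \<beta>) * (\<integral>\<^sup>+x. h x \<partial>lborel)"
    by (rule nn_integral_cmult) measurable
  finally show ?thesis .
qed

section \<open>The Poincare inequality on spheres\<close>

text \<open>The Cauchy-Schwarz inequality, by integrating \<open>(h - m)\<^sup>2 \<ge> 0\<close> with \<open>m\<close> the mean of \<open>h\<close>.\<close>

lemma square_integral_le:
  fixes h :: "real \<Rightarrow> real"
  assumes h: "continuous_on {0..1} h"
  shows "(integral {0..1} h)\<^sup>2 \<le> integral {0..1} (\<lambda>t. (h t)\<^sup>2)"
proof -
  define m where "m = integral {0..1} h"
  have i1: "h integrable_on {0..1}" and i2: "(\<lambda>t. (h t)\<^sup>2) integrable_on {0..1}"
    using h by (auto intro!: integrable_continuous_real continuous_intros)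
  have "((\<lambda>t. (h t)\<^sup>2 - 2 * m * h t + m\<^sup>2) has_integral
      (integral {0..1} (\<lambda>t. (h t)\<^sup>2) - 2 * m * m + (1 - 0) *\<^sub>R m\<^sup>2)) {0..1}"
    unfolding m_def using i1 i2
    by (intro has_integral_add has_integral_diff has_integral_mult_right has_integral_const_real integrable_integral) 
       (use has_integral_const_real[of "(integral {0..1} h)\<^sup>2" 0 1] in auto)
  moreover have "(h t)\<^sup>2 - 2 * m * h t + m\<^sup>2 \<ge> 0" for t
    using zero_le_power2[of "h t - m"] by (simp add: power2_diff algebra_simps)
  ultimately have "0 \<le> integral {0..1} (\<lambda>t. (h t)\<^sup>2) - 2 * m * m + (1 - 0) *\<^sub>R m\<^sup>2"
    by (rule has_integral_nonneg)
  thus ?thesis unfolding m_def by (simp add: power2_eq_square)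
qed

text \<open>The radial projection to the sphere of radius \<open>s\<close> has Lipschitz constant of order \<open>s\<close> away from
  the origin. So the projection of a segment that avoids a small ball is a curve on the sphere of
  length \<open>O(s)\<close>, and \<open>f\<close> is integrated along this curve.\<close>

lemma radial_segment_estimate:
  fixes f :: "'a::euclidean_space \<Rightarrow> real" and g :: "'a \<Rightarrow> 'a"
  assumes s: "s > 0"
    and deriv: "\<And>x. norm x = s \<Longrightarrow> (f has_derivative (\<lambda>v. g x \<bullet> v)) (at x)"
    and cont: "continuous_on (sphere 0 s) g"
    and x: "norm x \<le> 1" and y: "norm y \<le> 1"
    and seg: "\<And>t. 0 \<le> t \<Longrightarrow> t \<le> 1 \<Longrightarrow> 1/8 \<le> norm ((1 - t) *\<^sub>R x + t *\<^sub>R y)"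
  shows "ennreal ((f ((s / norm x) *\<^sub>R x) - f ((s / norm y) *\<^sub>R y))\<^sup>2) \<le>
    ennreal (1024 * s\<^sup>2) * (\<integral>\<^sup>+t. indicator {0..1} t *
      ennreal ((norm (g ((s / norm ((1 - t) *\<^sub>R x + t *\<^sub>R y)) *\<^sub>R ((1 - t) *\<^sub>R x + t *\<^sub>R y))))\<^sup>2) \<partial>lborel)"
proof -
  define z where "z t = (1 - t) *\<^sub>R x + t *\<^sub>R y" for t
  define P where "P t = (s / norm (z t)) *\<^sub>R z t" for t
  define D where "D t = (s / norm (z t)) *\<^sub>R (y - x) - (s * (z t \<bullet> (y - x)) / norm (z t) ^ 3) *\<^sub>R z t" for t
  define h where "h t = g (P t) \<bullet> D t" for t
  have nz: "1/8 \<le> norm (z t)" if "t \<in> {0..1}" for t using seg that by (auto simp: z_def)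
  have z0: "z t \<noteq> 0" if "t \<in> {0..1}" for t using nz[OF that] by auto
  have nP: "norm (P t) = s" if "t \<in> {0..1}" for t
    using z0[OF that] s by (simp add: P_def)
  have dz: "(z has_vector_derivative (y - x)) (at t within T)" for t T
    unfolding z_def by (auto intro!: derivative_eq_intros simp: algebra_simps)
  have dn: "((\<lambda>t. norm (z t)) has_real_derivative (z t \<bullet> (y - x)) / norm (z t)) (at t within T)"
    if "t \<in> {0..1}" for t T
  proof -
    have "(norm has_derivative (\<lambda>h. h \<bullet> sgn (z t))) (at (z t))"
      using z0[OF that] by (rule has_derivative_norm)
    from has_derivative_compose[OF dz[unfolded has_vector_derivative_def] this]
    have "((\<lambda>t. norm (z t)) has_derivative (\<lambda>h. (h *\<^sub>R (y - x)) \<bullet> sgn (z t))) (at t within T)" .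
    thus ?thesis unfolding has_field_derivative_def
      by (rule has_derivative_eq_rhs) (auto simp: sgn_div_norm inner_commute divide_inverse fun_eq_iff)
  qed
  have dP: "(P has_vector_derivative D t) (at t within T)" if "t \<in> {0..1}" for t T
  proof -
    have "((\<lambda>t. s / norm (z t)) has_real_derivative - (s * (z t \<bullet> (y - x)) / norm (z t) ^ 3)) (at t within T)"
      using z0[OF that] by (auto intro!: derivative_eq_intros dn[OF that] simp: power3_eq_cube)
    from has_vector_derivative_scaleR[OF this dz[of t T]]
    have "((\<lambda>t. (s / norm (z t)) *\<^sub>R z t) has_vector_derivative
       ((s / norm (z t)) *\<^sub>R (y - x) + (- (s * (z t \<bullet> (y - x)) / norm (z t) ^ 3)) *\<^sub>R z t)) (at t within T)" .
    thus ?thesis unfolding P_def[abs_def] D_def by simp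
  qed
  have df: "((\<lambda>t. f (P t)) has_vector_derivative h t) (at t within T)" if "t \<in> {0..1}" for t T
  proof -
    from has_derivative_compose[OF dP[OF that, unfolded has_vector_derivative_def] deriv[OF nP[OF that]]]
    have "((\<lambda>t. f (P t)) has_derivative (\<lambda>v. g (P t) \<bullet> (v *\<^sub>R D t))) (at t within T)" .
    thus ?thesis unfolding has_vector_derivative_def h_def by simp
  qed
  have cz: "continuous_on {0..1} z" unfolding z_def by (intro continuous_intros)
  have cP: "continuous_on {0..1} P"
    using dP by (meson continuous_on_eq_continuous_within has_vector_derivative_continuous)
  have "continuous_on {0..1} (\<lambda>t. g (P t))"
    by (rule continuous_on_compose2[OF cont cP]) (use nP in auto)
  moreover have "continuous_on {0..1} D" unfolding D_def
    by (intro continuous_intros cz) (use z0 in auto)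
  ultimately have ch: "continuous_on {0..1} h" unfolding h_def by (intro continuous_intros)
  have "(h has_integral (f (P 1) - f (P 0))) {0..1}"
    by (rule fundamental_theorem_of_calculus) (use df in auto)
  hence "integral {0..1} h = f (P 1) - f (P 0)" by (rule integral_unique)
  hence "(f (P 0) - f (P 1))\<^sup>2 \<le> integral {0..1} (\<lambda>t. (h t)\<^sup>2)"
    using square_integral_le[OF ch] by (simp add: power2_commute)
  hence "ennreal ((f (P 0) - f (P 1))\<^sup>2) \<le> ennreal (integral {0..1} (\<lambda>t. (h t)\<^sup>2))" by (rule ennreal_leI)
  also have "\<dots> = (\<integral>\<^sup>+t. indicator {0..1} t * ennreal ((h t)\<^sup>2) \<partial>lborel)"
    by (subst mult.commute, rule nn_integral_has_integral_lebesgue'[symmetric])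
       (auto intro!: integrable_integral integrable_continuous_real continuous_intros ch)
  also have "\<dots> \<le> (\<integral>\<^sup>+t. ennreal (1024 * s\<^sup>2) * (indicator {0..1} t * ennreal ((norm (g (P t)))\<^sup>2)) \<partial>lborel)"
  proof (rule nn_integral_mono, goal_cases)
    case (1 t)
    show ?case
    proof (cases "t \<in> {0..1}")
      case True
      have xy: "norm (y - x) \<le> 2" using norm_triangle_ineq4[of y x] x y by linarith
      let ?n = "norm (z t)"
      have n: "?n > 0" using z0[OF True] by simp
      have "norm (D t) \<le> s / ?n * norm (y - x) + \<bar>s * (z t \<bullet> (y - x)) / ?n ^ 3\<bar> * ?n"
        unfolding D_def by (rule order_trans[OF norm_triangle_ineq4]) (use s in auto)
      also have "\<bar>s * (z t \<bullet> (y - x)) / ?n ^ 3\<bar> * ?n = s * \<bar>z t \<bullet> (y - x)\<bar> / ?n ^ 2"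
        using n s by (simp add: abs_mult power3_eq_cube power2_eq_square)
      also have "\<dots> \<le> s * (?n * norm (y - x)) / ?n ^ 2"
        using s n Cauchy_Schwarz_ineq2[of "z t" "y - x"] by (intro divide_right_mono mult_left_mono) auto
      also have "\<dots> = s / ?n * norm (y - x)" using n by (simp add: power2_eq_square)
      also have "s / ?n * norm (y - x) \<le> (s * 8) * 2"
      proof (rule mult_mono[OF _ xy])
        show "s / ?n \<le> s * 8" using nz[OF True] n s by (simp add: field_simps)
      qed (use s in auto)
      finally have Db: "norm (D t) \<le> 32 * s" by simp
      have "(h t)\<^sup>2 \<le> (norm (g (P t)) * norm (D t))\<^sup>2"
        unfolding h_def using Cauchy_Schwarz_ineq2[of "g (P t)" "D t"]
        by (metis abs_ge_zero power2_abs power_mono)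
      also have "\<dots> \<le> (norm (g (P t)) * (32 * s))\<^sup>2"
        by (intro power_mono mult_left_mono Db) auto
      also have "\<dots> = 1024 * s\<^sup>2 * (norm (g (P t)))\<^sup>2" by (simp add: power_mult_distrib)
      finally show ?thesis using True by (simp add: ennreal_mult[symmetric] ennreal_leI)
    qed simp
  qed
  also have "\<dots> = ennreal (1024 * s\<^sup>2) * (\<integral>\<^sup>+t. indicator {0..1} t * ennreal ((norm (g (P t)))\<^sup>2) \<partial>lborel)"
  proof (rule nn_integral_cmult)
    have "continuous_on {0..1} (\<lambda>t. (norm (g (P t)))\<^sup>2)"
      by (intro continuous_intros continuous_on_compose2[OF cont cP]) (use nP in auto)
    hence "(\<lambda>t. indicator {0..1} t *\<^sub>R (norm (g (P t)))\<^sup>2) \<in> borel_measurable borel"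
      by (rule borel_measurable_continuous_on_indicator[rotated]) simp
    hence "(\<lambda>t. ennreal (indicator {0..1} t *\<^sub>R (norm (g (P t)))\<^sup>2)) \<in> borel_measurable borel" by measurable
    also have "(\<lambda>t. ennreal (indicator {0..1} t *\<^sub>R (norm (g (P t)))\<^sup>2)) = (\<lambda>t. indicator {0..1} t * ennreal ((norm (g (P t)))\<^sup>2))"
      by (auto simp: indicator_def fun_eq_iff)
    finally show "(\<lambda>t. indicator {0..1} t * ennreal ((norm (g (P t)))\<^sup>2)) \<in> borel_measurable lborel" by simp
  qed
  finally show ?thesis by (simp add: P_def z_def)
qed

text \<open>For \<open>t \<ge> 1/2\<close> the map \<open>y \<mapsto> (1 - t) *\<^sub>R x + t *\<^sub>R y\<close> shrinks volumes by at most the factor \<open>2 ^ DIM\<close>, for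
  \<open>t \<le> 1/2\<close> the same holds for \<open>x\<close> in place of \<open>y\<close>. This is the standard step in the proof of
  the Poincare inequality on convex sets.\<close>

lemma nn_integral_segment_le:
  fixes K :: "'a::euclidean_space \<Rightarrow> ennreal"
  assumes [measurable]: "K \<in> borel_measurable borel" "S \<in> sets borel"
  shows "(\<integral>\<^sup>+x. (\<integral>\<^sup>+y. indicator S x * indicator S y * (\<integral>\<^sup>+t. indicator {0..1::real} t *
            K ((1 - t) *\<^sub>R x + t *\<^sub>R y) \<partial>lborel) \<partial>lborel) \<partial>lborel)
         \<le> ennreal (2 ^ DIM('a)) * emeasure lborel S * (\<integral>\<^sup>+x. K x \<partial>lborel)"
proof -
  let ?I = "\<lambda>t x y. indicator S x * indicator S y * (indicator {0..1::real} t * K ((1 - t) *\<^sub>R x + t *\<^sub>R y))"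
  let ?c = "ennreal (2 ^ DIM('a))"
  have sc: "(\<integral>\<^sup>+x. K (a + c *\<^sub>R x) \<partial>lborel) \<le> ?c * (\<integral>\<^sup>+x. K x \<partial>lborel)" if "c \<ge> 1/2" for c :: real and a
  proof -
    have "1 \<le> 2 ^ DIM('a) * \<bar>c\<bar> ^ DIM('a)" using that power_mono[of 1 "2 * c" "DIM('a)"] 
      by (auto simp: power_mult_distrib)
    hence "1 \<le> ?c * ennreal (\<bar>c\<bar> ^ DIM('a))" by (simp add: ennreal_mult[symmetric] ennreal_1[symmetric] del: ennreal_1)
    hence "1 * (\<integral>\<^sup>+x. K (a + c *\<^sub>R x) \<partial>lborel) \<le> ?c * ennreal (\<bar>c\<bar> ^ DIM('a)) * (\<integral>\<^sup>+x. K (a + c *\<^sub>R x) \<partial>lborel)"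
      by (rule mult_right_mono) simp
    also have "\<dots> = ?c * (\<integral>\<^sup>+x. K x \<partial>lborel)"
      using that by (subst (2) nn_integral_lborel_affine[where c=c and t=a]) (auto simp: mult.assoc)
    finally show ?thesis by simp
  qed
  have "(\<integral>\<^sup>+x. (\<integral>\<^sup>+y. indicator S x * indicator S y * (\<integral>\<^sup>+t. indicator {0..1::real} t *
            K ((1 - t) *\<^sub>R x + t *\<^sub>R y) \<partial>lborel) \<partial>lborel) \<partial>lborel)
      = (\<integral>\<^sup>+x. (\<integral>\<^sup>+y. (\<integral>\<^sup>+t. ?I t x y \<partial>lborel) \<partial>lborel) \<partial>lborel)"
    by (simp add: nn_integral_cmult[symmetric])
  also have "\<dots> = (\<integral>\<^sup>+x. (\<integral>\<^sup>+t. (\<integral>\<^sup>+y. ?I t x y \<partial>lborel) \<partial>lborel) \<partial>lborel)"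
    by (intro nn_integral_cong lborel_pair.Fubini') measurable
  also have "\<dots> = (\<integral>\<^sup>+t. (\<integral>\<^sup>+x. (\<integral>\<^sup>+y. ?I t x y \<partial>lborel) \<partial>lborel) \<partial>lborel)"
    by (rule lborel_pair.Fubini') measurable
  also have "\<dots> \<le> (\<integral>\<^sup>+t. indicator {0..1::real} t * (?c * emeasure lborel S * (\<integral>\<^sup>+x. K x \<partial>lborel)) \<partial>lborel)"
  proof (rule nn_integral_mono, goal_cases)
    case (1 t)
    show ?case
    proof (cases "t \<in> {0..1}")
      case t: True
      have "(\<integral>\<^sup>+x. (\<integral>\<^sup>+y. ?I t x y \<partial>lborel) \<partial>lborel) \<le> ?c * emeasure lborel S * (\<integral>\<^sup>+x. K x \<partial>lborel)"
      proof (cases "t \<ge> 1/2")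
        case True
        have "(\<integral>\<^sup>+x. (\<integral>\<^sup>+y. ?I t x y \<partial>lborel) \<partial>lborel) \<le> (\<integral>\<^sup>+x. (\<integral>\<^sup>+y. indicator S x * K ((1 - t) *\<^sub>R x + t *\<^sub>R y) \<partial>lborel) \<partial>lborel)"
          by (intro nn_integral_mono) (auto simp: indicator_def)
        also have "\<dots> \<le> (\<integral>\<^sup>+x. indicator S x * (?c * (\<integral>\<^sup>+x. K x \<partial>lborel)) \<partial>lborel)"
          using True by (intro nn_integral_mono, subst nn_integral_cmult) (auto intro!: mult_left_mono sc)
        finally show ?thesis by (subst (asm) nn_integral_multc) (auto simp: mult_ac)
      next
        case False
        have "(\<integral>\<^sup>+x. (\<integral>\<^sup>+y. ?I t x y \<partial>lborel) \<partial>lborel) \<le> (\<integral>\<^sup>+x. (\<integral>\<^sup>+y. indicator S y * K (t *\<^sub>R y + (1 - t) *\<^sub>R x) \<partial>lborel) \<partial>lborel)"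
          by (intro nn_integral_mono) (auto simp: indicator_def add.commute)
        also have "\<dots> = (\<integral>\<^sup>+y. (\<integral>\<^sup>+x. indicator S y * K (t *\<^sub>R y + (1 - t) *\<^sub>R x) \<partial>lborel) \<partial>lborel)"
          by (rule lborel_pair.Fubini') measurable
        also have "\<dots> \<le> (\<integral>\<^sup>+x. indicator S x * (?c * (\<integral>\<^sup>+x. K x \<partial>lborel)) \<partial>lborel)"
          using False by (intro nn_integral_mono, subst nn_integral_cmult) (auto intro!: mult_left_mono sc)
        finally show ?thesis by (subst (asm) nn_integral_multc) (auto simp: mult_ac)
      qed
      thus ?thesis using t by simp
    qed simp
  qed
  also have "\<dots> = ?c * emeasure lborel S * (\<integral>\<^sup>+x. K x \<partial>lborel)"
    by (subst nn_integral_multc) auto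
  finally show ?thesis .
qed

text \<open>A segment between nearly antipodal points passes close to the origin, where the radial projection
  is not Lipschitz. Such points are joined through a third one: any point close to a vector
  orthogonal to \<open>x\<close> and on the side of \<open>y\<close> is connected to both by segments that stay away from
  the origin. A whole ball of fixed radius is available, which permits averaging.\<close>

lemma intermediate_ball_exists:
  fixes x y :: "'a::euclidean_space"
  assumes dim: "DIM('a) \<ge> 2" and x: "1/2 \<le> norm x" and y: "1/2 \<le> norm y"
  obtains z0 where "ball z0 (1/8) \<subseteq> shell (1/2) 1"
    "\<And>z t. z \<in> ball z0 (1/8) \<Longrightarrow> 0 \<le> t \<Longrightarrow> t \<le> 1 \<Longrightarrow> 1/8 \<le> norm ((1 - t) *\<^sub>R x + t *\<^sub>R z)"
    "\<And>z t. z \<in> ball z0 (1/8) \<Longrightarrow> 0 \<le> t \<Longrightarrow> t \<le> 1 \<Longrightarrow> 1/8 \<le> norm ((1 - t) *\<^sub>R y + t *\<^sub>R z)"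
proof -
  obtain e :: 'a where e: "e \<noteq> 0" "orthogonal x e" using orthogonal_to_vector_exists[OF dim] by metis
  \<comment> \<open>the sign puts \<open>z0\<close> on the side of \<open>y\<close>; its norm is the middle of the shell\<close>
  define z0 where "z0 = ((if e \<bullet> y \<ge> 0 then 1 else - 1) * (3/4) / norm e) *\<^sub>R e"
  have n0: "norm z0 = 3/4" using e by (simp add: z0_def)
  have ix: "x \<bullet> z0 = 0" using e by (simp add: z0_def orthogonal_def)
  have iy: "y \<bullet> z0 \<ge> 0" using e by (auto simp: z0_def inner_commute field_simps mult_nonneg_nonpos2)
  have key: "1/8 \<le> norm ((1 - t) *\<^sub>R p + t *\<^sub>R z)"
    if z: "z \<in> ball z0 (1/8)" and t: "0 \<le> t" "t \<le> 1" and p: "1/2 \<le> norm p" "p \<bullet> z0 \<ge> 0" for p z t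
  proof -
    let ?q = "(1 - t) *\<^sub>R p + t *\<^sub>R z0"
    have "(norm ?q)\<^sup>2 = (1-t)\<^sup>2 * (norm p)\<^sup>2 + 2 * ((1-t) * t * (p \<bullet> z0)) + t\<^sup>2 * (norm z0)\<^sup>2"
      unfolding power2_norm_eq_inner by (simp add: inner_simps inner_commute power2_eq_square algebra_simps)
    also have "\<dots> \<ge> (1-t)\<^sup>2 * (1/2)\<^sup>2 + 0 + t\<^sup>2 * (1/2)\<^sup>2"
      using t p by (intro add_mono mult_left_mono power_mono) (auto simp: n0)
    finally have "(norm ?q)\<^sup>2 \<ge> (1-t)\<^sup>2 * (1/2)\<^sup>2 + t\<^sup>2 * (1/2)\<^sup>2" by simp
    moreover have "(1-t)\<^sup>2 * (1/2)\<^sup>2 + t\<^sup>2 * (1/2)\<^sup>2 \<ge> (1/4::real)\<^sup>2"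
    proof -
      have "0 \<le> (t - 1/2)\<^sup>2" by simp
      also have "\<dots> = t * t - t + 1/4" by (simp add: power2_eq_square algebra_simps)
      finally show ?thesis by (simp add: power2_eq_square field_simps)
    qed
    ultimately have "norm ?q \<ge> 1/4" by (meson norm_ge_zero order_trans power2_le_imp_le)
    moreover have "norm (t *\<^sub>R (z - z0)) \<le> 1 * (1/8)"
      unfolding norm_scaleR using t z by (intro mult_mono) (auto simp: dist_norm norm_minus_commute)
    moreover have "norm ((1 - t) *\<^sub>R p + t *\<^sub>R z) = norm (?q + t *\<^sub>R (z - z0))" by (simp add: algebra_simps)
    moreover have "norm ?q - norm (t *\<^sub>R (z - z0)) \<le> norm (?q + t *\<^sub>R (z - z0))"
      by (rule norm_diff_ineq)
    ultimately show ?thesis by linarith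
  qed
  show thesis
  proof
    show "ball z0 (1/8) \<subseteq> shell (1/2) 1"
    proof
      fix z assume "z \<in> ball z0 (1/8)"
      hence "norm (z - z0) < 1/8" by (simp add: dist_norm norm_minus_commute)
      moreover have "norm z \<le> norm z0 + norm (z - z0)" "norm z0 \<le> norm z + norm (z - z0)"
        using norm_triangle_sub[of z z0] norm_triangle_sub[of z0 z] by (auto simp: norm_minus_commute)
      ultimately show "z \<in> shell (1/2) 1" by (simp add: shell_def n0)
    qed
  qed (use key x y ix iy in auto)
qed

text \<open>Joining two points of the shell through all points of the ball from \<open>intermediate_ball_exists\<close> and
  averaging bounds the oscillation by integrals along segments; \<open>nn_integral_segment_le\<close> turns
  these into an integral over the larger shell.\<close>

lemma sphere_poincare:
  assumes dim: "DIM('a::euclidean_space) \<ge> 2"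
  shows "\<exists>C>0. \<forall>(f::'a \<Rightarrow> real) g s. s > 0 \<longrightarrow> f \<in> borel_measurable borel \<longrightarrow> g \<in> borel_measurable borel \<longrightarrow>
    (\<forall>x. norm x = s \<longrightarrow> (f has_derivative (\<lambda>v. g x \<bullet> v)) (at x)) \<longrightarrow> continuous_on (sphere 0 s) g \<longrightarrow>
    sphere_integral (1/2) 1 (\<lambda>x. sphere_integral (1/2) 1 (\<lambda>y. ennreal ((f x - f y)\<^sup>2)) s) s
      \<le> ennreal (C * s\<^sup>2) * sphere_integral (1/8) 1 (\<lambda>x. ennreal ((norm (g x))\<^sup>2)) s"
proof -
  let ?S = "shell (1/2) 1 :: 'a set"
  define m where "m = unit_ball_vol (real DIM('a)) * (1/8) ^ DIM('a)"
  define M where "M = measure lborel ?S"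
  have m: "m > 0" unfolding m_def by (simp add: unit_ball_vol_pos)
  have mball: "emeasure lborel (ball z (1/8)) = ennreal m" for z :: 'a
    unfolding m_def by (subst emeasure_ball) auto
  have Sfin: "emeasure lborel ?S < \<infinity>"
    by (rule emeasure_bounded_finite) (auto simp: shell_def bounded_iff)
  have M: "emeasure lborel ?S = ennreal M" "M \<ge> 0"
    unfolding M_def using Sfin by (auto simp: emeasure_eq_ennreal_measure)
  \<comment> \<open>\<open>4096 = 4 * 1024\<close>: two segments, each with the factor \<open>2\<close>; the summand \<open>1\<close> makes \<open>C\<close> positive\<close>
  define C where "C = 1 + 4096 * M * (2 ^ DIM('a) * M) / m"
  have C: "C > 0" using M m by (auto simp: C_def intro!: add_pos_nonneg)
  show ?thesis
  proof (intro exI[of _ C] conjI allI impI C)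
    fix f :: "'a \<Rightarrow> real" and g s
    assume s: "s > 0" and [measurable]: "f \<in> borel_measurable borel" "g \<in> borel_measurable borel"
      and deriv: "\<forall>x. norm x = s \<longrightarrow> (f has_derivative (\<lambda>v. g x \<bullet> v)) (at x)"
      and cont: "continuous_on (sphere 0 s) g"
    define h where "h x = f ((s / norm x) *\<^sub>R x)" for x
    define K where "K z = indicator (shell (1/8) 1) z * ennreal ((norm (g ((s / norm z) *\<^sub>R z)))\<^sup>2)" for z
    define B where "B x y = (\<integral>\<^sup>+t. indicator {0..1::real} t * K ((1 - t) *\<^sub>R x + t *\<^sub>R y) \<partial>lborel)" for x y
    have [measurable]: "h \<in> borel_measurable borel" "K \<in> borel_measurable borel"
      unfolding h_def K_def by measurable
    have [measurable]: "(\<lambda>(x,y). B x y) \<in> borel_measurable (borel \<Otimes>\<^sub>M borel)"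
      unfolding B_def by measurable
    have intK: "(\<integral>\<^sup>+x. K x \<partial>lborel) = sphere_integral (1/8) 1 (\<lambda>x. ennreal ((norm (g x))\<^sup>2)) s"
      unfolding K_def sphere_integral_def by simp
    define k where "k = ennreal (1024 * s\<^sup>2)"
    have est: "ennreal ((h x - h y)\<^sup>2) \<le> k * B x y"
      if "norm x \<le> 1" "norm y \<le> 1" and seg: "\<And>t. 0 \<le> t \<Longrightarrow> t \<le> 1 \<Longrightarrow> 1/8 \<le> norm ((1 - t) *\<^sub>R x + t *\<^sub>R y)" for x y
    proof -
      have "norm ((1 - t) *\<^sub>R x + t *\<^sub>R y) \<le> 1" if "0 \<le> t" "t \<le> 1" for t
        using convexD[OF convex_cball[of "0::'a" 1], of x y "1-t" t] that \<open>norm x \<le> 1\<close> \<open>norm y \<le> 1\<close> by auto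
      hence "B x y = (\<integral>\<^sup>+t. indicator {0..1} t *
        ennreal ((norm (g ((s / norm ((1 - t) *\<^sub>R x + t *\<^sub>R y)) *\<^sub>R ((1 - t) *\<^sub>R x + t *\<^sub>R y))))\<^sup>2) \<partial>lborel)"
        unfolding B_def K_def using seg by (intro nn_integral_cong) (auto simp: indicator_def shell_def)
      thus ?thesis unfolding k_def h_def using radial_segment_estimate[OF s _ cont that] deriv by simp
    qed
    have chain: "ennreal m * ennreal ((h x - h y)\<^sup>2) \<le> (\<integral>\<^sup>+z. indicator ?S z * (2 * k * B x z + 2 * k * B y z) \<partial>lborel)"
      if xS: "x \<in> ?S" and yS: "y \<in> ?S" for x y
    proof -
      have n: "1/2 \<le> norm x" "1/2 \<le> norm y" "norm x \<le> 1" "norm y \<le> 1" using that by (auto simp: shell_def)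
      obtain z0 :: 'a where z0: "ball z0 (1/8) \<subseteq> ?S"
        "\<And>z t. z \<in> ball z0 (1/8) \<Longrightarrow> 0 \<le> t \<Longrightarrow> t \<le> 1 \<Longrightarrow> 1/8 \<le> norm ((1 - t) *\<^sub>R x + t *\<^sub>R z)"
        "\<And>z t. z \<in> ball z0 (1/8) \<Longrightarrow> 0 \<le> t \<Longrightarrow> t \<le> 1 \<Longrightarrow> 1/8 \<le> norm ((1 - t) *\<^sub>R y + t *\<^sub>R z)"
        using intermediate_ball_exists[OF dim n(1,2)] by metis
      have "ennreal m * ennreal ((h x - h y)\<^sup>2) = (\<integral>\<^sup>+z. indicator (ball z0 (1/8)) z * ennreal ((h x - h y)\<^sup>2) \<partial>lborel)"
        by (subst nn_integral_multc) (auto simp: mball intro!: borel_measurable_indicator)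
      also have "\<dots> \<le> (\<integral>\<^sup>+z. indicator ?S z * (2 * k * B x z + 2 * k * B y z) \<partial>lborel)"
      proof (rule nn_integral_mono, goal_cases)
        case (1 z)
        show ?case
        proof (cases "z \<in> ball z0 (1/8)")
          case True
          hence zS: "z \<in> ?S" using z0 by auto
          have nz: "norm z \<le> 1" using zS by (simp add: shell_def)
          have "(h x - h y)\<^sup>2 \<le> 2 * (h x - h z)\<^sup>2 + 2 * (h y - h z)\<^sup>2"
            using zero_le_power2[of "h x + h y - 2 * h z"] by (simp add: power2_eq_square algebra_simps)
          hence "ennreal ((h x - h y)\<^sup>2) \<le> ennreal (2 * (h x - h z)\<^sup>2 + 2 * (h y - h z)\<^sup>2)" by (rule ennreal_leI)
          also have "\<dots> = 2 * ennreal ((h x - h z)\<^sup>2) + 2 * ennreal ((h y - h z)\<^sup>2)"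
            by (simp add: ennreal_plus ennreal_mult)
          also have "\<dots> \<le> 2 * (k * B x z) + 2 * (k * B y z)"
            using True by (intro add_mono mult_left_mono est n nz z0) auto
          finally show ?thesis using zS True by (simp add: mult.assoc)
        qed auto
      qed
      finally show ?thesis .
    qed
    have BB: "(\<integral>\<^sup>+x. \<integral>\<^sup>+y. indicator ?S x * indicator ?S y * B x y \<partial>lborel \<partial>lborel)
       \<le> ennreal (2 ^ DIM('a)) * ennreal M * (\<integral>\<^sup>+x. K x \<partial>lborel)"
      unfolding B_def M(1)[symmetric] by (rule nn_integral_segment_le) auto
    define V where "V = (\<integral>\<^sup>+x. \<integral>\<^sup>+y. indicator ?S x * indicator ?S y * ennreal ((h x - h y)\<^sup>2) \<partial>lborel \<partial>lborel)"
    have "ennreal m * V = (\<integral>\<^sup>+x. \<integral>\<^sup>+y. indicator ?S x * indicator ?S y * (ennreal m * ennreal ((h x - h y)\<^sup>2)) \<partial>lborel \<partial>lborel)"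
      unfolding V_def by (simp add: nn_integral_cmult[symmetric] mult_ac)
    also have "\<dots> \<le> (\<integral>\<^sup>+x. \<integral>\<^sup>+y. indicator ?S x * indicator ?S y * (\<integral>\<^sup>+z. indicator ?S z * (2 * k * B x z + 2 * k * B y z) \<partial>lborel) \<partial>lborel \<partial>lborel)"
      proof (intro nn_integral_mono, goal_cases)
      case (1 x y)
      thus ?case using chain[of x y] by (cases "x \<in> ?S"; cases "y \<in> ?S") auto
    qed
    also have "\<dots> = (\<integral>\<^sup>+x. \<integral>\<^sup>+y. (indicator ?S y * (2 * k * (\<integral>\<^sup>+z. indicator ?S x * indicator ?S z * B x z \<partial>lborel))
           + indicator ?S x * (2 * k * (\<integral>\<^sup>+z. indicator ?S y * indicator ?S z * B y z \<partial>lborel))) \<partial>lborel \<partial>lborel)"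
      by (intro nn_integral_cong) 
         (auto simp: nn_integral_cmult[symmetric] nn_integral_add[symmetric] indicator_def algebra_simps intro!: nn_integral_cong)
    also have "\<dots> = 2 * (ennreal M * (2 * k * (\<integral>\<^sup>+x. \<integral>\<^sup>+y. indicator ?S x * indicator ?S y * B x y \<partial>lborel \<partial>lborel)))"
      by (simp add: nn_integral_add nn_integral_cmult nn_integral_multc M(1) mult_2)
    also have "\<dots> \<le> 2 * (ennreal M * (2 * k * (ennreal (2 ^ DIM('a)) * ennreal M * (\<integral>\<^sup>+x. K x \<partial>lborel))))"
      by (intro mult_left_mono BB) auto
    also have "\<dots> = ennreal (4096 * M * (2 ^ DIM('a) * M) * s\<^sup>2) * (\<integral>\<^sup>+x. K x \<partial>lborel)"
      using M(2) unfolding k_def by (simp add: ennreal_mult[symmetric] mult.assoc[symmetric] ennreal_numeral[symmetric] del: ennreal_numeral) (simp add: mult_ac)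
    also have "\<dots> \<le> ennreal (m * (C * s\<^sup>2)) * (\<integral>\<^sup>+x. K x \<partial>lborel)"
      using m by (intro mult_right_mono ennreal_leI) (auto simp: C_def field_simps)
    also have "\<dots> = ennreal m * (ennreal (C * s\<^sup>2) * (\<integral>\<^sup>+x. K x \<partial>lborel))"
      using m C by (simp add: ennreal_mult mult.assoc)
    finally have "V \<le> ennreal (C * s\<^sup>2) * (\<integral>\<^sup>+x. K x \<partial>lborel)"
      using m by (simp add: ennreal_mult_le_mult_iff)
    moreover have "V = sphere_integral (1/2) 1 (\<lambda>x. sphere_integral (1/2) 1 (\<lambda>y. ennreal ((f x - f y)\<^sup>2)) s) s"
      unfolding V_def sphere_integral_def h_def by (simp add: nn_integral_cmult[symmetric] mult_ac)
    ultimately show "sphere_integral (1/2) 1 (\<lambda>x. sphere_integral (1/2) 1 (\<lambda>y. ennreal ((f x - f y)\<^sup>2)) s) s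
      \<le> ennreal (C * s\<^sup>2) * sphere_integral (1/8) 1 (\<lambda>x. ennreal ((norm (g x))\<^sup>2)) s" by (simp add: intK)
  qed
qed

section \<open>The Caccioppoli inequality for smooth subsolutions\<close>

lemma integral_lborel_translate:
  fixes f :: "'a::euclidean_space \<Rightarrow> real"
  assumes [measurable]: "f \<in> borel_measurable borel"
  shows "integral\<^sup>L lborel (\<lambda>x. f (x + c)) = integral\<^sup>L lborel f"
proof -
  have "integral\<^sup>L lborel f = integral\<^sup>L (distr lborel borel ((+) c)) f" by (simp add: lborel_distr_plus)
  also have "\<dots> = integral\<^sup>L lborel (\<lambda>x. f (c + x))" by (subst integral_distr) auto
  finally show ?thesis by (simp add: add.commute)
qed

lemma integrable_continuous_cball:
  fixes f :: "'a::euclidean_space \<Rightarrow> real"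
  assumes f: "continuous_on UNIV f" and 0: "\<And>x. norm x > R \<Longrightarrow> f x = 0"
  shows "integrable lborel f"
proof -
  have "integrable lborel (\<lambda>x. indicator (cball 0 R) x *\<^sub>R f x)"
    by (rule borel_integrable_compact) (auto intro: continuous_on_subset[OF f])
  also have "(\<lambda>x. indicator (cball 0 R) x *\<^sub>R f x) = f"
    using 0 by (auto simp: indicator_def fun_eq_iff not_le)
  finally show ?thesis .
qed

text \<open>The divergence theorem for fields of compact support, one direction at a time: the difference
  quotients of \<open>F\<close> integrate to zero by translation invariance and converge dominatedly.\<close>

lemma integral_directional_derivative_eq_0:
  fixes F F' :: "'a::euclidean_space \<Rightarrow> real"
  assumes F: "continuous_on UNIV F" and F': "continuous_on UNIV F'"
    and deriv: "\<And>x. ((\<lambda>t. F (x + t *\<^sub>R b)) has_real_derivative F' x) (at 0)"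
    and supp: "\<And>x. norm x > R \<Longrightarrow> F x = 0" "\<And>x. norm x > R \<Longrightarrow> F' x = 0"
    and b: "norm b = 1"
  shows "integrable lborel F'" and "integral\<^sup>L lborel F' = 0"
proof -
  show int': "integrable lborel F'" by (rule integrable_continuous_cball[OF F' supp(2)])
  have int: "integrable lborel F" by (rule integrable_continuous_cball[OF F supp(1)])
  have [measurable]: "F \<in> borel_measurable borel" "F' \<in> borel_measurable borel"
    using F F' by (auto intro: borel_measurable_continuous_onI)
  have "compact (F' ` cball 0 R)" by (intro compact_continuous_image continuous_on_subset[OF F']) auto
  hence "bounded (F' ` cball 0 R)" by (rule compact_imp_bounded)
  then obtain M where "\<forall>x\<in>cball 0 R. \<bar>F' x\<bar> \<le> M" unfolding bounded_iff by auto
  hence M: "\<And>x. x \<in> cball 0 R \<Longrightarrow> \<bar>F' x\<bar> \<le> M" by blast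
  have M': "\<bar>F' x\<bar> \<le> max 0 M" for x using M[of x] supp(2)[of x] by (cases "norm x \<le> R") auto
  define D where "D n x = (F (x + (1 / Suc n) *\<^sub>R b) - F x) * Suc n" for n :: nat and x
  have derivt: "((\<lambda>t. F (x + t *\<^sub>R b)) has_real_derivative F' (x + u *\<^sub>R b)) (at u)" for x u
  proof -
    have "((\<lambda>t. F (x + u *\<^sub>R b + t *\<^sub>R b)) has_real_derivative F' (x + u *\<^sub>R b)) (at (u - u))"
      using deriv[of "x + u *\<^sub>R b"] by simp
    hence "((\<lambda>t. F (x + u *\<^sub>R b + (t - u) *\<^sub>R b)) has_real_derivative F' (x + u *\<^sub>R b)) (at u)"
      using DERIV_at_within_shift[of _ _ "-u" u UNIV] by (auto simp: DERIV_shift[where z="-u"] o_def)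
    thus ?thesis by (simp add: algebra_simps)
  qed
  have int_shift: "integrable lborel (\<lambda>x. F (x + c))" for c
  proof -
    have "integrable (distr lborel borel ((+) c)) F" using int by (simp add: lborel_distr_plus)
    hence "integrable lborel (\<lambda>x. F (c + x))" by (subst (asm) integrable_distr_eq) auto
    thus ?thesis by (simp add: add.commute)
  qed
  have Dint: "integral\<^sup>L lborel (D n) = 0" for n
    unfolding D_def using int int_shift integral_lborel_translate[of F "(1 / Suc n) *\<^sub>R b"] by simp
  have "(\<lambda>n. integral\<^sup>L lborel (D n)) \<longlonglongrightarrow> integral\<^sup>L lborel F'"
  proof (rule integral_dominated_convergence[where w="\<lambda>x. indicator (cball 0 (R + 1)) x *\<^sub>R max 0 M"])
    show "integrable lborel (\<lambda>x. indicator (cball 0 (R + 1)) x *\<^sub>R max 0 M)"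
      by (rule borel_integrable_compact) auto
    show "AE x in lborel. (\<lambda>n. D n x) \<longlonglongrightarrow> F' x"
    proof (rule AE_I2)
      fix x
      have "((\<lambda>t. (F (x + t *\<^sub>R b) - F x) / t) \<longlongrightarrow> F' x) (at 0)"
        using deriv[of x] unfolding has_field_derivative_iff by simp
      moreover have "filterlim (\<lambda>n. 1 / real (Suc n)) (at 0) sequentially"
        unfolding filterlim_at using LIMSEQ_inverse_real_of_nat by (auto simp: inverse_eq_divide)
      ultimately have "(\<lambda>n. (F (x + (1 / Suc n) *\<^sub>R b) - F x) / (1 / Suc n)) \<longlonglongrightarrow> F' x"
        by (rule filterlim_compose)
      thus "(\<lambda>n. D n x) \<longlonglongrightarrow> F' x" by (simp add: D_def)
    qed
    fix n
    show "AE x in lborel. norm (D n x) \<le> indicator (cball 0 (R + 1)) x *\<^sub>R max 0 M"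
    proof (rule AE_I2)
      fix x
      show "norm (D n x) \<le> indicator (cball 0 (R + 1)) x *\<^sub>R max 0 M"
      proof (cases "norm x \<le> R + 1")
        case True
        have "\<exists>u. 0 < u \<and> u < 1 / Suc n \<and> F (x + (1 / Suc n) *\<^sub>R b) - F (x + 0 *\<^sub>R b) = (1 / Suc n - 0) * F' (x + u *\<^sub>R b)"
          by (rule MVT2) (use derivt in auto)
        then obtain u where "F (x + (1 / Suc n) *\<^sub>R b) - F x = (1 / Suc n) * F' (x + u *\<^sub>R b)" by auto
        hence "D n x = F' (x + u *\<^sub>R b)" by (simp add: D_def)
        thus ?thesis using M' True by auto
      next
        case False
        have "norm x \<le> norm (x + (1 / Suc n) *\<^sub>R b) + norm ((1 / Suc n) *\<^sub>R b)"
          by (metis add_diff_cancel norm_triangle_ineq4)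
        moreover have "norm ((1 / Suc n) *\<^sub>R b) \<le> 1" using b by simp
        ultimately have "norm (x + (1 / Suc n) *\<^sub>R b) > R" using False by linarith
        hence "D n x = 0" using False supp(1)[of x] supp(1)[of "x + (1 / Suc n) *\<^sub>R b"] by (simp add: D_def)
        thus ?thesis using False by simp
      qed
    qed
  qed (auto simp: D_def[abs_def])
  thus "integral\<^sup>L lborel F' = 0" unfolding Dint using LIMSEQ_unique tendsto_const by blast
qed

lemma continuous_on_UNIV_vanishing_outside:
  fixes F :: "'a::euclidean_space \<Rightarrow> 'b::real_normed_vector"
  assumes "continuous_on (ball 0 r) F" "\<And>x. norm x > \<beta> \<Longrightarrow> F x = 0" "\<beta> < r"
  shows "continuous_on UNIV F"
proof -
  have "continuous_on (- cball 0 \<beta>) F"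
    using continuous_on_const[of "- cball 0 \<beta>" 0] by (rule continuous_on_eq) (use assms(2) in auto)
  hence "continuous_on (ball 0 r \<union> - cball 0 \<beta>) F"
    using assms(1) by (intro continuous_on_open_Un) auto
  moreover have "ball 0 r \<union> - cball (0::'a) \<beta> = UNIV" using assms(3) by auto
  ultimately show ?thesis by simp
qed

lemma continuous_on_UNIV_const_near_0:
  fixes F :: "'a::euclidean_space \<Rightarrow> 'b::real_normed_vector"
  assumes "continuous_on (- {0}) F" "\<And>x. norm x < \<alpha> \<Longrightarrow> F x = c" "0 < \<alpha>"
  shows "continuous_on UNIV F"
proof -
  have "continuous_on (ball 0 \<alpha>) F"
    using continuous_on_const[of "ball 0 \<alpha>" c] by (rule continuous_on_eq) (use assms(2) in auto)
  hence "continuous_on (ball 0 \<alpha> \<union> - {0}) F"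
    using assms(1) by (intro continuous_on_open_Un) auto
  moreover have "ball 0 \<alpha> \<union> - {0::'a} = UNIV" using assms(3) by auto
  ultimately show ?thesis by simp
qed

text \<open>The vector field \<open>2 f \<Gamma> \<eta> A \<nabla>f - f\<^sup>2 \<eta> A \<nabla>\<Gamma>\<close> has integral divergence zero, where \<open>\<Gamma>\<close> is the
  regularised kernel \<open>q powr p\<close> and \<open>\<eta>\<close> the radial cutoff. In its divergence the mixed terms
  \<open>\<nabla>f \<bullet> A \<nabla>\<Gamma>\<close> cancel; the terms with \<open>div (A \<nabla>f) \<ge> 0\<close> and with
  \<open>- div (A \<nabla>\<Gamma>) = - 2 N p \<kappa> q powr (p - 2) \<ge> 0\<close> have a good sign; what is left is the energy
  \<open>2 \<Gamma> \<eta> \<langle>A \<nabla>f, \<nabla>f\<rangle>\<close> and terms with \<open>\<nabla>\<eta> = - w(\<bar>x\<bar>) x / \<bar>x\<bar>\<close>, which are estimated by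
  \<open>q \<ge> \<bar>x\<bar>\<^sup>2 / L\<close>. The bound does not depend on \<open>\<kappa>\<close>.\<close>

lemma caccioppoli_smooth:
  fixes f :: "real^'n \<Rightarrow> real" and g :: "real^'n \<Rightarrow> real^'n" and d :: "'n \<Rightarrow> real^'n \<Rightarrow> real"
    and a :: "'n \<Rightarrow> real" and w \<psi> :: "real \<Rightarrow> real" and \<kappa> L r \<alpha> \<beta> :: real
  defines "p \<equiv> (2 - real CARD('n)) / 2"
  defines "q \<equiv> (\<lambda>x::real^'n. \<kappa> + (\<Sum>i\<in>UNIV. (x $ i)\<^sup>2 / a i))"
  assumes N: "CARD('n) \<ge> 2" and a: "\<And>i. 1 \<le> a i" "\<And>i. a i \<le> L" and \<kappa>: "\<kappa> > 0"
    and w: "continuous_on UNIV w" "\<And>s. 0 \<le> w s" "\<And>s. w s \<noteq> 0 \<Longrightarrow> \<alpha> \<le> s \<and> s \<le> \<beta>"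
    and ab: "0 < \<alpha>" "\<alpha> < \<beta>" "\<beta> < r"
    and \<psi>: "\<And>s. s > 0 \<Longrightarrow> (\<psi> has_real_derivative - w s) (at s)" "\<And>s. 0 \<le> \<psi> s" 
       "\<And>s. \<beta> < s \<Longrightarrow> \<psi> s = 0" "\<And>s. 0 \<le> s \<Longrightarrow> s < \<alpha> \<Longrightarrow> \<psi> s = \<psi> 0"
    and df: "\<And>x. x \<in> ball 0 r \<Longrightarrow> (f has_derivative (\<lambda>v. g x \<bullet> v)) (at x)"
    and dg: "\<And>i x. x \<in> ball 0 r \<Longrightarrow> ((\<lambda>t. g (x + t *\<^sub>R axis i 1) $ i) has_real_derivative d i x) (at 0)"
    and cg: "continuous_on (ball 0 r) g" and cd: "\<And>i. continuous_on (ball 0 r) (d i)"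
    and f0: "\<And>x. x \<in> ball 0 r \<Longrightarrow> 0 \<le> f x"
    and sub: "\<And>x. x \<in> ball 0 r \<Longrightarrow> 0 \<le> (\<Sum>i\<in>UNIV. a i * d i x)"
  shows "(\<integral>\<^sup>+x. ennreal ((\<Sum>i\<in>UNIV. a i * (g x $ i)\<^sup>2) * q x powr p * \<psi> (norm x)) \<partial>lborel) \<le>
    (\<integral>\<^sup>+x. ennreal ((real CARD('n) + 1) * L powr (1 - p) * 
        (w (norm x) / norm x ^ (CARD('n) - 1) * ((f x)\<^sup>2 + (norm x)\<^sup>2 * (norm (g x))\<^sup>2))) \<partial>lborel)"
proof -
  let ?N = "real CARD('n)"
  define \<eta> where "\<eta> x = \<psi> (norm x)" for x :: "real^'n"
  define \<eta>' where "\<eta>' i x = - (w (norm x) * (x $ i) / norm x)" for i and x :: "real^'n"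
  \<comment> \<open>the components of the field, and below their derivatives along the coordinate lines\<close>
  define V where "V i x = \<eta> x * (2 * a i * f x * g x $ i * q x powr p - 2 * p * (f x)\<^sup>2 * q x powr (p - 1) * x $ i)" for i x
  define V' where "V' i x = 2 * a i * (g x $ i)\<^sup>2 * q x powr p * \<eta> x + 2 * a i * f x * d i x * q x powr p * \<eta> x
     + \<eta>' i x * (2 * a i * f x * g x $ i * q x powr p - 2 * p * (f x)\<^sup>2 * q x powr (p - 1) * x $ i)
     - 2 * p * (f x)\<^sup>2 * \<eta> x * ((p - 1) * q x powr (p - 2) * (2 * (x $ i)\<^sup>2 / a i) + q x powr (p - 1))" for i x
  have a0: "a i > 0" for i using a(1)[of i] by linarith
  have L1: "1 \<le> L" using a order_trans by blast
  have p0: "p \<le> 0" using N by (simp add: p_def)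
  have q0: "q x > 0" for x unfolding q_def using a0 by (intro add_pos_nonneg \<kappa> sum_nonneg) (auto simp: less_imp_le)
  have \<eta>_out: "\<eta> x = 0" "\<eta>' i x = 0" if "norm x > \<beta>" for x i using that \<psi>(3) w(3)[of "norm x"] by (auto simp: \<eta>_def \<eta>'_def)
  have V_out: "V i x = 0" "V' i x = 0" if "norm x > \<beta>" for x i using \<eta>_out[OF that] by (auto simp: V_def V'_def)
  have dx: "((\<lambda>t. (x + t *\<^sub>R axis i 1) $ i) has_real_derivative 1) (at 0)" for x :: "real^'n" and i
    by (auto intro!: derivative_eq_intros)
  have dq: "((\<lambda>t. q (x + t *\<^sub>R axis i 1)) has_real_derivative 2 * x $ i / a i) (at 0)" for x i
  proof -
    have 1: "((\<lambda>t. ((x + t *\<^sub>R axis i 1) $ j)\<^sup>2 / a j) has_real_derivative (if j = i then 2 * x $ i / a i else 0)) (at 0)" for j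
      using less_imp_neq[OF a0[of i]] by (auto intro!: derivative_eq_intros simp: axis_def)
    have "((\<lambda>t. \<kappa> + (\<Sum>j\<in>UNIV. ((x + t *\<^sub>R axis i 1) $ j)\<^sup>2 / a j)) has_real_derivative
        0 + (\<Sum>j\<in>UNIV. if j = i then 2 * x $ i / a i else 0)) (at 0)"
      by (intro DERIV_add DERIV_const DERIV_sum 1)
    thus ?thesis unfolding q_def by simp
  qed
  have dqp: "((\<lambda>t. q (x + t *\<^sub>R axis i 1) powr c) has_real_derivative c * q x powr (c - 1) * (2 * x $ i / a i)) (at 0)" for x i c
    using DERIV_fun_powr[OF dq[of x i], where r=c] q0[of x] by simp
  have d\<eta>: "((\<lambda>t. \<eta> (x + t *\<^sub>R axis i 1)) has_real_derivative \<eta>' i x) (at 0)" for x i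
  proof (cases "x = 0")
    case True
    have "((\<lambda>t. \<psi> 0) has_real_derivative 0) (at 0)" by simp
    moreover have "\<forall>\<^sub>F t in nhds 0. \<psi> 0 = \<eta> (x + t *\<^sub>R axis i 1)"
      unfolding eventually_nhds_metric
      by (rule exI[of _ \<alpha>]) (use ab True in \<open>auto simp: \<eta>_def dist_norm norm_axis_1 intro!: \<psi>(4)[symmetric]\<close>)
    ultimately have "((\<lambda>t. \<eta> (x + t *\<^sub>R axis i 1)) has_real_derivative 0) (at 0)"
      using DERIV_cong_ev[OF refl, of "\<lambda>t. \<psi> 0" "\<lambda>t. \<eta> (x + t *\<^sub>R axis i 1)" 0 0 0] by blast
    thus ?thesis using True by (simp add: \<eta>'_def)
  next
    case False
    have "((\<lambda>t. x + t *\<^sub>R axis i 1) has_derivative (\<lambda>h. h *\<^sub>R axis i 1)) (at 0)"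
      by (auto intro!: derivative_eq_intros)
    moreover have "(norm has_derivative (\<lambda>h. h \<bullet> sgn x)) (at (x + 0 *\<^sub>R axis i 1))"
      using has_derivative_norm[OF False] by simp
    ultimately have "((\<lambda>t. norm (x + t *\<^sub>R axis i 1)) has_derivative (\<lambda>h. (h *\<^sub>R axis i 1) \<bullet> sgn x)) (at 0)"
      by (rule has_derivative_compose)
    hence 1: "((\<lambda>t. norm (x + t *\<^sub>R axis i 1)) has_real_derivative x $ i / norm x) (at 0)"
      unfolding has_field_derivative_def
      by (rule has_derivative_eq_rhs) (auto simp: sgn_div_norm inner_commute[of "axis i 1"] inner_axis divide_inverse fun_eq_iff)
    have "(\<psi> has_real_derivative - w (norm x)) (at (norm (x + 0 *\<^sub>R axis i 1)))" using \<psi>(1) False by simp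
    from DERIV_chain2[OF this 1] show ?thesis by (simp add: \<eta>_def \<eta>'_def)
  qed
  have df1: "((\<lambda>t. f (x + t *\<^sub>R axis i 1)) has_real_derivative g x $ i) (at 0)" if "x \<in> ball 0 r" for x i
  proof -
    have "((\<lambda>t. x + t *\<^sub>R axis i 1) has_derivative (\<lambda>h. h *\<^sub>R axis i 1)) (at 0)"
      by (auto intro!: derivative_eq_intros)
    moreover have "(f has_derivative (\<lambda>v. g x \<bullet> v)) (at (x + 0 *\<^sub>R axis i 1))" using df that by simp
    ultimately have "((\<lambda>t. f (x + t *\<^sub>R axis i 1)) has_derivative (\<lambda>h. g x \<bullet> (h *\<^sub>R axis i 1))) (at 0)"
      by (rule has_derivative_compose)
    thus ?thesis unfolding has_field_derivative_def
      by (rule has_derivative_eq_rhs) (auto simp: inner_axis fun_eq_iff)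
  qed
  have dV: "((\<lambda>t. V i (x + t *\<^sub>R axis i 1)) has_real_derivative V' i x) (at 0)" for x i
  proof (cases "x \<in> ball 0 r")
    case True
    \<comment> \<open>the product rule for \<open>V i\<close>; the two terms with \<open>F * G * R * X\<close> cancel because \<open>\<partial>\<^sub>i q = 2 * X / A\<close>\<close>
    have alg: "E' * (2 * A * F * G * Q - 2 * p * F\<^sup>2 * R * X) +
       (2 * A * ((G * F' + D * F) * Q + p * R * (2 * X / A) * (F * G)) -
        2 * p * ((2 * F * F' * R + (p - 1) * S * (2 * X / A) * F\<^sup>2) * X + 1 * (F\<^sup>2 * R))) * E
      = 2 * A * G\<^sup>2 * Q * E + 2 * A * F * D * Q * E + E' * (2 * A * F * G * Q - 2 * p * F\<^sup>2 * R * X)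
        - 2 * p * F\<^sup>2 * E * ((p - 1) * S * (2 * X\<^sup>2 / A) + R)"
      if "A \<noteq> 0" "F' = G" for E E' A F F' G Q R X S D :: real
      using that by (simp add: field_simps power2_eq_square)
    have d1: "((\<lambda>t. f (x + t *\<^sub>R axis i 1) * g (x + t *\<^sub>R axis i 1) $ i) has_real_derivative
        (g x $ i * g x $ i + d i x * f x)) (at 0)"
      using DERIV_mult[OF df1[OF True, of i] dg[OF True, of i]] by simp
    have d2: "((\<lambda>t. (f (x + t *\<^sub>R axis i 1))\<^sup>2) has_real_derivative 2 * f x * g x $ i) (at 0)"
      using DERIV_power[OF df1[OF True, of i], of 2] by (simp add: mult_ac)
    have d3: "((\<lambda>t. 2 * a i * (f (x + t *\<^sub>R axis i 1) * g (x + t *\<^sub>R axis i 1) $ i * q (x + t *\<^sub>R axis i 1) powr p)) has_real_derivative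
        2 * a i * ((g x $ i * g x $ i + d i x * f x) * q x powr p + p * q x powr (p - 1) * (2 * x $ i / a i) * (f x * g x $ i))) (at 0)"
      using DERIV_cmult[OF DERIV_mult[OF d1 dqp[of x i p]], of "2 * a i"] by simp
    have d4: "((\<lambda>t. 2 * p * ((f (x + t *\<^sub>R axis i 1))\<^sup>2 * q (x + t *\<^sub>R axis i 1) powr (p - 1) * (x + t *\<^sub>R axis i 1) $ i)) has_real_derivative
        2 * p * ((2 * f x * g x $ i * q x powr (p - 1) + (p - 1) * q x powr (p - 2) * (2 * x $ i / a i) * (f x)\<^sup>2) * x $ i
          + 1 * ((f x)\<^sup>2 * q x powr (p - 1)))) (at 0)"
      using DERIV_cmult[OF DERIV_mult[OF DERIV_mult[OF d2 dqp[of x i "p - 1"]] dx[of x i]], of "2 * p"] by simp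
    have "((\<lambda>t. \<eta> (x + t *\<^sub>R axis i 1) * (2 * a i * (f (x + t *\<^sub>R axis i 1) * g (x + t *\<^sub>R axis i 1) $ i * q (x + t *\<^sub>R axis i 1) powr p)
        - 2 * p * ((f (x + t *\<^sub>R axis i 1))\<^sup>2 * q (x + t *\<^sub>R axis i 1) powr (p - 1) * (x + t *\<^sub>R axis i 1) $ i))) has_real_derivative V' i x) (at 0)"
      apply (rule DERIV_cong[OF DERIV_mult[OF d\<eta> DERIV_diff[OF d3 d4]]])
      using alg[of "a i" "g x $ i" "g x $ i" "\<eta>' i x" "f x" "q x powr p" "q x powr (p-1)" "x $ i" "d i x" "q x powr (p-2)" "\<eta> x"] a0[of i]
      unfolding V'_def by (simp add: mult.assoc)
    thus ?thesis unfolding V_def by (simp add: mult.assoc)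
  next
    case False
    hence x: "norm x > \<beta>" using ab by auto
    have "((\<lambda>t. 0) has_real_derivative 0) (at 0)" by simp
    moreover have "\<forall>\<^sub>F t in nhds 0. 0 = V i (x + t *\<^sub>R axis i 1)"
      unfolding eventually_nhds_metric
    proof (intro exI[of _ "norm x - \<beta>"] conjI allI impI)
      fix t :: real assume "dist t 0 < norm x - \<beta>"
      hence "norm (t *\<^sub>R axis i 1 :: real^'n) < norm x - \<beta>" by (simp add: norm_axis_1 dist_norm)
      hence "norm (x + t *\<^sub>R axis i 1) > \<beta>" using norm_diff_ineq[of x "t *\<^sub>R axis i 1"] by linarith
      thus "0 = V i (x + t *\<^sub>R axis i 1)" using V_out by simp
    qed (use x in simp)
    ultimately have "((\<lambda>t. V i (x + t *\<^sub>R axis i 1)) has_real_derivative 0) (at 0)"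
      using DERIV_cong_ev[OF refl, of "\<lambda>t. 0" "\<lambda>t. V i (x + t *\<^sub>R axis i 1)" 0 0 0] by blast
    thus ?thesis using V_out[OF x] by simp
  qed
  define \<omega> where "\<omega> x = w (norm x) / norm x ^ (CARD('n) - 1)" for x :: "real^'n"
  have wcomp: "continuous_on S (\<lambda>x. w (norm x))" for S :: "(real^'n) set"
    by (rule continuous_on_compose2[OF w(1)]) (auto intro: continuous_intros)
  have w_in: "w (norm x) = 0" if "norm x < \<alpha>" for x :: "real^'n" using w(3)[of "norm x"] that by force
  have w_out: "w (norm x) = 0" if "norm x > \<beta>" for x :: "real^'n" using w(3)[of "norm x"] that by force
  have c\<omega>: "continuous_on UNIV \<omega>"
    by (rule continuous_on_UNIV_const_near_0[OF _ _ ab(1), where c=0])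
       (use w_in in \<open>auto simp: \<omega>_def intro!: continuous_intros wcomp\<close>)
  have c\<eta>': "continuous_on UNIV (\<eta>' i)" for i
    by (rule continuous_on_UNIV_const_near_0[OF _ _ ab(1), where c=0])
       (use w_in in \<open>auto simp: \<eta>'_def intro!: continuous_intros wcomp\<close>)
  have c\<psi>: "continuous_on {0<..} \<psi>"
    using \<psi>(1) by (meson DERIV_isCont continuous_at_imp_continuous_on greaterThan_iff)
  have c\<eta>: "continuous_on UNIV \<eta>"
    by (rule continuous_on_UNIV_const_near_0[OF _ _ ab(1), where c="\<psi> 0"])
       (auto simp: \<eta>_def intro!: \<psi>(4) continuous_on_compose2[OF c\<psi>] continuous_intros)
  have cq: "continuous_on S (\<lambda>x. q x powr c)" for S c
    by (intro continuous_on_powr continuous_on_const) 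
       (auto simp: q_def less_imp_neq[OF a0] less_imp_neq[OF q0[unfolded q_def], symmetric] intro!: continuous_intros, (metis a0 less_irrefl)?)
  have cf: "continuous_on (ball 0 r) f"
    using df by (meson continuous_at_imp_continuous_on has_derivative_continuous)
  have cgi: "continuous_on (ball 0 r) (\<lambda>x. g x $ i)" for i using cg by (intro continuous_intros)
  have sub\<eta>: "continuous_on S \<eta>" "continuous_on S (\<eta>' i)" "continuous_on S \<omega>" for S i
    using c\<eta> c\<eta>' c\<omega> by (auto intro: continuous_on_subset)
  have cV: "continuous_on UNIV (V i)" for i
    by (rule continuous_on_UNIV_vanishing_outside[OF _ V_out(1) ab(3)])
       (auto simp: V_def intro!: continuous_intros sub\<eta> cf cgi cq)
  have cV': "continuous_on UNIV (V' i)" for i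
    by (rule continuous_on_UNIV_vanishing_outside[OF _ V_out(2) ab(3)])
       (use a0 in \<open>auto simp: V'_def less_imp_neq[symmetric] intro!: continuous_intros sub\<eta> cf cgi cq cd\<close>)
  have V'int: "integrable lborel (V' i)" "integral\<^sup>L lborel (V' i) = 0" for i
    using integral_directional_derivative_eq_0[OF cV[of i] cV'[of i] dV V_out(1) V_out(2)] by (auto simp: norm_axis_1)
  define E where "E x = (\<Sum>i\<in>UNIV. a i * (g x $ i)\<^sup>2) * q x powr p * \<psi> (norm x)" for x
  define Q where "Q x = (?N + 1) * L powr (1 - p) * (\<omega> x * ((f x)\<^sup>2 + (norm x)\<^sup>2 * (norm (g x))\<^sup>2))" for x
  have E_out: "E x = 0" "Q x = 0" if "norm x > \<beta>" for x 
    using \<eta>_out[OF that] w_out[OF that] by (auto simp: E_def Q_def \<eta>_def \<omega>_def)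
  have "continuous_on UNIV E"
    by (rule continuous_on_UNIV_vanishing_outside[OF _ E_out(1) ab(3)])
       (auto simp: E_def \<eta>_def[symmetric] intro!: continuous_intros sub\<eta> cf cgi cq)
  hence Eint: "integrable lborel E" by (rule integrable_continuous_cball) (rule E_out)
  have "continuous_on UNIV Q"
    by (rule continuous_on_UNIV_vanishing_outside[OF _ E_out(2) ab(3)])
       (auto simp: Q_def intro!: continuous_intros sub\<eta> cf cg)
  hence Qint: "integrable lborel Q" by (rule integrable_continuous_cball) (rule E_out)
  have E0: "0 \<le> E x" for x
    unfolding E_def using \<psi>(2) a0 by (intro mult_nonneg_nonneg sum_nonneg) (auto simp: less_imp_le)
  have Q0: "0 \<le> Q x" for x
    unfolding Q_def \<omega>_def using w(2) L1 by (intro mult_nonneg_nonneg add_nonneg_nonneg) auto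
  \<comment> \<open>the four kinds of terms of \<open>V' i x\<close>, summed over \<open>i\<close>, are treated in \<open>e1\<close> to \<open>e4\<close>\<close>
  have main: "E x \<le> (\<Sum>i\<in>UNIV. V' i x) + Q x" for x
  proof (cases "norm x > \<beta>")
    case True thus ?thesis using E_out V_out by simp
  next
    case False
    hence x: "x \<in> ball 0 r" using ab by auto
    define S where "S = (\<Sum>i\<in>UNIV. a i * g x $ i * x $ i)"
    have e1: "(\<Sum>i\<in>UNIV. 2 * a i * (g x $ i)\<^sup>2 * q x powr p * \<eta> x) = 2 * E x"
      unfolding E_def \<eta>_def by (simp add: sum_distrib_left sum_distrib_right mult_ac)
    have e2: "(\<Sum>i\<in>UNIV. 2 * a i * f x * d i x * q x powr p * \<eta> x) \<ge> 0"
    proof -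
      have "(\<Sum>i\<in>UNIV. 2 * a i * f x * d i x * q x powr p * \<eta> x) = 2 * f x * q x powr p * \<eta> x * (\<Sum>i\<in>UNIV. a i * d i x)"
        by (simp add: sum_distrib_left mult_ac)
      thus ?thesis using f0[OF x] sub[OF x] \<psi>(2) by (simp add: \<eta>_def)
    qed
    have n2: "(\<Sum>i\<in>UNIV. (x $ i)\<^sup>2) = (norm x)\<^sup>2"
      unfolding power2_norm_eq_inner by (simp add: inner_vec_def power2_eq_square)
    have e4: "(\<Sum>i\<in>UNIV. 2 * p * (f x)\<^sup>2 * \<eta> x * ((p - 1) * q x powr (p - 2) * (2 * (x $ i)\<^sup>2 / a i) + q x powr (p - 1))) \<le> 0"
    proof -
      have "(\<Sum>i\<in>UNIV. ((p - 1) * q x powr (p - 2) * (2 * (x $ i)\<^sup>2 / a i) + q x powr (p - 1)))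
         = (p - 1) * q x powr (p - 2) * 2 * (\<Sum>i\<in>UNIV. (x $ i)\<^sup>2 / a i) + ?N * q x powr (p - 1)"
        by (simp add: sum.distrib sum_distrib_left mult_ac)
      also have "(\<Sum>i\<in>UNIV. (x $ i)\<^sup>2 / a i) = q x - \<kappa>" by (simp add: q_def)
      also have "(p - 1) * q x powr (p - 2) * 2 * (q x - \<kappa>) + ?N * q x powr (p - 1) = ?N * \<kappa> * q x powr (p - 2)"
      proof -
        have "q x powr (p - 1) = q x * q x powr (p - 2)"
          using powr_mult_base[of "q x" "p - 2"] q0[of x] by simp
        moreover have "(p - 1) * 2 = - ?N" by (simp add: p_def field_simps)
        hence "(p - 1) * q x powr (p - 2) * 2 * (q x - \<kappa>) = - ?N * (q x powr (p - 2) * (q x - \<kappa>))"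
          by (metis mult.assoc mult.commute)
        ultimately show ?thesis by (simp add: algebra_simps)
      qed
      finally have "(\<Sum>i\<in>UNIV. ((p - 1) * q x powr (p - 2) * (2 * (x $ i)\<^sup>2 / a i) + q x powr (p - 1))) \<ge> 0"
        using \<kappa> by simp
      moreover have "2 * p * (f x)\<^sup>2 * \<eta> x \<le> 0" using p0 \<psi>(2)
        by (simp add: \<eta>_def mult_nonpos_nonneg)
      ultimately show ?thesis unfolding sum_distrib_left[symmetric] by (rule mult_nonpos_nonneg[rotated])
    qed
    have e3: "(\<Sum>i\<in>UNIV. \<eta>' i x * (2 * a i * f x * g x $ i * q x powr p - 2 * p * (f x)\<^sup>2 * q x powr (p - 1) * x $ i))
       = - (w (norm x) / norm x * (2 * f x * q x powr p * S - 2 * p * (f x)\<^sup>2 * q x powr (p - 1) * (norm x)\<^sup>2))"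
      unfolding S_def n2[symmetric] \<eta>'_def
      by (simp add: sum_distrib_left right_diff_distrib sum_subtractf sum_negf power2_eq_square mult_ac)
    have "w (norm x) / norm x * (2 * f x * q x powr p * S - 2 * p * (f x)\<^sup>2 * q x powr (p - 1) * (norm x)\<^sup>2) \<le> Q x"
    proof (cases "w (norm x) = 0")
      case True thus ?thesis using Q0 by simp
    next
      case False
      define n where "n = norm x"
      have n: "n > 0" using w(3)[OF False] ab(1) unfolding n_def by linarith
      define X where "X = (f x)\<^sup>2 + n\<^sup>2 * (norm (g x))\<^sup>2"
      have L0: "L > 0" using L1 by linarith
      \<comment> \<open>this lower bound controls both negative powers of \<open>q\<close> uniformly in \<open>\<kappa>\<close>\<close>
      have qL: "n\<^sup>2 / L \<le> q x"
      proof -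
        have "n\<^sup>2 / L = (\<Sum>i\<in>UNIV. (x $ i)\<^sup>2 / L)" by (simp add: n_def n2[symmetric] sum_divide_distrib)
        also have "\<dots> \<le> (\<Sum>i\<in>UNIV. (x $ i)\<^sup>2 / a i)"
          using a a0 L0 by (intro sum_mono divide_left_mono) auto
        finally show ?thesis using \<kappa> by (simp add: q_def)
      qed
      have qc: "q x powr c \<le> L powr (- c) * n powr (2 * c)" if "c \<le> 0" for c
      proof -
        have "q x powr c \<le> (n\<^sup>2 / L) powr c" using n L0 qL that by (intro powr_mono2') auto
        also have "\<dots> = L powr (- c) * n powr (2 * c)"
          using n L0 by (simp add: powr_divide powr_minus_divide powr_powr[symmetric] powr_numeral)
        finally show ?thesis .
      qed
      have nN: "n powr (2 * p) = n * n / n ^ CARD('n)"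
      proof -
        have "2 * p = 2 - ?N" by (simp add: p_def)
        thus ?thesis using n by (simp add: powr_diff powr_realpow powr_numeral power2_eq_square)
      qed
      have nN1: "n powr (2 * (p - 1)) = 1 / n ^ CARD('n)"
      proof -
        have "2 * (p - 1) = - ?N" by (simp add: p_def field_simps)
        thus ?thesis using n by (simp add: powr_minus_divide powr_realpow)
      qed
      have S: "\<bar>S\<bar> \<le> L * (norm (g x) * n)"
      proof -
        have "\<bar>S\<bar> = \<bar>(\<chi> i. a i * g x $ i) \<bullet> x\<bar>" by (simp add: S_def inner_vec_def)
        also have "\<dots> \<le> norm (\<chi> i. a i * g x $ i) * n" unfolding n_def by (rule Cauchy_Schwarz_ineq2)
        also have "norm (\<chi> i. a i * g x $ i) \<le> norm (L *\<^sub>R g x)"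
          using a a0 L0 by (intro norm_le_componentwise_cart) (auto simp: abs_mult less_imp_le intro!: mult_mono)
        finally show ?thesis using n L0 by (simp add: mult_right_mono mult.assoc)
      qed
      have "2 * f x * q x powr p * S \<le> (q x powr p * L) * (2 * f x * (norm (g x) * n))"
      proof -
        have "2 * f x * q x powr p * S \<le> 2 * f x * q x powr p * (L * (norm (g x) * n))"
          using S f0[OF x] by (intro mult_left_mono) auto
        thus ?thesis by (simp add: mult_ac)
      qed
      also have "\<dots> \<le> (q x powr p * L) * X"
      proof (rule mult_left_mono)
        show "2 * f x * (norm (g x) * n) \<le> X"
          using zero_le_power2[of "f x - norm (g x) * n"] by (simp add: X_def power2_eq_square algebra_simps)
      qed (use L0 in auto)
      also have "\<dots> \<le> (L powr (- p) * n powr (2 * p) * L) * X"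
        using qc[OF p0] L0 by (intro mult_right_mono) (auto simp: X_def)
      also have "\<dots> = L powr (1 - p) * (n * n / n ^ CARD('n)) * X"
      proof -
        have "L powr (- p) * n powr (2 * p) * L = (L * L powr (- p)) * n powr (2 * p)" by simp
        also have "\<dots> = L powr (1 - p) * (n * n / n ^ CARD('n))"
          using L0 powr_mult_base[of L "- p"] unfolding nN by simp
        finally show ?thesis by simp
      qed
      finally have b1: "2 * f x * q x powr p * S \<le> L powr (1 - p) * (n * n / n ^ CARD('n)) * X" .
      have "- 2 * p * (f x)\<^sup>2 * q x powr (p - 1) * n\<^sup>2 \<le> ?N * X * (L powr (1 - p) * (1 / n ^ CARD('n))) * n\<^sup>2"
      proof (intro mult_mono)
        show "q x powr (p - 1) \<le> L powr (1 - p) * (1 / n ^ CARD('n))"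
          using qc[of "p - 1"] p0 unfolding nN1 by simp
        show "- 2 * p \<le> ?N" by (simp add: p_def)
        show "(f x)\<^sup>2 \<le> X" by (simp add: X_def)
      qed (use p0 n in \<open>auto simp: X_def mult_nonpos_nonneg\<close>)
      hence b2: "- 2 * p * (f x)\<^sup>2 * q x powr (p - 1) * n\<^sup>2 \<le> ?N * (L powr (1 - p) * (n * n / n ^ CARD('n)) * X)"
        by (simp add: power2_eq_square mult_ac)
      have "2 * f x * q x powr p * S - 2 * p * (f x)\<^sup>2 * q x powr (p - 1) * n\<^sup>2 \<le> (?N + 1) * (L powr (1 - p) * (n * n / n ^ CARD('n)) * X)"
      proof -
        have "A - B \<le> (?N + 1) * T" if "A \<le> T" "- B \<le> ?N * T" for A B T :: real
          using that by (simp add: distrib_right)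
        from this[OF b1, of "2 * p * (f x)\<^sup>2 * q x powr (p - 1) * n\<^sup>2"] show ?thesis using b2 by simp
      qed
      hence "w n / n * (2 * f x * q x powr p * S - 2 * p * (f x)\<^sup>2 * q x powr (p - 1) * n\<^sup>2)
         \<le> w n / n * ((?N + 1) * (L powr (1 - p) * (n * n / n ^ CARD('n)) * X))"
        using w(2) n by (intro mult_left_mono) auto
      also have "\<dots> = (?N + 1) * L powr (1 - p) * (w n / n ^ (CARD('n) - 1) * X)"
      proof -
        have "n ^ CARD('n) = n * n ^ (CARD('n) - 1)" using N by (cases "CARD('n)") auto
        thus ?thesis using n by (simp add: field_simps)
      qed
      finally show ?thesis unfolding Q_def \<omega>_def X_def n_def .
    qed
    with e1 e2 e3 e4 have "2 * E x - Q x \<le> (\<Sum>i\<in>UNIV. V' i x)"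
      unfolding V'_def sum.distrib sum_subtractf by linarith
    thus ?thesis using E0[of x] by linarith
  qed
  have "integral\<^sup>L lborel E \<le> integral\<^sup>L lborel (\<lambda>x. (\<Sum>i\<in>UNIV. V' i x) + Q x)"
    using Eint Qint V'int main by (intro integral_mono) auto
  also have "\<dots> = integral\<^sup>L lborel Q" using Qint V'int by (simp add: integral_sum)
  finally have "ennreal (integral\<^sup>L lborel E) \<le> ennreal (integral\<^sup>L lborel Q)" by (rule ennreal_leI)
  hence "(\<integral>\<^sup>+x. ennreal (E x) \<partial>lborel) \<le> (\<integral>\<^sup>+x. ennreal (Q x) \<partial>lborel)"
    using Eint Qint E0 Q0 by (simp add: nn_integral_eq_integral)
  thus ?thesis unfolding E_def Q_def \<omega>_def .
qed

section \<open>A smooth bump function and convolution with it\<close>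

text \<open>The family is closed under differentiation up to linear combinations, and its member with
  \<open>k = 0\<close> is the usual smooth function that is flat at \<open>0\<close>.\<close>

definition flat_exp :: "nat \<Rightarrow> real \<Rightarrow> real" where
  "flat_exp k t = (if t > 0 then exp (- (1 / t)) / t ^ k else 0)"

lemma flat_exp_nonneg: "0 \<le> flat_exp k t"
  by (simp add: flat_exp_def)

lemma flat_exp_tendsto_0: "(flat_exp k \<longlongrightarrow> 0) (at_right 0)"
proof -
  have "((\<lambda>x::real. x ^ k / exp x) \<longlongrightarrow> 0) at_top" by (rule tendsto_power_div_exp_0)
  hence "((\<lambda>t. (inverse t) ^ k / exp (inverse t)) \<longlongrightarrow> (0::real)) (at_right 0)"
    by (rule filterlim_compose[OF _ filterlim_inverse_at_top_right])
  thus ?thesis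
    by (rule Lim_transform_eventually)
       (auto simp: flat_exp_def eventually_at_right_field exp_minus field_simps intro!: exI[of _ 1])
qed

lemma flat_exp_has_derivative:
  "(flat_exp k has_real_derivative flat_exp (k + 2) t - real k * flat_exp (k + 1) t) (at t)"
proof (cases t "0::real" rule: linorder_cases)
  case less
  have "((\<lambda>t. 0) has_real_derivative 0) (at t)" by simp
  moreover have "\<forall>\<^sub>F s in nhds t. 0 = flat_exp k s"
    using eventually_nhds_in_open[of "{..<0}" t] less by (auto elim!: eventually_mono simp: flat_exp_def)
  ultimately have "(flat_exp k has_real_derivative 0) (at t)"
    using DERIV_cong_ev[OF refl, of "\<lambda>t. 0" "flat_exp k" t 0 0] by blast
  thus ?thesis using less by (simp add: flat_exp_def)
next
  case greater
  have "((\<lambda>t. exp (- (1 / t)) / t ^ k) has_real_derivative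
      (exp (- (1 / t)) / t ^ (k + 2) - real k * (exp (- (1 / t)) / t ^ (k + 1)))) (at t)"
  proof -
    have "((\<lambda>t. exp (- (1 / t))) has_real_derivative exp (- (1 / t)) * (1 / t\<^sup>2)) (at t)"
      using greater by (auto intro!: derivative_eq_intros simp: power2_eq_square)
    from DERIV_divide[OF this DERIV_pow[of k t]]
    have "((\<lambda>t. exp (- (1 / t)) / t ^ k) has_real_derivative
      (exp (- (1 / t)) * (1 / t\<^sup>2) * t ^ k - exp (- (1 / t)) * (real k * t ^ (k - Suc 0))) / (t ^ k * t ^ k)) (at t)"
      using greater by simp
    moreover have "real k * t ^ (k - Suc 0) = real k * (t ^ k / t)"
      using greater by (cases k) auto
    moreover have "(e * (1 / t\<^sup>2) * P - e * (real k * (P / t))) / (P * P) = e / (P * t\<^sup>2) - real k * (e / (t * P))"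
      if "P > 0" for e P
      using greater that by (simp add: field_simps power2_eq_square)
    from this[of "t ^ k" "exp (- (1 / t))"] greater
    have "(exp (- (1 / t)) * (1 / t\<^sup>2) * t ^ k - exp (- (1 / t)) * (real k * (t ^ k / t))) / (t ^ k * t ^ k)
      = exp (- (1 / t)) / t ^ (k + 2) - real k * (exp (- (1 / t)) / t ^ (k + 1))"
      by (simp add: power_add power2_eq_square)
    ultimately show ?thesis by simp
  qed
  moreover have "\<forall>\<^sub>F s in nhds t. exp (- (1 / s)) / s ^ k = flat_exp k s"
    using eventually_nhds_in_open[of "{0<..}" t] greater by (auto elim!: eventually_mono simp: flat_exp_def)
  ultimately show ?thesis
    using DERIV_cong_ev[OF refl, of "\<lambda>s. exp (- (1 / s)) / s ^ k" "flat_exp k" t] greater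
    by (auto simp: flat_exp_def)
next
  case equal
  have "((\<lambda>h. (flat_exp k (0 + h) - flat_exp k 0) / h) \<longlongrightarrow> 0) (at_right 0)"
    by (rule Lim_transform_eventually[OF flat_exp_tendsto_0[of "Suc k"]])
       (auto simp: flat_exp_def eventually_at_right_field intro!: exI[of _ 1])
  moreover have "((\<lambda>h. (flat_exp k (0 + h) - flat_exp k 0) / h) \<longlongrightarrow> 0) (at_left 0)"
    by (rule Lim_transform_eventually[OF tendsto_const])
       (auto simp: flat_exp_def eventually_at_left_field intro!: exI[of _ "-1"])
  ultimately have "((\<lambda>h. (flat_exp k (0 + h) - flat_exp k 0) / h) \<longlongrightarrow> 0) (at 0)"
    using filterlim_split_at by blast
  hence "(flat_exp k has_real_derivative 0) (at 0)" unfolding DERIV_def by simp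
  thus ?thesis using equal by (simp add: flat_exp_def)
qed

text \<open>A class of functions that contains the bumps and is mapped to itself by all partial derivatives,
  so that smoothness of every order follows by induction on the order.\<close>

inductive_set bump_algebra :: "(real^'n \<Rightarrow> real) set" where
  const: "(\<lambda>x. c) \<in> bump_algebra"
| coord: "(\<lambda>x. x $ i) \<in> bump_algebra"
| bump: "(\<lambda>x. flat_exp k (c - (norm (x - z))\<^sup>2)) \<in> bump_algebra"
| add: "f \<in> bump_algebra \<Longrightarrow> g \<in> bump_algebra \<Longrightarrow> (\<lambda>x. f x + g x) \<in> bump_algebra"
| mult: "f \<in> bump_algebra \<Longrightarrow> g \<in> bump_algebra \<Longrightarrow> (\<lambda>x. f x * g x) \<in> bump_algebra"

lemma partial_deriv_eq:
  assumes "(f has_derivative f') (at x)"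
  shows "partial_deriv i f x = f' (axis i 1)"
  unfolding partial_deriv_def using frechet_derivative_at[OF assms] by simp

lemma flat_exp_norm_has_derivative:
  fixes x z :: "'a::euclidean_space"
  shows "((\<lambda>x. flat_exp k (c - (norm (x - z))\<^sup>2)) has_derivative
     (\<lambda>h. (flat_exp (k + 2) (c - (norm (x - z))\<^sup>2) - real k * flat_exp (k + 1) (c - (norm (x - z))\<^sup>2)) * (- 2 * ((x - z) \<bullet> h)))) (at x)"
proof -
  have "((\<lambda>x. c - (norm (x - z))\<^sup>2) has_derivative (\<lambda>h. - 2 * ((x - z) \<bullet> h))) (at x)"
    unfolding power2_norm_eq_inner by (auto intro!: derivative_eq_intros simp: inner_commute)
  from has_derivative_compose[OF this flat_exp_has_derivative[unfolded has_field_derivative_def]]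
  show ?thesis by simp
qed

lemma bump_algebra_deriv:
  assumes "f \<in> bump_algebra"
  shows "(\<forall>x. f differentiable (at x)) \<and> (\<forall>i. partial_deriv i f \<in> bump_algebra)"
  using assms
proof induction
  case (const c)
  have "partial_deriv i (\<lambda>x::real^'a. c) = (\<lambda>x. 0)" for i
    by (rule ext, subst partial_deriv_eq) (auto intro!: derivative_intros)
  thus ?case by (auto intro: bump_algebra.intros)
next
  case (coord i)
  have "partial_deriv j (\<lambda>x::real^'a. x $ i) = (\<lambda>x. axis j 1 $ i)" for j
    by (rule ext, subst partial_deriv_eq) (auto intro!: bounded_linear_imp_has_derivative bounded_linear_vec_nth)
  thus ?case by (auto intro!: bump_algebra.intros bounded_linear_imp_differentiable bounded_linear_vec_nth)
next
  case (bump k c z)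
  have "partial_deriv i (\<lambda>x. flat_exp k (c - (norm (x - z))\<^sup>2)) = 
     (\<lambda>x. (flat_exp (k + 2) (c - (norm (x - z))\<^sup>2) + (- real k) * flat_exp (k + 1) (c - (norm (x - z))\<^sup>2)) * (- 2 * (x $ i + (- z $ i))))" for i
    by (rule ext, subst partial_deriv_eq[OF flat_exp_norm_has_derivative]) (simp add: inner_axis)
  note eq = this
  show ?case
  proof (intro conjI allI)
    show "partial_deriv i (\<lambda>x. flat_exp k (c - (norm (x - z))\<^sup>2)) \<in> bump_algebra" for i
      unfolding eq by (intro bump_algebra.intros)
  qed (rule differentiableI[OF flat_exp_norm_has_derivative])
next
  case (add f g)
  have "partial_deriv i (\<lambda>x. f x + g x) = (\<lambda>x. partial_deriv i f x + partial_deriv i g x)" for i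
  proof
    fix x
    have "((\<lambda>x. f x + g x) has_derivative (\<lambda>h. frechet_derivative f (at x) h + frechet_derivative g (at x) h)) (at x)"
      using add(3,4) by (intro has_derivative_add) (auto simp: frechet_derivative_works[symmetric])
    thus "partial_deriv i (\<lambda>x. f x + g x) x = partial_deriv i f x + partial_deriv i g x"
      by (subst partial_deriv_eq) (auto simp: partial_deriv_def)
  qed
  thus ?case using add by (auto intro!: bump_algebra.intros)
next
  case (mult f g)
  have "partial_deriv i (\<lambda>x. f x * g x) = (\<lambda>x. f x * partial_deriv i g x + partial_deriv i f x * g x)" for i
  proof
    fix x
    have "((\<lambda>x. f x * g x) has_derivative (\<lambda>h. f x * frechet_derivative g (at x) h + frechet_derivative f (at x) h * g x)) (at x)"
      using mult(3,4) by (intro has_derivative_mult) (auto simp: frechet_derivative_works[symmetric])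
    thus "partial_deriv i (\<lambda>x. f x * g x) x = f x * partial_deriv i g x + partial_deriv i f x * g x"
      by (subst partial_deriv_eq) (auto simp: partial_deriv_def)
  qed
  thus ?case using mult by (auto intro!: bump_algebra.intros)
qed

lemma bump_algebra_Ck: "f \<in> bump_algebra \<Longrightarrow> Ck k f"
proof (induction k arbitrary: f)
  case 0
  thus ?case using bump_algebra_deriv[OF 0] 
    by (auto intro!: continuous_at_imp_continuous_on differentiable_imp_continuous_within)
next
  case (Suc k)
  thus ?case using bump_algebra_deriv[OF Suc.prems] by auto
qed

definition bump :: "real \<Rightarrow> 'a::euclidean_space \<Rightarrow> real" where
  "bump \<delta> v = flat_exp 0 (\<delta>\<^sup>2 - (norm v)\<^sup>2)"

definition bump_grad :: "real \<Rightarrow> 'a::euclidean_space \<Rightarrow> 'a" where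
  "bump_grad \<delta> v = (- 2 * flat_exp 2 (\<delta>\<^sup>2 - (norm v)\<^sup>2)) *\<^sub>R v"

lemma continuous_on_flat_exp [continuous_intros]:
  "continuous_on S f \<Longrightarrow> continuous_on S (\<lambda>x. flat_exp k (f x))"
  by (rule continuous_on_compose2[of UNIV "flat_exp k"])
     (auto intro!: continuous_at_imp_continuous_on DERIV_isCont flat_exp_has_derivative)

lemma bump_has_derivative: "(bump \<delta> has_derivative (\<lambda>h. bump_grad \<delta> v \<bullet> h)) (at v)"
  using flat_exp_norm_has_derivative[of 0 "\<delta>\<^sup>2" 0 v] by (simp add: bump_def[abs_def] bump_grad_def mult_ac numeral_2_eq_2)

lemma continuous_bump: "continuous_on S (bump \<delta>)" and continuous_bump_grad: "continuous_on S (bump_grad \<delta>)"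
  unfolding bump_def[abs_def] bump_grad_def[abs_def] by (intro continuous_intros)+

lemma bump_measurable [measurable]: "bump \<delta> \<in> borel_measurable borel" "bump_grad \<delta> \<in> borel_measurable borel"
  by (auto intro: borel_measurable_continuous_onI continuous_bump continuous_bump_grad)

lemma bump_nonneg: "0 \<le> bump \<delta> v" by (simp add: bump_def flat_exp_nonneg)

lemma bump_le_1: "bump \<delta> v \<le> 1" by (simp add: bump_def flat_exp_def)

lemma bump_outside: "\<delta> \<ge> 0 \<Longrightarrow> norm v \<ge> \<delta> \<Longrightarrow> bump \<delta> v = 0" "\<delta> \<ge> 0 \<Longrightarrow> norm v \<ge> \<delta> \<Longrightarrow> bump_grad \<delta> v = 0"
proof -
  assume "\<delta> \<ge> 0" "norm v \<ge> \<delta>"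
  hence "\<not> \<delta>\<^sup>2 - (norm v)\<^sup>2 > 0" using power_mono[of \<delta> "norm v" 2] by linarith
  thus "bump \<delta> v = 0" "bump_grad \<delta> v = 0" by (auto simp: bump_def bump_grad_def flat_exp_def)
qed

lemma bump_pos: "norm v < \<delta> \<Longrightarrow> bump \<delta> v > 0"
  using power_strict_mono[of "norm v" \<delta> 2] by (auto simp: bump_def flat_exp_def)

lemma bump_minus: "bump \<delta> (- v) = bump \<delta> v" by (simp add: bump_def)

lemma bump_test_function:
  fixes x :: "real^'n"
  assumes "\<delta> > 0" "cball x \<delta> \<subseteq> S"
  shows "(\<lambda>y. bump \<delta> (y - x)) \<in> test_functions S"
    and "partial_deriv i (\<lambda>y. bump \<delta> (y - x)) y = bump_grad \<delta> (y - x) $ i"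
proof -
  have "{y. bump \<delta> (y - x) \<noteq> 0} \<subseteq> cball x \<delta>"
    using bump_outside(1)[of \<delta>] assms by (force simp: dist_norm norm_minus_commute)
  hence *: "closure {y. bump \<delta> (y - x) \<noteq> 0} \<subseteq> cball x \<delta>" by (rule closure_minimal) simp
  moreover from this have "compact (closure {y. bump \<delta> (y - x) \<noteq> 0})"
    by (meson bounded_cball bounded_subset closed_closure compact_eq_bounded_closed)
  moreover have "(\<lambda>y. bump \<delta> (y - x)) \<in> bump_algebra" unfolding bump_def by (rule bump_algebra.bump)
  ultimately show "(\<lambda>y. bump \<delta> (y - x)) \<in> test_functions S"
    unfolding test_functions_def using assms bump_algebra_Ck by blast
  show "partial_deriv i (\<lambda>y. bump \<delta> (y - x)) y = bump_grad \<delta> (y - x) $ i"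
    unfolding bump_def by (subst partial_deriv_eq[OF flat_exp_norm_has_derivative]) (simp add: bump_grad_def inner_axis numeral_2_eq_2 algebra_simps)
qed

lemma uniformly_continuous_compact_support:
  fixes k :: "'a::euclidean_space \<Rightarrow> 'b::euclidean_space"
  assumes k: "continuous_on UNIV k" and 0: "\<And>x. norm x > R \<Longrightarrow> k x = 0" and e: "e > 0"
  obtains d where "0 < d" "d \<le> 1" "\<And>x y. norm (y - x) < d \<Longrightarrow> norm (k y - k x) \<le> e"
proof -
  have "uniformly_continuous_on (cball 0 (R + 1)) k"
    by (rule compact_uniformly_continuous) (auto intro: continuous_on_subset[OF k])
  then obtain d where d: "d > 0" "\<And>x y. norm x \<le> R + 1 \<Longrightarrow> norm y \<le> R + 1 \<Longrightarrow> norm (y - x) < d \<Longrightarrow> norm (k y - k x) < e"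
    unfolding uniformly_continuous_on_def using e by (auto simp: dist_norm)
  show thesis
  proof (rule that[of "min d 1"])
    fix x y :: 'a assume xy: "norm (y - x) < min d 1"
    show "norm (k y - k x) \<le> e"
    proof (cases "norm x \<le> R + 1 \<and> norm y \<le> R + 1")
      case True thus ?thesis using d(2)[of x y] xy by auto
    next
      case False
      have "norm y \<le> norm x + norm (y - x)" "norm x \<le> norm y + norm (y - x)"
        using norm_triangle_sub[of y x] norm_triangle_sub[of x y] by (auto simp: norm_minus_commute)
      hence "norm x > R" "norm y > R" using False xy by auto
      thus ?thesis using 0 e by simp
    qed
  qed (use d in auto)
qed

text \<open>The convolution of \<open>w\<close> with the reflected kernel. In this form \<open>y \<mapsto> k (y - x)\<close> is directly a
  test function in \<open>y\<close>.\<close>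

definition conv :: "('a::euclidean_space \<Rightarrow> real) \<Rightarrow> ('a \<Rightarrow> real) \<Rightarrow> 'a \<Rightarrow> real" where
  "conv w k x = (LINT y|lborel. w y * k (y - x))"

lemma integrable_mult_bounded_kernel:
  fixes w k :: "'a::euclidean_space \<Rightarrow> real"
  assumes w: "integrable lborel w" and [measurable]: "k \<in> borel_measurable borel" and b: "\<And>v. \<bar>k v\<bar> \<le> M"
  shows "integrable lborel (\<lambda>y. w y * k (y - x))"
proof (rule Bochner_Integration.integrable_bound[where f="\<lambda>y. w y * M"])
  show "AE y in lborel. norm (w y * k (y - x)) \<le> norm (w y * M)"
    using b by (intro AE_I2) (auto simp: abs_mult intro!: mult_left_mono order_trans[OF b])
qed (use w in auto)

lemma compact_support_bounded:
  fixes k :: "'a::euclidean_space \<Rightarrow> 'b::euclidean_space"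
  assumes k: "continuous_on UNIV k" and 0: "\<And>x. norm x > R \<Longrightarrow> k x = 0"
  obtains M where "M \<ge> 0" "\<And>x. norm (k x) \<le> M"
proof -
  have "bounded (k ` cball 0 R)"
    by (intro compact_imp_bounded compact_continuous_image continuous_on_subset[OF k]) auto
  then obtain M where M: "\<forall>x\<in>cball 0 R. norm (k x) \<le> M" unfolding bounded_iff by auto
  show thesis
  proof (rule that[of "max 0 M"])
    fix x show "norm (k x) \<le> max 0 M"
      using M 0[of x] by (cases "norm x \<le> R") (auto simp: le_max_iff_disj)
  qed auto
qed

lemma integral_mult_small:
  fixes w h :: "'a::euclidean_space \<Rightarrow> real"
  assumes w: "integrable lborel w" and "\<And>y. \<bar>h y\<bar> \<le> e"
  shows "\<bar>LINT y|lborel. w y * h y\<bar> \<le> e * (LINT y|lborel. \<bar>w y\<bar>)"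
proof -
  have "\<bar>LINT y|lborel. w y * h y\<bar> \<le> (LINT y|lborel. \<bar>w y * h y\<bar>)" by (rule integral_abs_bound)
  also have "\<dots> \<le> (LINT y|lborel. e * \<bar>w y\<bar>)"
  proof (rule integral_mono')
    show "integrable lborel (\<lambda>y. e * \<bar>w y\<bar>)" using w by auto
    fix y show "\<bar>w y * h y\<bar> \<le> e * \<bar>w y\<bar>"
      using mult_left_mono[OF assms(2)[of y], of "\<bar>w y\<bar>"] by (simp add: abs_mult mult_ac)
    show "0 \<le> e * \<bar>w y\<bar>" using assms(2)[of y] by (intro mult_nonneg_nonneg) auto
  qed
  finally show ?thesis by simp
qed

lemma conv_continuous:
  fixes k :: "'a::euclidean_space \<Rightarrow> real"
  assumes w: "integrable lborel w" and k: "continuous_on UNIV k" and 0: "\<And>x. norm x > R \<Longrightarrow> k x = 0"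
  shows "continuous_on S (conv w k)"
proof -
  have [measurable]: "k \<in> borel_measurable borel" using k by (rule borel_measurable_continuous_onI)
  obtain M where M: "\<And>x. norm (k x) \<le> M" using compact_support_bounded[OF k 0] by metis
  have int: "integrable lborel (\<lambda>y. w y * k (y - x))" for x
    by (rule integrable_mult_bounded_kernel[OF w, where M=M]) (use M in auto)
  define I where "I = (LINT y|lborel. \<bar>w y\<bar>) + 1"
  have I: "I > 0" unfolding I_def by (intro add_nonneg_pos integral_nonneg) auto
  have "continuous_on UNIV (conv w k)"
    unfolding continuous_on_iff
  proof (intro ballI allI impI)
    fix x :: 'a and e :: real assume e: "e > 0"
    have "e / (2 * I) > 0" using e I by simp
    then obtain d where d: "0 < d" "\<And>x y. norm (y - x) < d \<Longrightarrow> norm (k y - k x) \<le> e / (2 * I)"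
      using uniformly_continuous_compact_support[OF k 0] by metis
    show "\<exists>d>0. \<forall>x'\<in>UNIV. dist x' x < d \<longrightarrow> dist (conv w k x') (conv w k x) < e"
    proof (intro exI[of _ d] conjI ballI impI d(1))
      fix x' assume "dist x' x < d"
      hence "norm ((y - x') - (y - x)) < d" for y by (simp add: dist_norm norm_minus_commute)
      hence b: "\<bar>k (y - x') - k (y - x)\<bar> \<le> e / (2 * I)" for y using d(2) by fastforce
      have "conv w k x' - conv w k x = (LINT y|lborel. w y * (k (y - x') - k (y - x)))"
        unfolding conv_def using int by (simp add: right_diff_distrib)
      also have "\<bar>\<dots>\<bar> \<le> e / (2 * I) * (LINT y|lborel. \<bar>w y\<bar>)"
        by (rule integral_mult_small[OF w b])
      also have "\<dots> \<le> e / (2 * I) * I" using e I by (intro mult_left_mono) (auto simp: I_def)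
      also have "\<dots> < e" using e I by (simp add: field_simps)
      finally show "dist (conv w k x') (conv w k x) < e" by (simp add: dist_norm)
    qed
  qed
  thus ?thesis by (rule continuous_on_subset) auto
qed

text \<open>Since the gradient of the kernel is uniformly continuous, the kernel is differentiable uniformly
  in the base point; the remainder can then be integrated against \<open>w\<close>.\<close>

lemma conv_has_derivative:
  fixes k :: "'a::euclidean_space \<Rightarrow> real" and K :: "'a \<Rightarrow> 'a"
  assumes w: "integrable lborel w" and k: "continuous_on UNIV k" "\<And>x. norm x > R \<Longrightarrow> k x = 0"
    and K: "continuous_on UNIV K" "\<And>x. norm x > R \<Longrightarrow> K x = 0"
    and deriv: "\<And>v. (k has_derivative (\<lambda>h. K v \<bullet> h)) (at v)"
  shows "(conv w k has_derivative (\<lambda>h. - (LINT y|lborel. w y * (K (y - x) \<bullet> h)))) (at x)"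
proof -
  have [measurable]: "k \<in> borel_measurable borel" "K \<in> borel_measurable borel" 
    using k K by (auto intro: borel_measurable_continuous_onI)
  obtain M where M: "\<And>x. norm (k x) \<le> M" using compact_support_bounded[OF k] by metis
  obtain M' where M': "\<And>x. norm (K x) \<le> M'" using compact_support_bounded[OF K] by metis
  have int: "integrable lborel (\<lambda>y. w y * k (y - x))" for x
    by (rule integrable_mult_bounded_kernel[OF w, where M=M]) (use M in auto)
  have int': "integrable lborel (\<lambda>y. w y * (K (y - x) \<bullet> h))" for x h
  proof (rule integrable_mult_bounded_kernel[OF w, where M="M' * norm h" and k="\<lambda>v. K v \<bullet> h"])
    fix v show "\<bar>K v \<bullet> h\<bar> \<le> M' * norm h"
      using Cauchy_Schwarz_ineq2[of "K v" h] mult_right_mono[OF M'[of v], of "norm h"] by auto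
  qed auto
  define I where "I = (LINT y|lborel. \<bar>w y\<bar>) + 1"
  have I: "I > 0" unfolding I_def by (intro add_nonneg_pos integral_nonneg) auto
  show ?thesis unfolding has_derivative_at_alt
  proof (intro conjI allI impI)
    show "bounded_linear (\<lambda>h. - (LINT y|lborel. w y * (K (y - x) \<bullet> h)))"
    proof (rule bounded_linear_intro[where K="M' * (LINT y|lborel. \<bar>w y\<bar>)"])
      fix h
      have "\<bar>LINT y|lborel. w y * (K (y - x) \<bullet> h)\<bar> \<le> (M' * norm h) * (LINT y|lborel. \<bar>w y\<bar>)"
      proof (rule integral_mult_small[OF w])
        fix y show "\<bar>K (y - x) \<bullet> h\<bar> \<le> M' * norm h"
          using Cauchy_Schwarz_ineq2[of "K (y - x)" h] mult_right_mono[OF M'[of "y - x"], of "norm h"] by auto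
      qed
      thus "norm (- (LINT y|lborel. w y * (K (y - x) \<bullet> h))) \<le> norm h * (M' * (LINT y|lborel. \<bar>w y\<bar>))"
        by (simp add: mult_ac)
    qed (use int' in \<open>auto simp: inner_add_right distrib_left mult.left_commute[of _ "_ :: real"] algebra_simps\<close>)
    fix e :: real assume e: "e > 0"
    have "e / I > 0" using e I by simp
    then obtain d where d: "0 < d" "\<And>x y. norm (y - x) < d \<Longrightarrow> norm (K y - K x) \<le> e / I"
      using uniformly_continuous_compact_support[OF K] by metis
    have lin: "\<bar>k (v - h) - k v + K v \<bullet> h\<bar> \<le> e / I * norm h" if h: "norm h < d" for v h
    proof -
      have "norm (k (v - h) - k v - K v \<bullet> ((v - h) - v)) \<le> norm ((v - h) - v) * (e / I)"
      proof (rule differentiable_bound_linearization[where f'="\<lambda>x h. K x \<bullet> h" and S="closed_segment v (v - h)"])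
        show "(k has_derivative (\<lambda>h. K z \<bullet> h)) (at z within closed_segment v (v - h))" for z
          using deriv by (rule has_derivative_at_withinI)
        show "v + t *\<^sub>R (v - h - v) \<in> closed_segment v (v - h)" if "t \<in> {0..1}" for t
          using that unfolding closed_segment_def by (auto simp: algebra_simps intro!: exI[of _ t])
        fix z assume z: "z \<in> closed_segment v (v - h)"
        have "norm (z - v) \<le> norm h" using segment_bound(1)[OF z] by simp
        hence "norm (K z - K v) \<le> e / I" using h by (intro d(2)) auto
        moreover have "onorm (\<lambda>i. K z \<bullet> i - K v \<bullet> i) \<le> norm (K z - K v)"
          by (rule onorm_le) (metis inner_diff_left Cauchy_Schwarz_ineq2 real_norm_def)
        ultimately show "onorm ((\<lambda>h. K z \<bullet> h) - (\<lambda>h. K v \<bullet> h)) \<le> e / I" by (simp add: fun_diff_def)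
      qed simp
      thus ?thesis by (simp add: mult_ac)
    qed
    show "\<exists>d>0. \<forall>x'. norm (x' - x) < d \<longrightarrow> norm (conv w k x' - conv w k x -
        - (LINT y|lborel. w y * (K (y - x) \<bullet> (x' - x)))) \<le> e * norm (x' - x)"
    proof (intro exI[of _ d] conjI allI impI d(1))
      fix x' assume x': "norm (x' - x) < d"
      have b: "\<bar>k (y - x') - k (y - x) + K (y - x) \<bullet> (x' - x)\<bar> \<le> e / I * norm (x' - x)" for y
        using lin[OF x', of "y - x"] by simp
      have "conv w k x' - conv w k x - - (LINT y|lborel. w y * (K (y - x) \<bullet> (x' - x)))
         = (LINT y|lborel. w y * (k (y - x') - k (y - x) + K (y - x) \<bullet> (x' - x)))"
        unfolding conv_def using int int' by (simp add: right_diff_distrib distrib_left)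
      also have "\<bar>\<dots>\<bar> \<le> (e / I * norm (x' - x)) * (LINT y|lborel. \<bar>w y\<bar>)"
        by (rule integral_mult_small[OF w b])
      also have "\<dots> \<le> (e / I * norm (x' - x)) * I" using e I by (intro mult_left_mono) (auto simp: I_def)
      also have "\<dots> = e * norm (x' - x)" using I by simp
      finally show "norm (conv w k x' - conv w k x - - (LINT y|lborel. w y * (K (y - x) \<bullet> (x' - x)))) \<le> e * norm (x' - x)"
        by simp
    qed
  qed
qed

section \<open>Mollification in the mean square\<close>

lemma square_sum3_le: "(p + q + r)\<^sup>2 \<le> 3 * p\<^sup>2 + (3 * q\<^sup>2 + 3 * r\<^sup>2)" for p q r :: real
proof -
  have "3 * p\<^sup>2 + (3 * q\<^sup>2 + 3 * r\<^sup>2) - (p + q + r)\<^sup>2 = (p - q)\<^sup>2 + (p - r)\<^sup>2 + (q - r)\<^sup>2"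
    by (simp add: power2_eq_square algebra_simps)
  thus ?thesis by (smt (verit) zero_le_power2)
qed

lemma bump_integrable: "\<delta> > 0 \<Longrightarrow> integrable lborel (bump \<delta> :: 'a::euclidean_space \<Rightarrow> real)"
  by (rule integrable_continuous_cball[where R=\<delta>, OF continuous_bump]) (rule bump_outside, auto)

definition bump_mass :: "'a::euclidean_space itself \<Rightarrow> real \<Rightarrow> real" where
  "bump_mass _ \<delta> = (LINT v|lborel. bump \<delta> (v::'a))"

lemma bump_mass_pos:
  assumes "\<delta> > 0" shows "bump_mass TYPE('a::euclidean_space) \<delta> > 0"
proof (rule ccontr)
  assume "\<not> ?thesis"
  moreover have "bump_mass TYPE('a) \<delta> \<ge> 0" unfolding bump_mass_def by (intro Bochner_Integration.integral_nonneg bump_nonneg)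
  ultimately have "(LINT v|lborel. bump \<delta> (v::'a)) = 0" unfolding bump_mass_def by linarith
  hence "AE v in lborel. bump \<delta> (v::'a) = 0"
    using integral_nonneg_eq_0_iff_AE[OF bump_integrable[OF assms]] bump_nonneg by blast
  hence "AE v in lborel. v \<notin> ball (0::'a) \<delta>"
    by eventually_elim (use bump_pos in force)
  hence "ball (0::'a) \<delta> \<in> null_sets lborel" by (subst (asm) AE_iff_null_sets[symmetric]) auto
  moreover have "emeasure lborel (ball (0::'a) \<delta>) > 0" using assms by (subst emeasure_ball) (auto simp: unit_ball_vol_pos)
  ultimately show False by (simp add: null_sets_def)
qed

definition mollify :: "real \<Rightarrow> ('a::euclidean_space \<Rightarrow> real) \<Rightarrow> 'a \<Rightarrow> real" where
  "mollify \<delta> w x = conv w (bump \<delta>) x / bump_mass TYPE('a) \<delta>"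

lemma bump_shift:
  assumes "\<delta> > 0"
  shows "integrable lborel (\<lambda>y. bump \<delta> (y - x :: 'a::euclidean_space))"
    and "(LINT y|lborel. bump \<delta> (y - x :: 'a)) = bump_mass TYPE('a) \<delta>"
    and "(LINT y|lborel. bump \<delta> (x - y :: 'a)) = bump_mass TYPE('a) \<delta>"
proof -
  have "integrable (distr lborel borel ((+) (-x))) (bump \<delta>)" using bump_integrable[OF assms] by (simp add: lborel_distr_plus)
  hence "integrable lborel (\<lambda>y. bump \<delta> (-x + y))" by (subst (asm) integrable_distr_eq) auto
  thus "integrable lborel (\<lambda>y. bump \<delta> (y - x))" by (simp add: add.commute)
  show *: "(LINT y|lborel. bump \<delta> (y - x :: 'a)) = bump_mass TYPE('a) \<delta>"
    unfolding bump_mass_def using integral_lborel_translate[of "bump \<delta>" "-x"] by simp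
  have "bump \<delta> (x - y) = bump \<delta> (y - x)" for y by (metis bump_minus minus_diff_eq)
  thus "(LINT y|lborel. bump \<delta> (x - y :: 'a)) = bump_mass TYPE('a) \<delta>" using * by simp
qed

lemma conv_bump_integrable:
  assumes "integrable lborel w"
  shows "integrable lborel (\<lambda>y. w y * bump \<delta> (y - x))"
  by (rule integrable_mult_bounded_kernel[OF assms, where M=1]) (auto simp: bump_nonneg bump_le_1)

lemma mollify_measurable [measurable]:
  fixes w :: "'a::euclidean_space \<Rightarrow> real"
  assumes "integrable lborel w" "\<delta> > 0"
  shows "mollify \<delta> w \<in> borel_measurable borel"
  unfolding mollify_def[abs_def]
  by (intro borel_measurable_continuous_onI continuous_intros conv_continuous[where R=\<delta>] assms continuous_bump bump_outside)
     (use assms bump_mass_pos[OF assms(2), where 'a='a] in auto)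

lemma mollify_diff:
  assumes "integrable lborel w" "integrable lborel k"
  shows "mollify \<delta> (\<lambda>x. w x - k x) x = mollify \<delta> w x - mollify \<delta> k x"
  unfolding mollify_def conv_def using conv_bump_integrable[OF assms(1)] conv_bump_integrable[OF assms(2)]
  by (simp add: left_diff_distrib diff_divide_distrib)

text \<open>Jensen's inequality for the square, again by expanding \<open>(w - m)\<^sup>2 \<ge> 0\<close> with \<open>m\<close> the average.\<close>

lemma mollify_square_le:
  fixes w :: "'a::euclidean_space \<Rightarrow> real"
  assumes w: "integrable lborel w" and \<delta>: "\<delta> > 0"
  shows "ennreal ((mollify \<delta> w x)\<^sup>2) \<le> ennreal (1 / bump_mass TYPE('a) \<delta>) * (\<integral>\<^sup>+y. ennreal ((w y)\<^sup>2 * bump \<delta> (y - x)) \<partial>lborel)"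
proof (cases "(\<integral>\<^sup>+y. ennreal ((w y)\<^sup>2 * bump \<delta> (y - x)) \<partial>lborel) < \<infinity>")
  case False
  have "bump_mass TYPE('a) \<delta> > 0" by (rule bump_mass_pos[OF \<delta>])
  thus ?thesis using False by (simp add: less_top[symmetric] ennreal_mult_eq_top_iff top_unique)
next
  case True
  let ?c = "bump_mass TYPE('a) \<delta>"
  have c: "?c > 0" by (rule bump_mass_pos[OF \<delta>])
  have [measurable]: "w \<in> borel_measurable borel" using w by auto
  have i2: "integrable lborel (\<lambda>y. (w y)\<^sup>2 * bump \<delta> (y - x))"
    using True by (intro integrableI_bounded) (auto simp: bump_nonneg)
  note i1 = conv_bump_integrable[OF w, of \<delta> x]
  define m where "m = mollify \<delta> w x"
  have m: "(LINT y|lborel. w y * bump \<delta> (y - x)) = m * ?c" unfolding m_def mollify_def conv_def using c by simp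
  have "0 \<le> (LINT y|lborel. (w y - m)\<^sup>2 * bump \<delta> (y - x))" by (intro Bochner_Integration.integral_nonneg mult_nonneg_nonneg bump_nonneg) auto
  also have "(\<lambda>y. (w y - m)\<^sup>2 * bump \<delta> (y - x)) = 
      (\<lambda>y. (w y)\<^sup>2 * bump \<delta> (y - x) - 2 * m * (w y * bump \<delta> (y - x)) + m\<^sup>2 * bump \<delta> (y - x))"
    by (simp add: power2_diff algebra_simps fun_eq_iff)
  also have "(LINT y|lborel. (w y)\<^sup>2 * bump \<delta> (y - x) - 2 * m * (w y * bump \<delta> (y - x)) + m\<^sup>2 * bump \<delta> (y - x))
     = (LINT y|lborel. (w y)\<^sup>2 * bump \<delta> (y - x)) - m\<^sup>2 * ?c"
    using i1 i2 bump_shift[OF \<delta>, of x] m by (simp add: power2_eq_square)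
  finally have "m\<^sup>2 \<le> (1 / ?c) * (LINT y|lborel. (w y)\<^sup>2 * bump \<delta> (y - x))" using c by (simp add: field_simps)
  hence "ennreal (m\<^sup>2) \<le> ennreal ((1 / ?c) * (LINT y|lborel. (w y)\<^sup>2 * bump \<delta> (y - x)))" by (rule ennreal_leI)
  also have "\<dots> = ennreal (1 / ?c) * (\<integral>\<^sup>+y. ennreal ((w y)\<^sup>2 * bump \<delta> (y - x)) \<partial>lborel)"
    using c i2 by (subst nn_integral_eq_integral)
      (auto simp: bump_nonneg ennreal_mult[symmetric] simp del: times_divide_eq_left intro!: Bochner_Integration.integral_nonneg)
  finally show ?thesis by (simp add: m_def)
qed

lemma mollify_L2_contraction:
  fixes w :: "'a::euclidean_space \<Rightarrow> real"
  assumes w: "integrable lborel w" and \<delta>: "\<delta> > 0"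
  shows "(\<integral>\<^sup>+x. ennreal ((mollify \<delta> w x)\<^sup>2) \<partial>lborel) \<le> (\<integral>\<^sup>+x. ennreal ((w x)\<^sup>2) \<partial>lborel)"
proof -
  let ?c = "bump_mass TYPE('a) \<delta>"
  have c: "?c > 0" by (rule bump_mass_pos[OF \<delta>])
  have [measurable]: "w \<in> borel_measurable borel" using w by auto
  have "(\<integral>\<^sup>+x. ennreal ((mollify \<delta> w x)\<^sup>2) \<partial>lborel)
    \<le> (\<integral>\<^sup>+x. ennreal (1 / ?c) * (\<integral>\<^sup>+y. ennreal ((w y)\<^sup>2 * bump \<delta> (y - x)) \<partial>lborel) \<partial>lborel)"
    by (intro nn_integral_mono mollify_square_le w \<delta>)
  also have "\<dots> = ennreal (1 / ?c) * (\<integral>\<^sup>+x. (\<integral>\<^sup>+y. ennreal ((w y)\<^sup>2 * bump \<delta> (y - x)) \<partial>lborel) \<partial>lborel)"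
    by (rule nn_integral_cmult) measurable
  also have "(\<integral>\<^sup>+x. (\<integral>\<^sup>+y. ennreal ((w y)\<^sup>2 * bump \<delta> (y - x)) \<partial>lborel) \<partial>lborel) 
     = (\<integral>\<^sup>+y. (\<integral>\<^sup>+x. ennreal ((w y)\<^sup>2 * bump \<delta> (y - x)) \<partial>lborel) \<partial>lborel)"
    by (rule lborel_pair.Fubini') measurable
  also have "\<dots> = (\<integral>\<^sup>+y. ennreal ((w y)\<^sup>2) * ennreal ?c \<partial>lborel)"
  proof (rule nn_integral_cong, goal_cases)
    case (1 y)
    have "(\<integral>\<^sup>+x. ennreal (bump \<delta> (y - x)) \<partial>lborel) = ennreal (LINT x|lborel. bump \<delta> (y - x))"
    proof (rule nn_integral_eq_integral)
      have "bump \<delta> (y - x) = bump \<delta> (x - y)" for x by (metis bump_minus minus_diff_eq)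
      thus "integrable lborel (\<lambda>x. bump \<delta> (y - x))" using bump_shift(1)[OF \<delta>, of y] by simp
    qed (simp add: bump_nonneg)
    thus ?case by (simp add: bump_shift(3)[OF \<delta>] ennreal_mult' bump_nonneg nn_integral_cmult ennreal_mult)
  qed
  also have "\<dots> = (\<integral>\<^sup>+y. ennreal ((w y)\<^sup>2) \<partial>lborel) * ennreal ?c" by (rule nn_integral_multc) measurable
  also have "ennreal (1 / ?c) * \<dots> = (\<integral>\<^sup>+y. ennreal ((w y)\<^sup>2) \<partial>lborel)"
  proof -
    have "ennreal (1 / ?c) * ennreal ?c = 1" using c by (simp add: ennreal_mult[symmetric])
    hence "ennreal (1 / ?c) * (X * ennreal ?c) = X" for X by (subst mult.left_commute) simp
    thus ?thesis .
  qed
  finally show ?thesis .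
qed

text \<open>A bounded measurable function with bounded support is an almost everywhere limit of continuous
  functions; after truncating these in value and in space the convergence is dominated.\<close>

lemma L2_dense_continuous_bounded:
  fixes w :: "'a::euclidean_space \<Rightarrow> real"
  assumes [measurable]: "w \<in> borel_measurable borel" and m: "m \<ge> 0"
    and b: "\<And>x. \<bar>w x\<bar> \<le> m" "\<And>x. norm x > m \<Longrightarrow> w x = 0" and e: "e > 0"
  shows "\<exists>k. continuous_on UNIV k \<and> (\<forall>x. norm x > m + 1 \<longrightarrow> k x = 0) \<and> (\<integral>\<^sup>+x. ennreal ((w x - k x)\<^sup>2) \<partial>lborel) < ennreal e"
proof -
  have "w measurable_on UNIV"
    by (intro lebesgue_measurable_imp_measurable_on_real) (auto intro: measurable_completion)
  then obtain N g where N: "negligible N" and g: "\<And>n. continuous_on UNIV (g n)"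
    and lim: "\<And>x. x \<notin> N \<Longrightarrow> (\<lambda>n. g n x) \<longlonglongrightarrow> w x"
    unfolding measurable_on_def by auto
  define cutoff where "cutoff x = max 0 (min 1 (m + 1 - norm x))" for x :: 'a
  define k where "k n x = max (- m) (min m (g n x)) * cutoff x" for n x
  have cutoff: "continuous_on UNIV cutoff" "0 \<le> cutoff x" "cutoff x \<le> 1" for x unfolding cutoff_def by (auto intro!: continuous_intros)
  have kc: "continuous_on UNIV (k n)" for n unfolding k_def by (intro continuous_intros g cutoff)
  have k0: "k n x = 0" if "norm x > m + 1" for n x using that by (simp add: k_def cutoff_def)
  have kb: "\<bar>k n x\<bar> \<le> m" for n x
  proof -
    have "\<bar>k n x\<bar> \<le> m * 1" unfolding k_def abs_mult using cutoff m by (intro mult_mono) auto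
    thus ?thesis by simp
  qed
  have [measurable]: "k n \<in> borel_measurable borel" for n using kc by (rule borel_measurable_continuous_onI)
  have klim: "(\<lambda>n. k n x) \<longlonglongrightarrow> w x" if "x \<notin> N" for x
  proof -
    have "(\<lambda>n. k n x) \<longlonglongrightarrow> max (- m) (min m (w x)) * cutoff x" unfolding k_def by (intro tendsto_intros lim that)
    also have "max (- m) (min m (w x)) = w x" using b(1)[of x] by auto
    also have "w x * cutoff x = w x" using b(2)[of x] by (auto simp: cutoff_def max_def min_def)
    finally show ?thesis .
  qed
  have AEN: "AE x in lborel. x \<notin> N"
    by (rule negligible_imp_AE_lborel[OF N])
  have "(\<lambda>n. \<integral>\<^sup>+x. ennreal ((w x - k n x)\<^sup>2) \<partial>lborel) \<longlonglongrightarrow> (\<integral>\<^sup>+(x::'a). 0 \<partial>lborel)"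
  proof (rule nn_integral_dominated_convergence[where w="\<lambda>x. ennreal ((2 * m)\<^sup>2) * indicator (cball (0::'a) (m + 1)) x"])
    fix n
    show "AE x in lborel. ennreal ((w x - k n x)\<^sup>2) \<le> ennreal ((2 * m)\<^sup>2) * indicator (cball 0 (m + 1)) x"
    proof (rule AE_I2)
      fix x
      show "ennreal ((w x - k n x)\<^sup>2) \<le> ennreal ((2 * m)\<^sup>2) * indicator (cball 0 (m + 1)) x"
      proof (cases "norm x \<le> m + 1")
        case True
        have "\<bar>w x - k n x\<bar> \<le> 2 * m" using b(1)[of x] kb[of n x] by linarith
        hence "(w x - k n x)\<^sup>2 \<le> (2 * m)\<^sup>2" using m by (intro abs_le_square_iff[THEN iffD1]) auto
        thus ?thesis using True by (simp add: ennreal_leI)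
      next
        case False thus ?thesis using k0[of x n] b(2)[of x] by simp
      qed
    qed
  next
    have "(\<integral>\<^sup>+x. ennreal ((2 * m)\<^sup>2) * indicator (cball (0::'a) (m + 1)) x \<partial>lborel) = ennreal ((2 * m)\<^sup>2) * emeasure lborel (cball (0::'a) (m + 1))"
      by (subst nn_integral_cmult_indicator) auto
    also have "\<dots> < \<infinity>" using emeasure_bounded_finite[OF bounded_cball, of "0::'a" "m + 1"] by (auto simp: ennreal_mult_less_top)
    finally show "(\<integral>\<^sup>+x. ennreal ((2 * m)\<^sup>2) * indicator (cball (0::'a) (m + 1)) x \<partial>lborel) < \<infinity>" .
    show "AE x in lborel. (\<lambda>n. ennreal ((w x - k n x)\<^sup>2)) \<longlonglongrightarrow> 0"
      using AEN
    proof eventually_elim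
      case (elim x)
      have "(\<lambda>n. ennreal ((w x - k n x)\<^sup>2)) \<longlonglongrightarrow> ennreal ((w x - w x)\<^sup>2)"
        by (intro tendsto_intros klim elim)
      thus ?case by simp
    qed
    show "(\<lambda>x. ennreal ((2 * m)\<^sup>2) * indicator (cball (0::'a) (m + 1)) x) \<in> borel_measurable lborel"
      by (intro borel_measurable_times_ennreal borel_measurable_indicator) auto
  qed auto
  hence "\<forall>\<^sub>F n in sequentially. (\<integral>\<^sup>+x. ennreal ((w x - k n x)\<^sup>2) \<partial>lborel) < ennreal e"
    by (intro order_tendstoD(2)) (use e in auto)
  then obtain n where "(\<integral>\<^sup>+x. ennreal ((w x - k n x)\<^sup>2) \<partial>lborel) < ennreal e"
    using eventually_happens by fastforce
  thus ?thesis using kc k0 by blast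
qed

lemma L2_dense_continuous:
  fixes w :: "'a::euclidean_space \<Rightarrow> real"
  assumes [measurable]: "w \<in> borel_measurable borel" and fin: "(\<integral>\<^sup>+x. ennreal ((w x)\<^sup>2) \<partial>lborel) < \<infinity>" and e: "e > 0"
  obtains k R where "continuous_on UNIV k" "\<And>x. norm x > R \<Longrightarrow> k x = 0" "R \<ge> 0"
    "(\<integral>\<^sup>+x. ennreal ((w x - k x)\<^sup>2) \<partial>lborel) < ennreal e"
proof -
  define W where "W m x = (if norm x \<le> real m then max (- real m) (min (real m) (w x)) else 0)" for m x
  have [measurable]: "W m \<in> borel_measurable borel" for m unfolding W_def by measurable
  have "(\<lambda>m. \<integral>\<^sup>+x. ennreal ((w x - W m x)\<^sup>2) \<partial>lborel) \<longlonglongrightarrow> (\<integral>\<^sup>+(x::'a). 0 \<partial>lborel)"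
  proof (rule nn_integral_dominated_convergence[where w="\<lambda>x. ennreal ((w x)\<^sup>2)"])
    fix m
    have "\<bar>w x - W m x\<bar> \<le> \<bar>w x\<bar>" for x by (auto simp: W_def max_def min_def)
    thus "AE x in lborel. ennreal ((w x - W m x)\<^sup>2) \<le> ennreal ((w x)\<^sup>2)"
      by (intro AE_I2 ennreal_leI) (simp add: abs_le_square_iff)
  next
    show "AE x in lborel. (\<lambda>m. ennreal ((w x - W m x)\<^sup>2)) \<longlonglongrightarrow> 0"
    proof (rule AE_I2)
      fix x
      obtain m0 :: nat where m0: "\<bar>w x\<bar> + norm x \<le> real m0" using real_arch_simple by blast
      have "W m x = w x" if "m \<ge> m0" for m
      proof -
        have "\<bar>w x\<bar> + norm x \<le> real m" using m0 that by (meson of_nat_mono order_trans)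
        hence "norm x \<le> real m" "- real m \<le> w x" "w x \<le> real m" using norm_ge_zero[of x] by linarith+
        thus ?thesis by (auto simp: W_def)
      qed
      hence "\<forall>\<^sub>F m in sequentially. ennreal ((w x - W m x)\<^sup>2) = 0"
        unfolding eventually_sequentially by (intro exI[of _ m0]) auto
      thus "(\<lambda>m. ennreal ((w x - W m x)\<^sup>2)) \<longlonglongrightarrow> 0" by (rule tendsto_eventually)
    qed
  qed (use fin in auto)
  hence "\<forall>\<^sub>F n in sequentially. (\<integral>\<^sup>+x. ennreal ((w x - W n x)\<^sup>2) \<partial>lborel) < ennreal (e / 8)"
    by (intro order_tendstoD(2)) (use e in auto)
  then obtain m where m: "(\<integral>\<^sup>+x. ennreal ((w x - W m x)\<^sup>2) \<partial>lborel) < ennreal (e / 8)"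
    using eventually_happens by fastforce
  have "\<bar>W m x\<bar> \<le> real m" "norm x > real m \<Longrightarrow> W m x = 0" for x by (auto simp: W_def)
  with L2_dense_continuous_bounded[of "W m" "real m" "e / 8"] e
  obtain k where k: "continuous_on UNIV k" "\<forall>x. norm x > real m + 1 \<longrightarrow> k x = 0"
    "(\<integral>\<^sup>+x. ennreal ((W m x - k x)\<^sup>2) \<partial>lborel) < ennreal (e / 8)" by auto
  have [measurable]: "k \<in> borel_measurable borel" using k(1) by (rule borel_measurable_continuous_onI)
  have "(\<integral>\<^sup>+x. ennreal ((w x - k x)\<^sup>2) \<partial>lborel) \<le> (\<integral>\<^sup>+x. 2 * ennreal ((w x - W m x)\<^sup>2) + 2 * ennreal ((W m x - k x)\<^sup>2) \<partial>lborel)"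
  proof (rule nn_integral_mono, goal_cases)
    case (1 x)
    have "(w x - k x)\<^sup>2 \<le> 2 * (w x - W m x)\<^sup>2 + 2 * (W m x - k x)\<^sup>2"
      using zero_le_power2[of "w x - W m x - (W m x - k x)"] by (simp add: power2_eq_square algebra_simps)
    hence "ennreal ((w x - k x)\<^sup>2) \<le> ennreal (2 * (w x - W m x)\<^sup>2 + 2 * (W m x - k x)\<^sup>2)" by (rule ennreal_leI)
    thus ?case by (simp add: ennreal_plus ennreal_mult)
  qed
  also have "\<dots> = 2 * (\<integral>\<^sup>+x. ennreal ((w x - W m x)\<^sup>2) \<partial>lborel) + 2 * (\<integral>\<^sup>+x. ennreal ((W m x - k x)\<^sup>2) \<partial>lborel)"
    by (simp add: nn_integral_add nn_integral_cmult)
  also have "\<dots> \<le> ennreal 2 * ennreal (e / 8) + ennreal 2 * ennreal (e / 8)"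
    using m k(3) by (intro add_mono mult_mono) auto
  also have "\<dots> = ennreal (e / 2)" using e by (simp only: ennreal_mult[symmetric] ennreal_plus[symmetric]) simp
  also have "\<dots> < ennreal e" using e by (intro ennreal_lessI) auto
  finally show thesis using k by (intro that[of k "real m + 1"]) auto
qed

lemma mollify_continuous_uniform:
  fixes k :: "'a::euclidean_space \<Rightarrow> real"
  assumes k: "integrable lborel k" and \<delta>: "\<delta> > 0"
    and unif: "\<And>x y. norm (y - x) < \<delta> \<Longrightarrow> \<bar>k y - k x\<bar> \<le> e"
  shows "\<bar>mollify \<delta> k x - k x\<bar> \<le> e"
proof -
  let ?c = "bump_mass TYPE('a) \<delta>"
  have c: "?c > 0" by (rule bump_mass_pos[OF \<delta>])
  have "(mollify \<delta> k x - k x) * ?c = (LINT y|lborel. k y * bump \<delta> (y - x)) - k x * ?c"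
    unfolding mollify_def conv_def using c by (simp add: field_simps)
  also have "\<dots> = (LINT y|lborel. bump \<delta> (y - x) * (k y - k x))"
    using conv_bump_integrable[OF k, of \<delta> x] bump_shift[OF \<delta>, of x] by (simp add: right_diff_distrib mult.commute[of "bump \<delta> _"])
  finally have "\<bar>mollify \<delta> k x - k x\<bar> * ?c = \<bar>LINT y|lborel. bump \<delta> (y - x) * (k y - k x)\<bar>"
    using c by (metis abs_mult abs_of_pos)
  also have "\<dots> \<le> (LINT y|lborel. \<bar>bump \<delta> (y - x) * (k y - k x)\<bar>)" by (rule integral_abs_bound)
  also have "\<dots> \<le> (LINT y|lborel. e * bump \<delta> (y - x))"
  proof (rule integral_mono')
    show "integrable lborel (\<lambda>y. e * bump \<delta> (y - x))" using bump_shift(1)[OF \<delta>, of x] by auto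
    have e: "e \<ge> 0" using unif[of x x] \<delta> by simp
    fix y
    show "0 \<le> e * bump \<delta> (y - x)" using e bump_nonneg[of \<delta> "y - x"] by simp
    show "\<bar>bump \<delta> (y - x) * (k y - k x)\<bar> \<le> e * bump \<delta> (y - x)"
    proof (cases "norm (y - x) < \<delta>")
      case True
      have "\<bar>k y - k x\<bar> * bump \<delta> (y - x) \<le> e * bump \<delta> (y - x)"
        by (intro mult_right_mono unif True bump_nonneg)
      thus ?thesis using bump_nonneg[of \<delta> "y - x"] by (simp add: abs_mult mult.commute)
    next
      case False thus ?thesis using bump_outside(1)[of \<delta> "y - x"] \<delta> by simp
    qed
  qed
  also have "\<dots> = e * ?c" using bump_shift(2)[OF \<delta>, of x] by simp
  finally show ?thesis using c by simp
qed

text \<open>Mollification is a contraction in the mean square, converges uniformly on continuous functions of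
  compact support, and those are dense.\<close>

lemma mollify_L2_converges:
  fixes w :: "'a::euclidean_space \<Rightarrow> real"
  assumes w: "integrable lborel w" and fin: "(\<integral>\<^sup>+x. ennreal ((w x)\<^sup>2) \<partial>lborel) < \<infinity>" and e: "e > 0"
  shows "\<exists>\<delta>0>0. \<forall>\<delta>. 0 < \<delta> \<and> \<delta> < \<delta>0 \<longrightarrow> (\<integral>\<^sup>+x. ennreal ((mollify \<delta> w x - w x)\<^sup>2) \<partial>lborel) < ennreal e"
proof -
  have wm[measurable]: "w \<in> borel_measurable borel" using w by auto
  \<comment> \<open>three errors below \<open>e / 18\<close>, each with the factor \<open>3\<close>, add up to at most \<open>e / 2\<close>\<close>
  have e9: "e / 18 > 0" using e by simp
  obtain k R where k: "continuous_on UNIV k" "\<And>x. norm x > R \<Longrightarrow> k x = 0" "R \<ge> 0"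
    and wk: "(\<integral>\<^sup>+x. ennreal ((w x - k x)\<^sup>2) \<partial>lborel) < ennreal (e / 18)"
    using L2_dense_continuous[OF wm fin e9] by blast
  have ki: "integrable lborel k" by (rule integrable_continuous_cball[OF k(1,2)])
  have [measurable]: "k \<in> borel_measurable borel" using k(1) by (rule borel_measurable_continuous_onI)
  define B where "B = measure lborel (cball (0::'a) (R + 1)) + 1"
  have B: "B > 0" unfolding B_def by (intro add_nonneg_pos) auto
  have Bm: "emeasure lborel (cball (0::'a) (R + 1)) \<le> ennreal B"
  proof -
    have "emeasure lborel (cball (0::'a) (R + 1)) < \<infinity>" by (rule emeasure_bounded_finite) auto
    thus ?thesis unfolding B_def by (subst emeasure_eq_ennreal_measure) (auto intro!: ennreal_leI)
  qed
  \<comment> \<open>chosen so that a uniform error \<open>s\<close> on a set of measure \<open>B\<close> has mean square at most \<open>e / 36\<close>\<close>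
  define s where "s = sqrt (e / 18 / (2 * B))"
  have s: "s > 0" "s\<^sup>2 = e / 18 / (2 * B)" using e B by (auto simp: s_def)
  obtain d where d: "0 < d" "d \<le> 1" "\<And>x y. norm (y - x) < d \<Longrightarrow> norm (k y - k x) \<le> s"
    using uniformly_continuous_compact_support[OF k(1,2) s(1)] by metis
  show ?thesis
  proof (intro exI[of _ d] conjI allI impI d(1))
    fix \<delta> assume "0 < \<delta> \<and> \<delta> < d"
    hence \<delta>: "0 < \<delta>" "\<delta> < d" by auto
    have [measurable]: "mollify \<delta> k \<in> borel_measurable borel" "mollify \<delta> w \<in> borel_measurable borel"
      by (auto intro!: mollify_measurable w ki \<delta>)
    have 1: "(\<integral>\<^sup>+x. ennreal ((mollify \<delta> w x - mollify \<delta> k x)\<^sup>2) \<partial>lborel) < ennreal (e / 18)"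
    proof -
      have "(\<integral>\<^sup>+x. ennreal ((mollify \<delta> (\<lambda>x. w x - k x) x)\<^sup>2) \<partial>lborel) \<le> (\<integral>\<^sup>+x. ennreal ((w x - k x)\<^sup>2) \<partial>lborel)"
        using w ki \<delta> by (intro mollify_L2_contraction) auto
      thus ?thesis using wk unfolding mollify_diff[OF w ki] by (rule le_less_trans)
    qed
    have 2: "(\<integral>\<^sup>+x. ennreal ((mollify \<delta> k x - k x)\<^sup>2) \<partial>lborel) < ennreal (e / 18)"
    proof -
      have b: "\<bar>mollify \<delta> k x - k x\<bar> \<le> s" for x
        using d(3) \<delta> by (intro mollify_continuous_uniform[OF ki \<delta>(1)]) force
      have z: "mollify \<delta> k x - k x = 0" if "norm x > R + 1" for x
      proof -
        have kz: "k y * bump \<delta> (y - x) = 0" for y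
        proof (cases "norm (y - x) < \<delta>")
          case True
          have "norm x \<le> norm y + norm (y - x)" using norm_triangle_sub[of x y] by (simp add: norm_minus_commute)
          hence "norm y > R" using that True \<delta> d(2) by linarith
          thus ?thesis using k(2) by simp
        next
          case False thus ?thesis using bump_outside(1)[of \<delta> "y - x"] \<delta> by simp
        qed
        have "conv k (bump \<delta>) x = 0" by (simp add: conv_def kz)
        thus ?thesis using k(2)[of x] that by (simp add: mollify_def)
      qed
      have "(\<integral>\<^sup>+x. ennreal ((mollify \<delta> k x - k x)\<^sup>2) \<partial>lborel) \<le> (\<integral>\<^sup>+x. ennreal (s\<^sup>2) * indicator (cball (0::'a) (R + 1)) x \<partial>lborel)"
      proof (rule nn_integral_mono, goal_cases)
        case (1 x)
        have "(mollify \<delta> k x - k x)\<^sup>2 \<le> s\<^sup>2" using b[of x] s(1) by (intro abs_le_square_iff[THEN iffD1]) auto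
        thus ?case using z[of x] by (cases "norm x \<le> R + 1") (auto intro: ennreal_leI)
      qed
      also have "\<dots> = ennreal (s\<^sup>2) * emeasure lborel (cball (0::'a) (R + 1))" by (rule nn_integral_cmult_indicator) auto
      also have "\<dots> \<le> ennreal (s\<^sup>2) * ennreal B" by (intro mult_left_mono Bm) auto
      also have "\<dots> = ennreal (e / 36)" using B e unfolding s(2) by (simp add: ennreal_mult[symmetric])
      also have "\<dots> < ennreal (e / 18)" using e by (intro ennreal_lessI) auto
      finally show ?thesis .
    qed
    have "(\<integral>\<^sup>+x. ennreal ((mollify \<delta> w x - w x)\<^sup>2) \<partial>lborel) \<le>
      (\<integral>\<^sup>+x. 3 * ennreal ((mollify \<delta> w x - mollify \<delta> k x)\<^sup>2) + (3 * ennreal ((mollify \<delta> k x - k x)\<^sup>2) + 3 * ennreal ((w x - k x)\<^sup>2)) \<partial>lborel)"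
    proof (rule nn_integral_mono, goal_cases)
      case (1 x)
      from square_sum3_le[of "mollify \<delta> w x - mollify \<delta> k x" "mollify \<delta> k x - k x" "k x - w x"]
      have "(mollify \<delta> w x - w x)\<^sup>2 \<le> 3 * (mollify \<delta> w x - mollify \<delta> k x)\<^sup>2 + (3 * (mollify \<delta> k x - k x)\<^sup>2 + 3 * (w x - k x)\<^sup>2)"
        by (simp add: power2_commute[of "k x" "w x"])
      hence "ennreal ((mollify \<delta> w x - w x)\<^sup>2) \<le> ennreal (3 * (mollify \<delta> w x - mollify \<delta> k x)\<^sup>2 + (3 * (mollify \<delta> k x - k x)\<^sup>2 + 3 * (w x - k x)\<^sup>2))"
        by (rule ennreal_leI)
      thus ?case by (simp add: ennreal_plus ennreal_mult)
    qed
    also have "\<dots> = 3 * (\<integral>\<^sup>+x. ennreal ((mollify \<delta> w x - mollify \<delta> k x)\<^sup>2) \<partial>lborel)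
       + (3 * (\<integral>\<^sup>+x. ennreal ((mollify \<delta> k x - k x)\<^sup>2) \<partial>lborel) + 3 * (\<integral>\<^sup>+x. ennreal ((w x - k x)\<^sup>2) \<partial>lborel))"
      by (simp add: nn_integral_add nn_integral_cmult)
    also have "\<dots> \<le> ennreal 3 * ennreal (e / 18) + (ennreal 3 * ennreal (e / 18) + ennreal 3 * ennreal (e / 18))"
      using 1 2 wk by (intro add_mono mult_mono) auto
    also have "\<dots> = ennreal (e / 2)" using e by (simp only: ennreal_mult[symmetric] ennreal_plus[symmetric]) simp
    also have "\<dots> < ennreal e" using e by (intro ennreal_lessI) auto
    finally show "(\<integral>\<^sup>+x. ennreal ((mollify \<delta> w x - w x)\<^sup>2) \<partial>lborel) < ennreal e" .
  qed
qed

section \<open>Smooth approximation of weak subsolutions\<close>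

text \<open>The information on a weak subsolution in the ball of radius \<open>R\<close> around the origin that enters the
  proof: the definitions of weak gradient and of weak subsolution tested with translated bumps only,
  for Borel functions on the whole space.\<close>

definition centered_subsolution :: "('n \<Rightarrow> real) \<Rightarrow> real \<Rightarrow> (real^'n \<Rightarrow> real) \<Rightarrow> (real^'n \<Rightarrow> real^'n) \<Rightarrow> bool" where
  "centered_subsolution a R u G \<longleftrightarrow> u \<in> borel_measurable borel \<and> G \<in> borel_measurable borel \<and> (\<forall>x. 0 \<le> u x) \<and>
    (\<forall>\<rho><R. (\<integral>\<^sup>+x. indicator (cball 0 \<rho>) x * ennreal ((u x)\<^sup>2 + (norm (G x))\<^sup>2) \<partial>lborel) < \<infinity>) \<and>
    (\<forall>x \<delta>. 0 < \<delta> \<longrightarrow> norm x + \<delta> < R \<longrightarrow>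
       (\<forall>i. (LINT y|lborel. u y * bump_grad \<delta> (y - x) $ i) = - (LINT y|lborel. G y $ i * bump \<delta> (y - x))) \<and>
       (LINT y|lborel. (\<Sum>i\<in>UNIV. a i * (G y $ i * bump_grad \<delta> (y - x) $ i))) \<le> 0)"

lemma borel_measurable_vec_nth' [measurable (raw)]:
  fixes f :: "'a \<Rightarrow> real^'n"
  assumes [measurable]: "f \<in> borel_measurable M"
  shows "(\<lambda>x. f x $ i) \<in> borel_measurable M"
  unfolding cart_eq_inner_axis by measurable

text \<open>On a set of finite measure square integrability implies integrability, as \<open>\<bar>t\<bar> \<le> 1 + t\<^sup>2\<close>.\<close>

lemma L2_truncated_integrable:
  fixes w :: "'a::euclidean_space \<Rightarrow> real"
  assumes [measurable]: "w \<in> borel_measurable borel"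
    and fin: "(\<integral>\<^sup>+x. indicator (cball 0 \<rho>) x * ennreal ((w x)\<^sup>2) \<partial>lborel) < \<infinity>"
  defines "W \<equiv> (\<lambda>x. if norm x \<le> \<rho> then w x else 0)"
  shows "integrable lborel W" and "(\<integral>\<^sup>+x. ennreal ((W x)\<^sup>2) \<partial>lborel) < \<infinity>"
proof -
  have [measurable]: "W \<in> borel_measurable borel" unfolding W_def by measurable
  have eq: "ennreal ((W x)\<^sup>2) = indicator (cball 0 \<rho>) x * ennreal ((w x)\<^sup>2)" for x
    by (auto simp: W_def indicator_def)
  show 2: "(\<integral>\<^sup>+x. ennreal ((W x)\<^sup>2) \<partial>lborel) < \<infinity>" using fin by (simp add: eq)
  have i2: "integrable lborel (\<lambda>x. (W x)\<^sup>2)" using 2 by (intro integrableI_bounded) auto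
  have i1: "integrable lborel (\<lambda>x. indicator (cball (0::'a) \<rho>) x *\<^sub>R (1::real))"
    by (rule borel_integrable_compact) auto
  show "integrable lborel W"
  proof (rule Bochner_Integration.integrable_bound[OF Bochner_Integration.integrable_add[OF i1 i2]])
    show "AE x in lborel. norm (W x) \<le> norm (indicator (cball 0 \<rho>) x *\<^sub>R (1::real) + (W x)\<^sup>2)"
    proof (rule AE_I2)
      fix x
      have "\<bar>t\<bar> \<le> 1 + t\<^sup>2" for t :: real
      proof -
        have "0 \<le> (\<bar>t\<bar> - 1/2)\<^sup>2" by simp
        also have "\<dots> = t\<^sup>2 - \<bar>t\<bar> + 1/4" by (simp add: power2_eq_square algebra_simps)
        finally show ?thesis by linarith
      qed
      thus "norm (W x) \<le> norm (indicator (cball 0 \<rho>) x *\<^sub>R (1::real) + (W x)\<^sup>2)"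
        by (auto simp: W_def indicator_def)
    qed
  qed auto
qed

text \<open>Testing with \<open>y \<mapsto> bump \<delta> (y - x)\<close> shows that the gradient of the mollified function is the
  mollified weak gradient, and that the mollified function satisfies the differential inequality at
  \<open>x\<close>. Truncation to a ball of radius \<open>\<rho>\<close> between \<open>r\<close> and \<open>R\<close> makes all functions integrable
  without changing the mollification in the ball of radius \<open>r\<close>.\<close>

lemma mollified_subsolution:
  fixes a :: "'n::finite \<Rightarrow> real" and u :: "real^'n \<Rightarrow> real"
  assumes W: "centered_subsolution a R u G" and r: "0 < r" "r < R" and e: "e > 0"
  obtains f g d where "f \<in> borel_measurable borel" "g \<in> borel_measurable borel"
    "\<And>x. x \<in> ball 0 r \<Longrightarrow> (f has_derivative (\<lambda>v. g x \<bullet> v)) (at x)"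
    "\<And>i x. x \<in> ball 0 r \<Longrightarrow> ((\<lambda>t. g (x + t *\<^sub>R axis i 1) $ i) has_real_derivative d i x) (at 0)"
    "continuous_on (ball 0 r) g" "\<And>i. continuous_on (ball 0 r) (d i)"
    "\<And>x. x \<in> ball 0 r \<Longrightarrow> 0 \<le> f x"
    "\<And>x. x \<in> ball 0 r \<Longrightarrow> 0 \<le> (\<Sum>i\<in>UNIV. a i * d i x)"
    "(\<integral>\<^sup>+x. indicator (ball 0 r) x * ennreal ((f x - u x)\<^sup>2 + (norm (g x - G x))\<^sup>2) \<partial>lborel) < ennreal e"
proof -
  let ?N = "real CARD('n)"
  define \<rho> where "\<rho> = (r + R) / 2"
  have \<rho>: "r < \<rho>" "\<rho> < R" using r by (auto simp: \<rho>_def)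
  have [measurable]: "u \<in> borel_measurable borel" "G \<in> borel_measurable borel"
    and u0: "\<And>x. 0 \<le> u x"
    and fin: "(\<integral>\<^sup>+x. indicator (cball 0 \<rho>) x * ennreal ((u x)\<^sup>2 + (norm (G x))\<^sup>2) \<partial>lborel) < \<infinity>"
    and wg: "\<And>x \<delta> i. 0 < \<delta> \<Longrightarrow> norm x + \<delta> < R \<Longrightarrow> (LINT y|lborel. u y * bump_grad \<delta> (y - x) $ i) = - (LINT y|lborel. G y $ i * bump \<delta> (y - x))"
    and ws: "\<And>x \<delta>. 0 < \<delta> \<Longrightarrow> norm x + \<delta> < R \<Longrightarrow> (LINT y|lborel. (\<Sum>i\<in>UNIV. a i * (G y $ i * bump_grad \<delta> (y - x) $ i))) \<le> 0"
    using W \<rho>(2) unfolding centered_subsolution_def by blast+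
  define U where "U x = (if norm x \<le> \<rho> then u x else 0)" for x
  define V where "V i x = (if norm x \<le> \<rho> then G x $ i else 0)" for i x
  have finu: "(\<integral>\<^sup>+x. indicator (cball 0 \<rho>) x * ennreal ((u x)\<^sup>2) \<partial>lborel) < \<infinity>"
    by (rule le_less_trans[OF _ fin], rule nn_integral_mono, rule mult_left_mono) (auto intro!: ennreal_leI)
  have finG: "(\<integral>\<^sup>+x. indicator (cball 0 \<rho>) x * ennreal ((G x $ i)\<^sup>2) \<partial>lborel) < \<infinity>" for i
  proof (rule le_less_trans[OF _ fin], rule nn_integral_mono, rule mult_left_mono, rule ennreal_leI)
    fix x
    have "(G x $ i)\<^sup>2 \<le> (norm (G x))\<^sup>2" using component_le_norm_cart[of "G x" i] by (intro abs_le_square_iff[THEN iffD1]) auto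
    thus "(G x $ i)\<^sup>2 \<le> (u x)\<^sup>2 + (norm (G x))\<^sup>2" using zero_le_power2[of "u x"] by linarith
  qed simp
  have Ui: "integrable lborel U" "(\<integral>\<^sup>+x. ennreal ((U x)\<^sup>2) \<partial>lborel) < \<infinity>"
    using L2_truncated_integrable[OF _ finu] by (auto simp: U_def[abs_def])
  have Vi: "integrable lborel (V i)" "(\<integral>\<^sup>+x. ennreal ((V i x)\<^sup>2) \<partial>lborel) < \<infinity>" for i
    using L2_truncated_integrable[OF _ finG, of i] by (auto simp: V_def[abs_def])
  define e' where "e' = e / (2 * (?N + 1))"
  have e': "e' > 0" using e by (simp add: e'_def)
  have ev1: "\<forall>\<^sub>F \<delta> in at_right 0. (\<integral>\<^sup>+x. ennreal ((mollify \<delta> U x - U x)\<^sup>2) \<partial>lborel) < ennreal e'"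
    using mollify_L2_converges[OF Ui e'] unfolding eventually_at_right_field by auto
  have ev2: "\<forall>\<^sub>F \<delta> in at_right 0. \<forall>i. (\<integral>\<^sup>+x. ennreal ((mollify \<delta> (V i) x - V i x)\<^sup>2) \<partial>lborel) < ennreal e'"
  proof (rule eventually_all_finite)
    fix i
    show "\<forall>\<^sub>F \<delta> in at_right 0. (\<integral>\<^sup>+x. ennreal ((mollify \<delta> (V i) x - V i x)\<^sup>2) \<partial>lborel) < ennreal e'"
      using mollify_L2_converges[OF Vi(1)[of i] Vi(2)[of i] e'] unfolding eventually_at_right_field by auto
  qed
  have ev3: "\<forall>\<^sub>F \<delta> in at_right (0::real). 0 < \<delta> \<and> \<delta> < \<rho> - r"
    unfolding eventually_at_right_field using \<rho> by (intro exI[of _ "\<rho> - r"]) auto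
  obtain \<delta> where \<delta>: "0 < \<delta>" "\<delta> < \<rho> - r"
    and aU: "(\<integral>\<^sup>+x. ennreal ((mollify \<delta> U x - U x)\<^sup>2) \<partial>lborel) < ennreal e'"
    and aV: "\<And>i. (\<integral>\<^sup>+x. ennreal ((mollify \<delta> (V i) x - V i x)\<^sup>2) \<partial>lborel) < ennreal e'"
    using eventually_happens[OF eventually_conj[OF ev1 eventually_conj[OF ev2 ev3]]] by auto
  let ?c = "bump_mass TYPE(real^'n) \<delta>"
  have c: "?c > 0" by (rule bump_mass_pos[OF \<delta>(1)])
  define f where "f = mollify \<delta> U"
  define g where "g x = (\<chi> i. mollify \<delta> (V i) x)" for x
  define d where "d i x = - (LINT y|lborel. V i y * bump_grad \<delta> (y - x) $ i) / ?c" for i x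
  have bo: "bump \<delta> v = 0" "bump_grad \<delta> v = 0" if "norm v > \<delta>" for v :: "real^'n"
    using bump_outside[of \<delta> v] that \<delta> by auto
  \<comment> \<open>a bump of radius \<open>\<delta>\<close> centred in the ball of radius \<open>r\<close> does not see the truncation\<close>
  have local: "U y * k (y - x) = u y * k (y - x)" "V i y * k (y - x) = G y $ i * k (y - x)"
    if x: "x \<in> ball 0 r" and k: "\<And>v. norm v > \<delta> \<Longrightarrow> k v = 0" for x y i and k :: "real^'n \<Rightarrow> real"
  proof -
    have "norm y \<le> norm x + norm (y - x)" using norm_triangle_sub[of y x] by simp
    hence "norm y \<le> \<rho> \<or> norm (y - x) > \<delta>" using x \<delta> by auto
    thus "U y * k (y - x) = u y * k (y - x)" "V i y * k (y - x) = G y $ i * k (y - x)"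
      using k by (auto simp: U_def V_def)
  qed
  have bgc: "continuous_on S (\<lambda>v. bump_grad \<delta> v $ i)" for S :: "(real^'n) set" and i
    by (intro continuous_intros continuous_bump_grad)
  obtain M where M: "\<And>v::real^'n. norm (bump_grad \<delta> v) \<le> M"
    using compact_support_bounded[OF continuous_bump_grad bo(2)] by metis
  have bgi: "integrable lborel (\<lambda>y. w y * bump_grad \<delta> (y - x) $ i)" if "integrable lborel w" for w and x :: "real^'n" and i
    by (rule integrable_mult_bounded_kernel[OF that, where k="\<lambda>v. bump_grad \<delta> v $ i" and M=M])
       (auto intro: order_trans[OF component_le_norm_cart M])
  have cd: "(conv w (bump \<delta>) has_derivative (\<lambda>h. - (LINT y|lborel. w y * (bump_grad \<delta> (y - x) \<bullet> h)))) (at x)"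
    if "integrable lborel w" for w and x :: "real^'n"
    by (rule conv_has_derivative[OF that continuous_bump bo(1) continuous_bump_grad bo(2) bump_has_derivative])
  have pos: "norm x + \<delta> < R" if "x \<in> ball 0 r" for x :: "real^'n" using that \<delta> \<rho> by simp
  show thesis
  proof (rule that[of f g d])
    show "f \<in> borel_measurable borel" unfolding f_def by (intro mollify_measurable Ui \<delta>)
    show "g \<in> borel_measurable borel" unfolding g_def[abs_def]
      by (intro borel_measurable_continuous_onI continuous_on_vec_lambda, unfold mollify_def[abs_def])
         (use c in \<open>auto intro!: continuous_intros conv_continuous[where R=\<delta>] Vi continuous_bump bo(1)\<close>)
    show "continuous_on (ball 0 r) g" unfolding g_def[abs_def]
      by (intro continuous_on_vec_lambda, unfold mollify_def[abs_def])
         (use c in \<open>auto intro!: continuous_intros conv_continuous[where R=\<delta>] Vi continuous_bump bo(1)\<close>)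
    show "continuous_on (ball 0 r) (d i)" for i
    proof -
      have "continuous_on (ball 0 r) (conv (V i) (\<lambda>v. bump_grad \<delta> v $ i))"
        by (rule conv_continuous[OF Vi(1) bgc, where R=\<delta>]) (simp add: bo)
      thus ?thesis unfolding d_def[abs_def] conv_def[abs_def] by (intro continuous_intros) (use c in auto)
    qed
    fix x :: "real^'n" assume x: "x \<in> ball 0 r"
    show "0 \<le> f x" unfolding f_def mollify_def conv_def using c
      by (intro divide_nonneg_nonneg Bochner_Integration.integral_nonneg mult_nonneg_nonneg bump_nonneg) (auto simp: U_def u0)
    have gx: "g x $ i = - (LINT y|lborel. U y * bump_grad \<delta> (y - x) $ i) / ?c" for i
    proof -
      have l1: "U y * bump_grad \<delta> (y - x) $ i = u y * bump_grad \<delta> (y - x) $ i" for y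
        by (rule local(1)[OF x, where k="\<lambda>v. bump_grad \<delta> v $ i"]) (simp add: bo)
      have l2: "V i y * bump \<delta> (y - x) = G y $ i * bump \<delta> (y - x)" for y
        by (rule local(2)[OF x bo(1)])
      show ?thesis unfolding g_def mollify_def conv_def using wg[OF \<delta>(1) pos[OF x], of i] by (simp add: l1 l2)
    qed
    show "(f has_derivative (\<lambda>v. g x \<bullet> v)) (at x)"
    proof -
      have "(f has_derivative (\<lambda>h. - (LINT y|lborel. U y * (bump_grad \<delta> (y - x) \<bullet> h)) / ?c)) (at x)"
        unfolding f_def mollify_def[abs_def] using has_derivative_mult_left[OF cd[OF Ui(1), of x], of "1 / ?c"] by simp
      moreover have "- (LINT y|lborel. U y * (bump_grad \<delta> (y - x) \<bullet> h)) / ?c = g x \<bullet> h" for h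
      proof -
        have "(LINT y|lborel. U y * (bump_grad \<delta> (y - x) \<bullet> h)) = (LINT y|lborel. (\<Sum>i\<in>UNIV. (U y * bump_grad \<delta> (y - x) $ i) * h $ i))"
          by (simp add: inner_vec_def sum_distrib_left mult_ac)
        also have "\<dots> = (\<Sum>i\<in>UNIV. (LINT y|lborel. U y * bump_grad \<delta> (y - x) $ i) * h $ i)"
          using bgi[OF Ui(1)] by simp
        also have "- \<dots> / ?c = (\<Sum>i\<in>UNIV. g x $ i * h $ i)"
          unfolding gx by (simp add: sum_negf[symmetric] sum_divide_distrib)
        finally show ?thesis by (simp add: inner_vec_def)
      qed
      ultimately show ?thesis by simp
    qed
    show "((\<lambda>t. g (x + t *\<^sub>R axis i 1) $ i) has_real_derivative d i x) (at 0)" for i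
    proof -
      have "((\<lambda>t. x + t *\<^sub>R axis i 1) has_derivative (\<lambda>h. h *\<^sub>R axis i 1)) (at 0)"
        by (auto intro!: derivative_eq_intros)
      moreover have "(mollify \<delta> (V i) has_derivative (\<lambda>h. - (LINT y|lborel. V i y * (bump_grad \<delta> (y - x) \<bullet> h)) / ?c)) (at (x + 0 *\<^sub>R axis i 1))"
        unfolding mollify_def[abs_def] using has_derivative_mult_left[OF cd[OF Vi(1)[of i], of x], of "1 / ?c"] by simp
      ultimately have "((\<lambda>t. mollify \<delta> (V i) (x + t *\<^sub>R axis i 1)) has_derivative
         (\<lambda>h. - (LINT y|lborel. V i y * (bump_grad \<delta> (y - x) \<bullet> (h *\<^sub>R axis i 1))) / ?c)) (at 0)"
        by (rule has_derivative_compose)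
      thus ?thesis unfolding has_field_derivative_def g_def
        by (simp, elim has_derivative_eq_rhs) (auto simp: d_def inner_axis fun_eq_iff mult.left_commute[of _ "_::real" "_ $ _"])
    qed
    show "0 \<le> (\<Sum>i\<in>UNIV. a i * d i x)"
    proof -
      have "(\<Sum>i\<in>UNIV. a i * d i x) = - (\<Sum>i\<in>UNIV. a i * (LINT y|lborel. V i y * bump_grad \<delta> (y - x) $ i)) / ?c"
        by (simp add: d_def sum_negf[symmetric] sum_divide_distrib)
      also have "(\<Sum>i\<in>UNIV. a i * (LINT y|lborel. V i y * bump_grad \<delta> (y - x) $ i)) = (LINT y|lborel. (\<Sum>i\<in>UNIV. a i * (V i y * bump_grad \<delta> (y - x) $ i)))"
        using bgi[OF Vi(1)] by simp
      also have "\<dots> = (LINT y|lborel. (\<Sum>i\<in>UNIV. a i * (G y $ i * bump_grad \<delta> (y - x) $ i)))"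
      proof -
        have l3: "V i y * bump_grad \<delta> (y - x) $ i = G y $ i * bump_grad \<delta> (y - x) $ i" for y i
          by (rule local(2)[OF x, where k="\<lambda>v. bump_grad \<delta> v $ i"]) (simp add: bo)
        show ?thesis by (simp only: l3)
      qed
      finally show ?thesis using ws[OF \<delta>(1) pos[OF x]] c by (simp add: divide_nonpos_pos)
    qed
  next
    have [measurable]: "mollify \<delta> U \<in> borel_measurable borel" "U \<in> borel_measurable borel"
      "\<And>i. mollify \<delta> (V i) \<in> borel_measurable borel" "\<And>i. V i \<in> borel_measurable borel"
      using Ui Vi by (auto intro!: mollify_measurable \<delta>)
    have "(\<integral>\<^sup>+x. indicator (ball 0 r) x * ennreal ((f x - u x)\<^sup>2 + (norm (g x - G x))\<^sup>2) \<partial>lborel)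
      \<le> (\<integral>\<^sup>+x. ennreal ((mollify \<delta> U x - U x)\<^sup>2) + (\<Sum>i\<in>UNIV. ennreal ((mollify \<delta> (V i) x - V i x)\<^sup>2)) \<partial>lborel)"
    proof (rule nn_integral_mono, goal_cases)
      case (1 x)
      show ?case
      proof (cases "x \<in> ball 0 r")
        case True
        hence n: "norm x \<le> \<rho>" using \<rho> by simp
        have "(norm (g x - G x))\<^sup>2 = (\<Sum>i\<in>UNIV. (mollify \<delta> (V i) x - V i x)\<^sup>2)"
          unfolding power2_norm_eq_inner inner_vec_def using n by (simp add: g_def V_def power2_eq_square)
        hence "ennreal ((norm (g x - G x))\<^sup>2) = (\<Sum>i\<in>UNIV. ennreal ((mollify \<delta> (V i) x - V i x)\<^sup>2))"
          by (simp add: sum_ennreal)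
        thus ?thesis using True n by (simp add: ennreal_plus f_def U_def)
      qed simp
    qed
    also have "\<dots> = (\<integral>\<^sup>+x. ennreal ((mollify \<delta> U x - U x)\<^sup>2) \<partial>lborel) + (\<Sum>i\<in>UNIV. (\<integral>\<^sup>+x. ennreal ((mollify \<delta> (V i) x - V i x)\<^sup>2) \<partial>lborel))"
      apply (subst nn_integral_add)
      subgoal by measurable
      subgoal by measurable
      apply (subst nn_integral_sum)
      subgoal by measurable
      by (rule refl)
    also have "\<dots> \<le> ennreal e' + (\<Sum>i\<in>(UNIV::'n set). ennreal e')"
      using aU aV by (intro add_mono sum_mono) (auto intro: less_imp_le)
    also have "\<dots> = ennreal (e' + (\<Sum>i\<in>(UNIV::'n set). e'))"
      using e' by (subst sum_ennreal) (auto simp: ennreal_plus)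
    also have "e' + (\<Sum>i\<in>(UNIV::'n set). e') = e / 2"
    proof -
      have "e' + (\<Sum>i\<in>(UNIV::'n set). e') = (?N + 1) * e'" by (simp add: algebra_simps)
      also have "\<dots> = e / 2"
      proof -
        have "M * (e / (2 * M)) = e / 2" if "M > 0" for M :: real using that by simp
        thus ?thesis unfolding e'_def by this simp
      qed
      finally show ?thesis .
    qed
    also have "ennreal (e / 2) < ennreal e" using e by (intro ennreal_lessI) auto
    finally show "(\<integral>\<^sup>+x. indicator (ball 0 r) x * ennreal ((f x - u x)\<^sup>2 + (norm (g x - G x))\<^sup>2) \<partial>lborel) < ennreal e" .
  qed
qed

section \<open>The Caccioppoli inequality for weak subsolutions\<close>

text \<open>The radial cutoff \<open>\<psi>\<close> with derivative \<open>- w\<close>. The last property lets Fubini turn integrals with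
  weight \<open>\<psi> (norm x)\<close> into averages, with weight \<open>w s\<close>, of integrals over balls of radius \<open>s\<close>.\<close>

lemma tail_integral_properties:
  fixes w :: "real \<Rightarrow> real"
  assumes w: "continuous_on UNIV w" "\<And>s. 0 \<le> w s" "\<And>s. w s \<noteq> 0 \<Longrightarrow> \<alpha> \<le> s \<and> s \<le> \<beta>"
    and ab: "0 < \<alpha>" "\<alpha> < \<beta>"
  defines "\<psi> \<equiv> (\<lambda>s. integral {0..\<beta>} w - integral {0..s} w)"
  shows "\<And>s. s > 0 \<Longrightarrow> (\<psi> has_real_derivative - w s) (at s)" 
    and "\<And>s. 0 \<le> \<psi> s" 
    and "\<And>s. \<beta> < s \<Longrightarrow> \<psi> s = 0"
    and "\<And>s. 0 \<le> s \<Longrightarrow> s < \<alpha> \<Longrightarrow> \<psi> s = \<psi> 0"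
    and "\<And>s. \<psi> s \<le> integral {0..\<beta>} w"
    and "\<And>t. 0 \<le> t \<Longrightarrow> (\<integral>\<^sup>+s. ennreal (w s) * indicator {t<..} s \<partial>lborel) = ennreal (\<psi> t)"
proof -
  have int: "w integrable_on {a..b}" for a b
    by (rule integrable_continuous_real) (auto intro: continuous_on_subset[OF w(1)])
  have comb: "integral {0..b} w = integral {0..a} w + integral {a..b} w" if "0 \<le> a" "a \<le> b" for a b
    using Henstock_Kurzweil_Integration.integral_combine[OF that int] by simp
  have nn: "integral {a..b} w \<ge> 0" for a b
    by (rule Henstock_Kurzweil_Integration.integral_nonneg[OF int]) (use w in auto)
  have out: "integral {\<beta>..b} w = 0" for b
  proof -
    have "integral {\<beta>..b} w = integral {\<beta>..b} (\<lambda>s. 0)"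
      by (rule integral_spike[of "{\<beta>}"]) (use w(3) in force)+
    thus ?thesis by simp
  qed
  have ins: "integral {0..s} w = 0" if "s < \<alpha>" for s
  proof -
    have "integral {0..s} w = integral {0..s} (\<lambda>s. 0)"
      by (rule Henstock_Kurzweil_Integration.integral_cong) (use w(3) that in force)
    thus ?thesis by simp
  qed
  have beyond: "integral {0..s} w = integral {0..\<beta>} w" if "s \<ge> \<beta>" for s
    using comb[of \<beta> s] out[of s] that ab by simp
  show "(\<psi> has_real_derivative - w s) (at s)" if s: "s > 0" for s
  proof -
    have "((\<lambda>x. integral {0..x} w) has_real_derivative w s) (at s within {0..s+1})"
      by (rule integral_has_real_derivative) (use s in \<open>auto intro: continuous_on_subset[OF w(1)]\<close>)
    hence "((\<lambda>x. integral {0..x} w) has_real_derivative w s) (at s)"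
      using s by (simp add: at_within_Icc_at)
    thus ?thesis unfolding \<psi>_def by (auto intro!: derivative_eq_intros)
  qed
  show "0 \<le> \<psi> s" for s
  proof (cases "s \<ge> 0 \<and> s \<le> \<beta>")
    case True
    thus ?thesis unfolding \<psi>_def using comb[of s \<beta>] nn[of s \<beta>] by simp
  next
    case False
    thus ?thesis unfolding \<psi>_def using beyond[of s] nn[of 0 \<beta>] by (cases "s < 0") auto
  qed
  show "\<psi> s = 0" if "\<beta> < s" for s using beyond[of s] that by (simp add: \<psi>_def)
  show "\<psi> s = \<psi> 0" if "0 \<le> s" "s < \<alpha>" for s using ins[of s] that by (simp add: \<psi>_def)
  show "\<psi> s \<le> integral {0..\<beta>} w" for s using nn[of 0 s] by (simp add: \<psi>_def)
  show "(\<integral>\<^sup>+s. ennreal (w s) * indicator {t<..} s \<partial>lborel) = ennreal (\<psi> t)" if t: "0 \<le> t" for t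
  proof -
    define b where "b = max t \<beta>"
    have AE: "AE s in lborel. s \<noteq> t" by (rule AE_lborel_singleton)
    have "(\<integral>\<^sup>+s. ennreal (w s) * indicator {t<..} s \<partial>lborel) = (\<integral>\<^sup>+s. ennreal (w s) * indicator {t..b} s \<partial>lborel)"
    proof (rule nn_integral_cong_AE, use AE in eventually_elim)
      case (elim s)
      show ?case using w(3)[of s] elim by (cases "w s = 0") (auto simp: indicator_def b_def)
    qed
    also have "\<dots> = ennreal (integral {t..b} w)"
      by (rule nn_integral_has_integral_lebesgue') (use w int in auto)
    also have "integral {t..b} w = \<psi> t"
      unfolding \<psi>_def using comb[of t b] t beyond[of b] by (simp add: b_def)
    finally show ?thesis .
  qed
qed

definition energy :: "('n::finite \<Rightarrow> real) \<Rightarrow> real^'n \<Rightarrow> real" where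
  "energy a v = (\<Sum>i\<in>UNIV. a i * (v $ i)\<^sup>2)"

text \<open>For \<open>\<kappa> = 0\<close> this is the kernel \<open>\<Gamma>\<close> of the functional; for \<open>\<kappa> > 0\<close> it is a smooth
  supersolution that, away from the origin, increases to it as \<open>\<kappa>\<close> decreases to \<open>0\<close>.\<close>

definition kernel :: "('n::finite \<Rightarrow> real) \<Rightarrow> real \<Rightarrow> real^'n \<Rightarrow> real" where
  "kernel a \<kappa> x = (\<kappa> + (\<Sum>i\<in>UNIV. (x $ i)\<^sup>2 / a i)) powr ((2 - real CARD('n)) / 2)"

definition energy_in_ball :: "('n::finite \<Rightarrow> real) \<Rightarrow> (real^'n \<Rightarrow> real^'n) \<Rightarrow> real \<Rightarrow> ennreal" where
  "energy_in_ball a G s = (\<integral>\<^sup>+x. indicator (ball 0 s) x * ennreal (energy a (G x) * kernel a 0 x) \<partial>lborel)"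

lemma kernel_measurable [measurable]: "kernel a \<kappa> \<in> borel_measurable borel"
  unfolding kernel_def[abs_def] by measurable

lemma energy_measurable [measurable]: "energy a \<in> borel_measurable borel"
  unfolding energy_def[abs_def] by measurable

lemma weighted_square_sum_pos:
  fixes x :: "real^'n"
  assumes "x \<noteq> 0" and a: "\<And>i. 1 \<le> a i"
  shows "0 < (\<Sum>i\<in>UNIV. (x $ i)\<^sup>2 / a i)"
proof -
  have a0: "a i > 0" for i using a[of i] by linarith
  obtain i where "x $ i \<noteq> 0" using \<open>x \<noteq> 0\<close> by (auto simp: vec_eq_iff)
  hence "0 < (x $ i)\<^sup>2 / a i" using a0[of i] by simp
  also have "\<dots> \<le> (\<Sum>i\<in>UNIV. (x $ i)\<^sup>2 / a i)"
    using a0 by (intro member_le_sum) (auto simp: less_imp_le)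
  finally show ?thesis .
qed

lemma energy_nonneg: "(\<And>i. 1 \<le> a i) \<Longrightarrow> 0 \<le> energy a v"
  unfolding energy_def by (intro sum_nonneg mult_nonneg_nonneg) (auto intro: order_trans[of 0 1])

lemma norm_square_sum_cart: "(norm (x::real^'n))\<^sup>2 = (\<Sum>i\<in>UNIV. (x $ i)\<^sup>2)"
  unfolding power2_norm_eq_inner by (simp add: inner_vec_def power2_eq_square)

lemma energy_bounds:
  assumes a: "\<And>i. 1 \<le> a i" "\<And>i. a i \<le> L"
  shows "(norm v)\<^sup>2 \<le> energy a v" and "energy a v \<le> L * (norm v)\<^sup>2"
proof -
  show "(norm v)\<^sup>2 \<le> energy a v"
    unfolding norm_square_sum_cart energy_def
    by (rule sum_mono) (use mult_right_mono[OF a(1)] in fastforce)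
  show "energy a v \<le> L * (norm v)\<^sup>2"
    unfolding norm_square_sum_cart energy_def sum_distrib_left by (intro sum_mono mult_right_mono a) auto
qed

lemma energy_triangle:
  assumes a: "\<And>i. 1 \<le> a i"
  shows "energy a G \<le> 2 * energy a g + 2 * energy a (g - G)"
proof -
  have "energy a G \<le> (\<Sum>i\<in>UNIV. a i * (2 * (g $ i)\<^sup>2 + 2 * ((g - G) $ i)\<^sup>2))"
    unfolding energy_def
  proof (intro sum_mono mult_left_mono)
    fix i
    show "(G $ i)\<^sup>2 \<le> 2 * (g $ i)\<^sup>2 + 2 * ((g - G) $ i)\<^sup>2"
      using zero_le_power2[of "2 * g $ i - G $ i"] by (simp add: power2_eq_square algebra_simps)
    show "0 \<le> a i" using a[of i] by linarith
  qed
  thus ?thesis by (simp add: energy_def sum_distrib_left distrib_left sum.distrib mult_ac)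
qed

text \<open>Four times the constant of \<open>caccioppoli_smooth\<close>: the passage to weak subsolutions doubles both
  sides.\<close>

definition caccioppoli_const :: "'n::finite itself \<Rightarrow> real \<Rightarrow> real" where
  "caccioppoli_const _ L = 4 * ((real CARD('n) + 1) * L powr (1 - (2 - real CARD('n)) / 2))"

text \<open>The inequality for a smooth approximation \<open>f\<close> of \<open>u\<close> is transferred by \<open>a\<^sup>2 \<le> 2 b\<^sup>2 + 2 (a - b)\<^sup>2\<close>
  on both sides. This costs a factor \<open>4\<close> and an error that is a constant, depending on \<open>\<kappa>\<close> and \<open>w\<close>,
  times the mean square distance, which is as small as desired.\<close>

lemma caccioppoli_weak_regularized:
  fixes a :: "'n::finite \<Rightarrow> real"
  assumes N: "CARD('n) \<ge> 2" and a: "\<And>i. 1 \<le> a i" "\<And>i. a i \<le> L" and \<kappa>: "\<kappa> > 0"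
    and W: "centered_subsolution a R u G"
    and w: "continuous_on UNIV w" "\<And>s. 0 \<le> w s" "\<And>s. w s \<le> 1" "\<And>s. w s \<noteq> 0 \<Longrightarrow> \<alpha> \<le> s \<and> s \<le> \<beta>"
    and ab: "0 < \<alpha>" "\<alpha> < \<beta>" "\<beta> < R"
  defines "\<psi> \<equiv> (\<lambda>s. integral {0..\<beta>} w - integral {0..s} w)"
  shows "(\<integral>\<^sup>+x. ennreal (energy a (G x) * kernel a \<kappa> x * \<psi> (norm x)) \<partial>lborel) \<le>
    (\<integral>\<^sup>+x. ennreal (caccioppoli_const TYPE('n) L * (w (norm x) / norm x ^ (CARD('n) - 1) * ((u x)\<^sup>2 + (norm x)\<^sup>2 * (norm (G x))\<^sup>2))) \<partial>lborel)"
    (is "?A \<le> ?B")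
proof (rule ennreal_le_epsilon)
  fix e :: real assume e: "e > 0"
  let ?N = "real CARD('n)"
  have \<psi>: "\<And>s. s > 0 \<Longrightarrow> (\<psi> has_real_derivative - w s) (at s)" "\<And>s. 0 \<le> \<psi> s"
     "\<And>s. \<beta> < s \<Longrightarrow> \<psi> s = 0" "\<And>s. 0 \<le> s \<Longrightarrow> s < \<alpha> \<Longrightarrow> \<psi> s = \<psi> 0" "\<And>s. \<psi> s \<le> integral {0..\<beta>} w"
    unfolding \<psi>_def by (rule tail_integral_properties[OF w(1,2,4) ab(1,2)]; assumption)+
  define r where "r = (\<beta> + R) / 2"
  have r: "0 < r" "\<beta> < r" "r < R" using ab by (auto simp: r_def)
  have L1: "1 \<le> L" using a order_trans by blast
  define p where "p = (2 - ?N) / 2"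
  have p0: "p \<le> 0" using N by (simp add: p_def)
  define T where "T = integral {0..\<beta>} w"
  have T0: "T \<ge> 0" using \<psi>(2,5)[of 0] unfolding T_def by linarith
  define C where "C = (?N + 1) * L powr (1 - p)"
  have C0: "C \<ge> 0" by (simp add: C_def)
  \<comment> \<open>the mean square error enters twice below, with coefficients \<open>k1\<close> and \<open>2 * k2\<close>; \<open>M\<close> bounds their sum\<close>
  define M where "M = 2 * L * \<kappa> powr p * T + 4 * C * (1 / \<alpha> ^ (CARD('n) - 1)) * (1 + r\<^sup>2) + 1"
  have M: "M > 0" unfolding M_def using L1 T0 C0 ab by (intro add_nonneg_pos add_nonneg_nonneg mult_nonneg_nonneg) auto
  have eM: "e / M > 0" using e M by simp
  obtain f g d where fgm[measurable]: "f \<in> borel_measurable borel" "g \<in> borel_measurable borel"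
    and fg: "\<And>x. x \<in> ball 0 r \<Longrightarrow> (f has_derivative (\<lambda>v. g x \<bullet> v)) (at x)"
    "\<And>i x. x \<in> ball 0 r \<Longrightarrow> ((\<lambda>t. g (x + t *\<^sub>R axis i 1) $ i) has_real_derivative d i x) (at 0)"
    "continuous_on (ball 0 r) g" "\<And>i. continuous_on (ball 0 r) (d i)"
    "\<And>x. x \<in> ball 0 r \<Longrightarrow> 0 \<le> f x"
    "\<And>x. x \<in> ball 0 r \<Longrightarrow> 0 \<le> (\<Sum>i\<in>UNIV. a i * d i x)"
    and err: "(\<integral>\<^sup>+x. indicator (ball 0 r) x * ennreal ((f x - u x)\<^sup>2 + (norm (g x - G x))\<^sup>2) \<partial>lborel) < ennreal (e / M)"
    by (rule mollified_subsolution[OF W r(1,3) eM]) (rule that)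
  have [measurable]: "u \<in> borel_measurable borel" "G \<in> borel_measurable borel" using W by (auto simp: centered_subsolution_def)
  have [measurable]: "w \<in> borel_measurable borel" using w(1) by (rule borel_measurable_continuous_onI)
  have \<psi>c: "continuous_on {0<..} \<psi>"
    using \<psi>(1) by (meson DERIV_isCont continuous_at_imp_continuous_on greaterThan_iff)
  have cacc: "(\<integral>\<^sup>+x. ennreal (energy a (g x) * kernel a \<kappa> x * \<psi> (norm x)) \<partial>lborel) \<le>
    (\<integral>\<^sup>+x. ennreal (C * (w (norm x) / norm x ^ (CARD('n) - 1) * ((f x)\<^sup>2 + (norm x)\<^sup>2 * (norm (g x))\<^sup>2))) \<partial>lborel)"
    unfolding C_def p_def energy_def kernel_def
    by (rule caccioppoli_smooth[where r=r and \<alpha>=\<alpha> and \<beta>=\<beta> and d=d])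
       (fact N a \<kappa> w ab r \<psi> fg)+
  define D where "D x = (f x - u x)\<^sup>2 + (norm (g x - G x))\<^sup>2" for x
  have kernel_bounds: "kernel a \<kappa> x \<le> \<kappa> powr p" "0 \<le> kernel a \<kappa> x" for x
  proof -
    have "0 \<le> a i" for i using a(1)[of i] by linarith
    hence "0 \<le> (\<Sum>i\<in>UNIV. (x $ i)\<^sup>2 / a i)" by (intro sum_nonneg) auto
    thus "kernel a \<kappa> x \<le> \<kappa> powr p" unfolding kernel_def p_def[symmetric] using p0 \<kappa> by (intro powr_mono2') auto
  qed (simp add: kernel_def)
  have S1: "energy a (G x) * kernel a \<kappa> x * \<psi> (norm x) \<le> 2 * (energy a (g x) * kernel a \<kappa> x * \<psi> (norm x))
        + 2 * L * \<kappa> powr p * T * (indicator (ball 0 r) x * D x)" for x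
  proof (cases "norm x > \<beta>")
    case True
    have "0 \<le> 2 * L * \<kappa> powr p * T * (indicator (ball 0 r) x * D x)"
      using L1 T0 by (intro mult_nonneg_nonneg) (auto simp: D_def)
    thus ?thesis using \<psi>(3)[OF True] by simp
  next
    case False
    hence x: "x \<in> ball 0 r" using r by auto
    have "energy a (G x) * (kernel a \<kappa> x * \<psi> (norm x)) \<le> (2 * energy a (g x) + 2 * energy a (g x - G x)) * (kernel a \<kappa> x * \<psi> (norm x))"
      by (intro mult_right_mono energy_triangle a mult_nonneg_nonneg kernel_bounds \<psi>)
    also have "\<dots> = 2 * (energy a (g x) * kernel a \<kappa> x * \<psi> (norm x)) + 2 * (energy a (g x - G x) * (kernel a \<kappa> x * \<psi> (norm x)))"
      by (simp add: algebra_simps)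
    also have "energy a (g x - G x) * (kernel a \<kappa> x * \<psi> (norm x)) \<le> (L * D x) * (\<kappa> powr p * T)"
    proof (intro mult_mono mult_nonneg_nonneg)
      have "energy a (g x - G x) \<le> L * (norm (g x - G x))\<^sup>2" using energy_bounds(2)[OF a] .
      also have "\<dots> \<le> L * D x" using L1 by (intro mult_left_mono) (auto simp: D_def)
      finally show "energy a (g x - G x) \<le> L * D x" .
      show "\<psi> (norm x) \<le> T" unfolding T_def by (rule \<psi>(5))
    qed (use kernel_bounds \<psi> T0 L1 in \<open>auto simp: D_def\<close>)
    finally show ?thesis using x by (simp add: mult_ac)
  qed
  have S2: "C * (w (norm x) / norm x ^ (CARD('n) - 1) * ((f x)\<^sup>2 + (norm x)\<^sup>2 * (norm (g x))\<^sup>2))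
     \<le> 2 * (C * (w (norm x) / norm x ^ (CARD('n) - 1) * ((u x)\<^sup>2 + (norm x)\<^sup>2 * (norm (G x))\<^sup>2)))
      + 2 * C * (1 / \<alpha> ^ (CARD('n) - 1)) * (1 + r\<^sup>2) * (indicator (ball 0 r) x * D x)" for x
  proof (cases "w (norm x) = 0")
    case True
    have "0 \<le> 2 * C * (1 / \<alpha> ^ (CARD('n) - 1)) * (1 + r\<^sup>2) * (indicator (ball 0 r) x * D x)"
      using C0 ab by (intro mult_nonneg_nonneg) (auto simp: D_def)
    thus ?thesis using True by simp
  next
    case False
    hence n: "\<alpha> \<le> norm x" "norm x \<le> \<beta>" using w(4) by auto
    have x: "x \<in> ball 0 r" using n r by auto
    let ?\<omega> = "w (norm x) / norm x ^ (CARD('n) - 1)"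
    have \<omega>0: "0 \<le> ?\<omega>" using w(2) by simp
    have \<omega>b: "?\<omega> \<le> 1 / \<alpha> ^ (CARD('n) - 1)"
      using w(3) n ab by (intro frac_le power_mono) auto
    have f2: "(f x)\<^sup>2 \<le> 2 * (u x)\<^sup>2 + 2 * (f x - u x)\<^sup>2"
      using zero_le_power2[of "2 * u x - f x"] by (simp add: power2_eq_square algebra_simps)
    have "norm (g x) \<le> norm (G x) + norm (g x - G x)" by (rule norm_triangle_sub)
    hence "(norm (g x))\<^sup>2 \<le> (norm (G x) + norm (g x - G x))\<^sup>2" by (intro power_mono) auto
    also have "\<dots> \<le> 2 * (norm (G x))\<^sup>2 + 2 * (norm (g x - G x))\<^sup>2"
      using zero_le_power2[of "norm (G x) - norm (g x - G x)"] by (simp add: power2_eq_square algebra_simps)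
    finally have g2: "(norm (g x))\<^sup>2 \<le> 2 * (norm (G x))\<^sup>2 + 2 * (norm (g x - G x))\<^sup>2" .
    have "(f x)\<^sup>2 + (norm x)\<^sup>2 * (norm (g x))\<^sup>2 \<le> (2 * (u x)\<^sup>2 + 2 * (f x - u x)\<^sup>2) + (norm x)\<^sup>2 * (2 * (norm (G x))\<^sup>2 + 2 * (norm (g x - G x))\<^sup>2)"
      by (intro add_mono f2 mult_left_mono g2) auto
    also have "\<dots> = 2 * ((u x)\<^sup>2 + (norm x)\<^sup>2 * (norm (G x))\<^sup>2) + 2 * ((f x - u x)\<^sup>2 + (norm x)\<^sup>2 * (norm (g x - G x))\<^sup>2)"
      by (simp add: algebra_simps)
    also have "(f x - u x)\<^sup>2 + (norm x)\<^sup>2 * (norm (g x - G x))\<^sup>2 \<le> (1 + r\<^sup>2) * D x"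
    proof -
      have "(norm x)\<^sup>2 \<le> r\<^sup>2" using x by (intro power_mono) auto
      hence "(norm x)\<^sup>2 * (norm (g x - G x))\<^sup>2 \<le> r\<^sup>2 * (norm (g x - G x))\<^sup>2" by (rule mult_right_mono) simp
      moreover have "0 \<le> r\<^sup>2 * (f x - u x)\<^sup>2" by simp
      moreover have "(1 + r\<^sup>2) * D x = (f x - u x)\<^sup>2 + r\<^sup>2 * (f x - u x)\<^sup>2 + (norm (g x - G x))\<^sup>2 + r\<^sup>2 * (norm (g x - G x))\<^sup>2"
        by (simp add: D_def algebra_simps)
      ultimately show ?thesis using zero_le_power2[of "norm (g x - G x)"] by linarith
    qed
    finally have b: "(f x)\<^sup>2 + (norm x)\<^sup>2 * (norm (g x))\<^sup>2 \<le> 2 * ((u x)\<^sup>2 + (norm x)\<^sup>2 * (norm (G x))\<^sup>2) + 2 * ((1 + r\<^sup>2) * D x)"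
      by simp
    have "C * (?\<omega> * ((f x)\<^sup>2 + (norm x)\<^sup>2 * (norm (g x))\<^sup>2)) \<le> C * (?\<omega> * (2 * ((u x)\<^sup>2 + (norm x)\<^sup>2 * (norm (G x))\<^sup>2) + 2 * ((1 + r\<^sup>2) * D x)))"
      by (intro mult_left_mono b \<omega>0 C0)
    also have "\<dots> = 2 * (C * (?\<omega> * ((u x)\<^sup>2 + (norm x)\<^sup>2 * (norm (G x))\<^sup>2))) + C * (?\<omega> * (2 * ((1 + r\<^sup>2) * D x)))"
      by (simp only: distrib_left mult_ac)
    also have "C * (?\<omega> * (2 * ((1 + r\<^sup>2) * D x))) \<le> C * ((1 / \<alpha> ^ (CARD('n) - 1)) * (2 * ((1 + r\<^sup>2) * D x)))"
      by (intro mult_left_mono mult_right_mono \<omega>b C0 mult_nonneg_nonneg) (auto simp: D_def)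
    finally show ?thesis using x by (simp add: mult_ac)
  qed
  have [measurable]: "D \<in> borel_measurable borel" unfolding D_def by measurable
  have meas1 [measurable]: "(\<lambda>x. ennreal (energy a (g x) * kernel a \<kappa> x * \<psi> (norm x))) \<in> borel_measurable lborel"
  proof -
    have "(\<lambda>x::real^'n. indicator (-{0}) x *\<^sub>R \<psi> (norm x)) \<in> borel_measurable borel"
      by (rule borel_measurable_continuous_on_indicator) (auto intro!: continuous_on_compose2[OF \<psi>c] continuous_intros)
    moreover have "(\<lambda>x::real^'n. \<psi> (norm x)) = (\<lambda>x. indicator (-{0}) x *\<^sub>R \<psi> (norm x) + \<psi> 0 * indicator {0} x)"
      by (auto simp: indicator_def fun_eq_iff)
    ultimately have "(\<lambda>x::real^'n. \<psi> (norm x)) \<in> borel_measurable borel" by simp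
    thus ?thesis by measurable
  qed
  define err where "err = (\<integral>\<^sup>+x. indicator (ball 0 r) x * ennreal (D x) \<partial>lborel)"
  define k1 where "k1 = 2 * L * \<kappa> powr p * T"
  define k2 where "k2 = 2 * C * (1 / \<alpha> ^ (CARD('n) - 1)) * (1 + r\<^sup>2)"
  have k: "k1 \<ge> 0" "k2 \<ge> 0" unfolding k1_def k2_def using L1 T0 C0 ab by (auto intro!: mult_nonneg_nonneg divide_nonneg_nonneg)
  have split: "(\<integral>\<^sup>+x. ennreal (A x) \<partial>lborel) \<le> 2 * (\<integral>\<^sup>+x. ennreal (B x) \<partial>lborel) + ennreal k * err"
    if "\<And>x. A x \<le> 2 * B x + k * (indicator (ball 0 r) x * D x)" "\<And>x. 0 \<le> B x" "k \<ge> 0" 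
      "(\<lambda>x. ennreal (B x)) \<in> borel_measurable lborel" for A B :: "real^'n \<Rightarrow> real" and k
  proof -
    note [measurable] = that(4)
    have "(\<integral>\<^sup>+x. ennreal (A x) \<partial>lborel) \<le> (\<integral>\<^sup>+x. 2 * ennreal (B x) + ennreal k * (indicator (ball 0 r) x * ennreal (D x)) \<partial>lborel)"
    proof (rule nn_integral_mono, goal_cases)
      case (1 x)
      have D: "0 \<le> D x" by (simp add: D_def)
      have "ennreal (A x) \<le> ennreal (2 * B x + k * (indicator (ball 0 r) x * D x))" by (rule ennreal_leI[OF that(1)])
      also have "\<dots> = 2 * ennreal (B x) + ennreal k * (indicator (ball 0 r) x * ennreal (D x))"
        using that(2)[of x] that(3) D by (cases "x \<in> ball 0 r") (auto simp: ennreal_plus ennreal_mult)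
      finally show ?case .
    qed
    also have "\<dots> = 2 * (\<integral>\<^sup>+x. ennreal (B x) \<partial>lborel) + ennreal k * err"
    proof -
      have [measurable]: "(\<lambda>x. indicator (ball 0 r) x * ennreal (D x)) \<in> borel_measurable lborel"
        by (intro borel_measurable_times_ennreal borel_measurable_indicator) auto
      show ?thesis unfolding err_def by (subst nn_integral_add) (auto simp: nn_integral_cmult)
    qed
    finally show ?thesis .
  qed
  have "?A \<le> 2 * (\<integral>\<^sup>+x. ennreal (energy a (g x) * kernel a \<kappa> x * \<psi> (norm x)) \<partial>lborel) + ennreal k1 * err"
    by (rule split[OF S1[folded k1_def] _ k(1) meas1]) (intro mult_nonneg_nonneg energy_nonneg a kernel_bounds \<psi>)
  also have "\<dots> \<le> 2 * (\<integral>\<^sup>+x. ennreal (C * (w (norm x) / norm x ^ (CARD('n) - 1) * ((f x)\<^sup>2 + (norm x)\<^sup>2 * (norm (g x))\<^sup>2))) \<partial>lborel) + ennreal k1 * err"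
    by (intro add_right_mono mult_left_mono cacc) auto
  also have "\<dots> \<le> 2 * (2 * (\<integral>\<^sup>+x. ennreal (C * (w (norm x) / norm x ^ (CARD('n) - 1) * ((u x)\<^sup>2 + (norm x)\<^sup>2 * (norm (G x))\<^sup>2))) \<partial>lborel) + ennreal k2 * err) + ennreal k1 * err"
    by (intro add_right_mono mult_left_mono split[OF S2[folded k2_def] _ k(2)]) (auto intro!: mult_nonneg_nonneg C0 w divide_nonneg_nonneg)
  also have "\<dots> = 4 * (\<integral>\<^sup>+x. ennreal (C * (w (norm x) / norm x ^ (CARD('n) - 1) * ((u x)\<^sup>2 + (norm x)\<^sup>2 * (norm (G x))\<^sup>2))) \<partial>lborel) + (2 * ennreal k2 + ennreal k1) * err"
    by (simp add: distrib_left distrib_right mult.assoc[symmetric] add.assoc)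
  also have "4 * (\<integral>\<^sup>+x. ennreal (C * (w (norm x) / norm x ^ (CARD('n) - 1) * ((u x)\<^sup>2 + (norm x)\<^sup>2 * (norm (G x))\<^sup>2))) \<partial>lborel) = ?B"
  proof -
    have eq: "4 * ennreal (C * X) = ennreal (caccioppoli_const TYPE('n) L * X)" if "0 \<le> X" for X
    proof -
      have "caccioppoli_const TYPE('n) L * X = 4 * (C * X)" by (simp add: caccioppoli_const_def C_def p_def)
      thus ?thesis using mult_nonneg_nonneg[OF C0 that] by (simp only: ennreal_mult ennreal_numeral)
    qed
    show ?thesis
      apply (subst nn_integral_cmult[symmetric])
      subgoal by measurable
      by (intro nn_integral_cong eq mult_nonneg_nonneg divide_nonneg_nonneg w add_nonneg_nonneg) auto
  qed
  also have "(2 * ennreal k2 + ennreal k1) * err \<le> ennreal M * ennreal (e / M)"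
  proof (rule mult_mono)
    have "2 * ennreal k2 + ennreal k1 = ennreal (2 * k2 + k1)" using k by (simp add: ennreal_plus ennreal_mult)
    also have "\<dots> \<le> ennreal M" by (rule ennreal_leI) (simp add: M_def k1_def k2_def)
    finally show "2 * ennreal k2 + ennreal k1 \<le> ennreal M" .
    show "err \<le> ennreal (e / M)" unfolding err_def D_def using err by (rule less_imp_le)
  qed auto
  also have "ennreal M * ennreal (e / M) = ennreal e" using M e by (simp add: ennreal_mult[symmetric])
  finally show "?A \<le> ?B + ennreal e" by (simp add: add_left_mono)
qed

text \<open>The limit \<open>\<kappa> \<rightarrow> 0\<close> by Fatou's lemma, with the left side rewritten as an average of energies in
  balls.\<close>

lemma caccioppoli_weak:
  fixes a :: "'n::finite \<Rightarrow> real"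
  assumes N: "CARD('n) \<ge> 2" and a: "\<And>i. 1 \<le> a i" "\<And>i. a i \<le> L"
    and W: "centered_subsolution a R u G"
    and w: "continuous_on UNIV w" "\<And>s. 0 \<le> w s" "\<And>s. w s \<le> 1" "\<And>s. w s \<noteq> 0 \<Longrightarrow> \<alpha> \<le> s \<and> s \<le> \<beta>"
    and ab: "0 < \<alpha>" "\<alpha> < \<beta>" "\<beta> < R"
  shows "(\<integral>\<^sup>+s. ennreal (w s) * energy_in_ball a G s \<partial>lborel) \<le>
    (\<integral>\<^sup>+x. ennreal (caccioppoli_const TYPE('n) L * (w (norm x) / norm x ^ (CARD('n) - 1) * ((u x)\<^sup>2 + (norm x)\<^sup>2 * (norm (G x))\<^sup>2))) \<partial>lborel)"
    (is "_ \<le> ?B")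
proof -
  define \<psi> where "\<psi> = (\<lambda>s. integral {0..\<beta>} w - integral {0..s} w)"
  have \<psi>0: "0 \<le> \<psi> s" for s
    unfolding \<psi>_def by (rule tail_integral_properties(2)[OF w(1,2,4) ab(1,2)])
  have \<psi>i: "(\<integral>\<^sup>+s. ennreal (w s) * indicator {t<..} s \<partial>lborel) = ennreal (\<psi> t)" if "0 \<le> t" for t
    unfolding \<psi>_def by (rule tail_integral_properties(6)[OF w(1,2,4) ab(1,2) that])
  have [measurable]: "u \<in> borel_measurable borel" "G \<in> borel_measurable borel" using W by (auto simp: centered_subsolution_def)
  have [measurable]: "w \<in> borel_measurable borel" using w(1) by (rule borel_measurable_continuous_onI)
  have [measurable]: "(\<lambda>x::'b::euclidean_space. ennreal (\<psi> (norm x))) \<in> borel_measurable lborel" 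
  proof -
    have "(\<lambda>x::'b. (\<integral>\<^sup>+s. (if norm x < s then ennreal (w s) else 0) \<partial>lborel)) \<in> borel_measurable lborel"
      by measurable
    also have "(\<lambda>x::'b. (\<integral>\<^sup>+s. (if norm x < s then ennreal (w s) else 0) \<partial>lborel)) = (\<lambda>x. ennreal (\<psi> (norm x)))"
      by (subst \<psi>i[symmetric]) (auto intro!: ext nn_integral_cong simp: indicator_def)
    finally show ?thesis .
  qed
  have pos: "0 < (\<Sum>i\<in>UNIV. (x $ i)\<^sup>2 / a i)" if "x \<noteq> 0" for x :: "real^'n"
    by (rule weighted_square_sum_pos[OF that a(1)])
  have e0: "0 \<le> energy a (G x)" for x by (rule energy_nonneg[OF a(1)])
  have f0: "0 \<le> kernel a \<kappa> x" for \<kappa> x by (simp add: kernel_def)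
  have "(\<integral>\<^sup>+s. ennreal (w s) * energy_in_ball a G s \<partial>lborel) = 
     (\<integral>\<^sup>+s. (\<integral>\<^sup>+x. (if norm x < s then ennreal (w s) * ennreal (energy a (G x) * kernel a 0 x) else 0) \<partial>lborel) \<partial>lborel)"
  proof (rule nn_integral_cong, goal_cases)
    case (1 s)
    have "energy_in_ball a G s = (\<integral>\<^sup>+x. (if norm x < s then ennreal (energy a (G x) * kernel a 0 x) else 0) \<partial>lborel)"
      unfolding energy_in_ball_def by (intro nn_integral_cong) (auto simp: indicator_def)
    thus ?case by (auto simp: nn_integral_cmult[symmetric] intro!: nn_integral_cong)
  qed
  also have "\<dots> = (\<integral>\<^sup>+x. (\<integral>\<^sup>+s. (if norm x < s then ennreal (w s) * ennreal (energy a (G x) * kernel a 0 x) else 0) \<partial>lborel) \<partial>lborel)"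
    by (rule lborel_pair.Fubini') measurable
  also have "\<dots> = (\<integral>\<^sup>+x. ennreal (energy a (G x) * kernel a 0 x * \<psi> (norm x)) \<partial>lborel)"
  proof (rule nn_integral_cong, goal_cases)
    case (1 x)
    have "(\<integral>\<^sup>+s. (if norm x < s then ennreal (w s) * ennreal (energy a (G x) * kernel a 0 x) else 0) \<partial>lborel)
       = (\<integral>\<^sup>+s. (ennreal (w s) * indicator {norm x<..} s) * ennreal (energy a (G x) * kernel a 0 x) \<partial>lborel)"
      by (intro nn_integral_cong) (auto simp: indicator_def)
    also have "\<dots> = ennreal (\<psi> (norm x)) * ennreal (energy a (G x) * kernel a 0 x)"
      by (subst nn_integral_multc) (auto simp: \<psi>i)
    finally show ?case using \<psi>0[of "norm x"] e0[of x] f0[of 0 x] by (simp add: ennreal_mult mult_ac)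
  qed
  also have "\<dots> = (\<integral>\<^sup>+x. liminf (\<lambda>n. ennreal (energy a (G x) * kernel a (1 / Suc n) x * \<psi> (norm x))) \<partial>lborel)"
  proof (rule nn_integral_cong_AE, use AE_lborel_singleton[of "0::real^'n"] in eventually_elim)
    case (elim x)
    have "(\<lambda>n. 1 / Suc n + (\<Sum>i\<in>UNIV. (x $ i)\<^sup>2 / a i)) \<longlonglongrightarrow> 0 + (\<Sum>i\<in>UNIV. (x $ i)\<^sup>2 / a i)"
      using LIMSEQ_inverse_real_of_nat by (intro tendsto_intros) (simp add: inverse_eq_divide)
    hence "(\<lambda>n. kernel a (1 / Suc n) x) \<longlonglongrightarrow> kernel a 0 x"
      unfolding kernel_def using pos[OF elim] by (intro tendsto_powr tendsto_const) auto
    hence "(\<lambda>n. ennreal (energy a (G x) * kernel a (1 / Suc n) x * \<psi> (norm x))) \<longlonglongrightarrow> ennreal (energy a (G x) * kernel a 0 x * \<psi> (norm x))"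
      by (intro tendsto_intros)
    thus ?case by (intro lim_imp_Liminf[symmetric]) auto
  qed
  also have "\<dots> \<le> liminf (\<lambda>n. \<integral>\<^sup>+x. ennreal (energy a (G x) * kernel a (1 / Suc n) x * \<psi> (norm x)) \<partial>lborel)"
  proof (rule nn_integral_liminf)
    fix n
    have "(\<lambda>x. ennreal (energy a (G x)) * ennreal (kernel a (1 / Suc n) x) * ennreal (\<psi> (norm x))) \<in> borel_measurable lborel"
      by measurable
    thus "(\<lambda>x. ennreal (energy a (G x) * kernel a (1 / Suc n) x * \<psi> (norm x))) \<in> borel_measurable lborel"
      using e0 f0 \<psi>0 by (simp add: ennreal_mult)
  qed
  also have "\<dots> \<le> liminf (\<lambda>n::nat. ?B)"
  proof (rule Liminf_mono, intro always_eventually allI)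
    fix n :: nat
    show "(\<integral>\<^sup>+x. ennreal (energy a (G x) * kernel a (1 / Suc n) x * \<psi> (norm x)) \<partial>lborel) \<le> ?B"
      unfolding \<psi>_def by (rule caccioppoli_weak_regularized[OF N a _ W w ab]) simp
  qed
  also have "\<dots> = ?B" by (simp add: Liminf_const)
  finally show ?thesis .
qed

text \<open>Polar coordinates with the factor \<open>s ^ (DIM - 1)\<close> moved to the other side, in the form in which
  the right side of the Caccioppoli inequality uses them.\<close>

lemma polar_radial:
  fixes h :: "'a::euclidean_space \<Rightarrow> ennreal" and k :: "real \<Rightarrow> ennreal"
  assumes [measurable]: "h \<in> borel_measurable borel" "k \<in> borel_measurable borel" and ab: "0 < \<alpha>" "\<alpha> < \<beta>"
  shows "(\<integral>\<^sup>+s. indicator {0<..} s * (k s * sphere_integral \<alpha> \<beta> h s) \<partial>lborel)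
       = ennreal (polar_const TYPE('a) \<alpha> \<beta>) * (\<integral>\<^sup>+x. k (norm x) * ennreal (1 / norm x ^ (DIM('a) - 1)) * h x \<partial>lborel)"
proof -
  have "ennreal (polar_const TYPE('a) \<alpha> \<beta>) * (\<integral>\<^sup>+x. k (norm x) * ennreal (1 / norm x ^ (DIM('a) - 1)) * h x \<partial>lborel)
     = (\<integral>\<^sup>+s. indicator {0<..} s * ennreal (s ^ (DIM('a) - 1)) * sphere_integral \<alpha> \<beta> (\<lambda>x. k (norm x) * ennreal (1 / norm x ^ (DIM('a) - 1)) * h x) s \<partial>lborel)"
    by (rule polar_nn_integral[symmetric, OF _ ab]) measurable
  also have "\<dots> = (\<integral>\<^sup>+s. indicator {0<..} s * (k s * sphere_integral \<alpha> \<beta> h s) \<partial>lborel)"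
  proof (rule nn_integral_cong, goal_cases)
    case (1 s)
    show ?case
    proof (cases "s > 0")
      case True
      have "sphere_integral \<alpha> \<beta> (\<lambda>x. k (norm x) * ennreal (1 / norm x ^ (DIM('a) - 1)) * h x) s
         = (\<integral>\<^sup>+x. (k s * ennreal (1 / s ^ (DIM('a) - 1))) * (indicator (shell \<alpha> \<beta>) x * h ((s / norm x) *\<^sub>R x)) \<partial>lborel)"
        unfolding sphere_integral_def
      proof (rule nn_integral_cong, goal_cases)
        case (1 x)
        show ?case
        proof (cases "x \<in> shell \<alpha> \<beta>")
          case True
          hence "norm x > 0" using ab by (auto simp: shell_def)
          hence "norm ((s / norm x) *\<^sub>R x) = s" using \<open>s > 0\<close> by simp
          thus ?thesis using True by simp
        qed simp
      qed
      also have "\<dots> = (k s * ennreal (1 / s ^ (DIM('a) - 1))) * sphere_integral \<alpha> \<beta> h s"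
        unfolding sphere_integral_def by (rule nn_integral_cmult) measurable
      finally have "ennreal (s ^ (DIM('a) - 1)) * sphere_integral \<alpha> \<beta> (\<lambda>x. k (norm x) * ennreal (1 / norm x ^ (DIM('a) - 1)) * h x) s
        = (ennreal (s ^ (DIM('a) - 1)) * ennreal (1 / s ^ (DIM('a) - 1))) * (k s * sphere_integral \<alpha> \<beta> h s)"
        by (simp only: mult_ac)
      also have "ennreal (s ^ (DIM('a) - 1)) * ennreal (1 / s ^ (DIM('a) - 1)) = 1"
        using True by (subst ennreal_mult[symmetric]) auto
      finally show ?thesis using True by simp
    qed simp
  qed
  finally show ?thesis by simp
qed

text \<open>The two quotients come from the shells of the two integrals in \<open>energy_le_slice\<close>; their sum serves
  for both.\<close>

definition slice_const :: "'n::finite itself \<Rightarrow> real \<Rightarrow> real" where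
  "slice_const _ L = caccioppoli_const TYPE('n) L / polar_const TYPE(real^'n) (1/2) 1 + caccioppoli_const TYPE('n) L / polar_const TYPE(real^'n) (1/8) 1"

lemma caccioppoli_const_pos: "L > 0 \<Longrightarrow> caccioppoli_const TYPE('n::finite) L > 0"
  unfolding caccioppoli_const_def by (intro mult_pos_pos add_nonneg_pos) auto

text \<open>In polar coordinates the right side of \<open>caccioppoli_weak\<close> is a weighted integral over the radius
  as well, with a locally integrable density; so the inequality holds for almost every radius.\<close>

lemma energy_le_slice:
  fixes a :: "'n::finite \<Rightarrow> real"
  assumes N: "CARD('n) \<ge> 2" and a: "\<And>i. 1 \<le> a i" "\<And>i. a i \<le> L"
    and W: "centered_subsolution a R u G"
  shows "AE s in lborel. 0 < s \<and> s < R \<longrightarrow> energy_in_ball a G s \<le>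
     ennreal (slice_const TYPE('n) L) * (sphere_integral (1/2) 1 (\<lambda>x. ennreal ((u x)\<^sup>2)) s + ennreal (s\<^sup>2) * sphere_integral (1/8) 1 (\<lambda>x. ennreal ((norm (G x))\<^sup>2)) s)"
proof -
  let ?SU = "sphere_integral (1/2) 1 (\<lambda>x. ennreal ((u x)\<^sup>2))" and ?SG = "sphere_integral (1/8) 1 (\<lambda>x. ennreal ((norm (G x))\<^sup>2))"
  have [measurable]: "u \<in> borel_measurable borel" "G \<in> borel_measurable borel"
    and fin: "\<And>\<rho>. \<rho> < R \<Longrightarrow> (\<integral>\<^sup>+x. indicator (cball 0 \<rho>) x * ennreal ((u x)\<^sup>2 + (norm (G x))\<^sup>2) \<partial>lborel) < \<infinity>"
    using W by (auto simp: centered_subsolution_def)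
  define C where "C = caccioppoli_const TYPE('n) L"
  define c1 where "c1 = polar_const TYPE(real^'n) (1/2) 1"
  define c2 where "c2 = polar_const TYPE(real^'n) (1/8) 1"
  have L1: "1 \<le> L" using a order_trans by blast
  have C: "C > 0" unfolding C_def using L1 by (intro caccioppoli_const_pos) simp
  have c: "c1 > 0" "c2 > 0" unfolding c1_def c2_def by (auto intro!: polar_const_ennreal(2))
  define Q where "Q s = indicator {0<..} s * (ennreal (C / c1) * ?SU s + ennreal (C / c2) * (ennreal (s\<^sup>2) * ?SG s))" for s
  have [measurable]: "Q \<in> borel_measurable borel" unfolding Q_def by measurable
  have [measurable]: "energy_in_ball a G \<in> borel_measurable borel"
  proof -
    have "(\<lambda>s. \<integral>\<^sup>+x. (if norm x < s then ennreal (energy a (G x) * kernel a 0 x) else 0) \<partial>lborel) \<in> borel_measurable borel"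
      by measurable
    also have "(\<lambda>s. \<integral>\<^sup>+x. (if norm x < s then ennreal (energy a (G x) * kernel a 0 x) else 0) \<partial>lborel) = energy_in_ball a G"
      unfolding energy_in_ball_def by (intro ext nn_integral_cong) (auto simp: indicator_def)
    finally show ?thesis .
  qed
  have intQ: "(\<integral>\<^sup>+s. k s * Q s \<partial>lborel) = ennreal C * (\<integral>\<^sup>+x. k (norm x) * ennreal (1 / norm x ^ (CARD('n) - 1)) * ennreal ((u x)\<^sup>2 + (norm x)\<^sup>2 * (norm (G x))\<^sup>2) \<partial>lborel)"
    if [measurable]: "k \<in> borel_measurable borel" for k
  proof -
    let ?U = "\<integral>\<^sup>+x. k (norm x) * ennreal (1 / norm x ^ (CARD('n) - 1)) * ennreal ((u x)\<^sup>2) \<partial>lborel"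
    let ?V = "\<integral>\<^sup>+x. (k (norm x) * ennreal ((norm x)\<^sup>2)) * ennreal (1 / norm x ^ (CARD('n) - 1)) * ennreal ((norm (G x))\<^sup>2) \<partial>lborel"
    have "(\<integral>\<^sup>+s. k s * Q s \<partial>lborel) = (\<integral>\<^sup>+s. ennreal (C / c1) * (indicator {0<..} s * (k s * ?SU s)) + 
         ennreal (C / c2) * (indicator {0<..} s * ((k s * ennreal (s\<^sup>2)) * ?SG s)) \<partial>lborel)"
      unfolding Q_def by (intro nn_integral_cong) (simp only: distrib_left mult_ac)
    also have "\<dots> = ennreal (C / c1) * (\<integral>\<^sup>+s. indicator {0<..} s * (k s * ?SU s) \<partial>lborel) + 
         ennreal (C / c2) * (\<integral>\<^sup>+s. indicator {0<..} s * ((k s * ennreal (s\<^sup>2)) * ?SG s) \<partial>lborel)"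
      by (subst nn_integral_add) (auto simp: nn_integral_cmult)
    also have "\<dots> = ennreal (C / c1) * (ennreal c1 * ?U) + ennreal (C / c2) * (ennreal c2 * ?V)"
      unfolding c1_def c2_def
      by (subst (1 2) polar_radial) auto
    also have "\<dots> = ennreal C * ?U + ennreal C * ?V"
      using c C by (simp add: mult.assoc[symmetric] ennreal_mult[symmetric])
    also have "\<dots> = ennreal C * (?U + ?V)" by (simp add: distrib_left)
    also have "?U + ?V = (\<integral>\<^sup>+x. k (norm x) * ennreal (1 / norm x ^ (CARD('n) - 1)) * ennreal ((u x)\<^sup>2 + (norm x)\<^sup>2 * (norm (G x))\<^sup>2) \<partial>lborel)"
      by (subst nn_integral_add[symmetric]) (auto intro!: nn_integral_cong simp: ennreal_plus ennreal_mult distrib_left mult_ac)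
    finally show ?thesis .
  qed
  have "AE s in lborel. 0 < s \<and> s < R \<longrightarrow> energy_in_ball a G s \<le> Q s"
  proof (rule AE_le_from_continuous_weights)
    fix w :: "real \<Rightarrow> real" and \<alpha> \<beta>
    assume w: "continuous_on UNIV w" "\<And>s. 0 \<le> w s" "\<And>s. w s \<le> 1" and ab: "0 < \<alpha>" "\<alpha> < \<beta>" "\<beta> < R"
      and ws: "\<And>s. w s \<noteq> 0 \<Longrightarrow> \<alpha> \<le> s \<and> s \<le> \<beta>"
    have [measurable]: "w \<in> borel_measurable borel" using w(1) by (rule borel_measurable_continuous_onI)
    have "(\<integral>\<^sup>+s. ennreal (w s) * energy_in_ball a G s \<partial>lborel) \<le>
      (\<integral>\<^sup>+x. ennreal (C * (w (norm x) / norm x ^ (CARD('n) - 1) * ((u x)\<^sup>2 + (norm x)\<^sup>2 * (norm (G x))\<^sup>2))) \<partial>lborel)"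
      unfolding C_def by (rule caccioppoli_weak[OF N a W w ws ab])
    also have "\<dots> = (\<integral>\<^sup>+x. ennreal C * (ennreal (w (norm x)) * ennreal (1 / norm x ^ (CARD('n) - 1)) * ennreal ((u x)\<^sup>2 + (norm x)\<^sup>2 * (norm (G x))\<^sup>2)) \<partial>lborel)"
    proof (rule nn_integral_cong, goal_cases)
      case (1 x)
      have em: "ennreal (C * (b * c * d)) = ennreal C * (ennreal b * ennreal c * ennreal d)"
        if "0 \<le> b" "0 \<le> c" "0 \<le> d" for b c d
        using C that by (simp add: ennreal_mult)
      have "C * (w (norm x) / norm x ^ (CARD('n) - 1) * ((u x)\<^sup>2 + (norm x)\<^sup>2 * (norm (G x))\<^sup>2))
         = C * (w (norm x) * (1 / norm x ^ (CARD('n) - 1)) * ((u x)\<^sup>2 + (norm x)\<^sup>2 * (norm (G x))\<^sup>2))" by simp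
      thus ?case by (simp only: em w(2) zero_le_divide_1_iff zero_le_power norm_ge_zero add_nonneg_nonneg mult_nonneg_nonneg zero_le_power2)
    qed
    also have "\<dots> = (\<integral>\<^sup>+s. ennreal (w s) * Q s \<partial>lborel)"
      by (subst intQ, measurable, subst nn_integral_cmult, auto)
    finally show "(\<integral>\<^sup>+s. ennreal (w s) * energy_in_ball a G s \<partial>lborel) \<le> (\<integral>\<^sup>+s. ennreal (w s) * Q s \<partial>lborel)" .
  next
    fix \<alpha> \<beta> :: real assume ab: "0 < \<alpha>" "\<beta> < R"
    define K where "K = (1 / \<alpha> ^ (CARD('n) - 1)) * (1 + \<beta>\<^sup>2)"
    have "(\<integral>\<^sup>+s. indicator {\<alpha>..\<beta>} s * Q s \<partial>lborel) = ennreal C * (\<integral>\<^sup>+x. indicator {\<alpha>..\<beta>} (norm x) * ennreal (1 / norm x ^ (CARD('n) - 1)) * ennreal ((u x)\<^sup>2 + (norm x)\<^sup>2 * (norm (G x))\<^sup>2) \<partial>lborel)"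
      by (rule intQ) measurable
    also have "\<dots> \<le> ennreal C * (\<integral>\<^sup>+x. ennreal K * (indicator (cball 0 \<beta>) x * ennreal ((u x)\<^sup>2 + (norm (G x))\<^sup>2)) \<partial>lborel)"
    proof (intro mult_left_mono nn_integral_mono)
      fix x :: "real^'n"
      show "indicator {\<alpha>..\<beta>} (norm x) * ennreal (1 / norm x ^ (CARD('n) - 1)) * ennreal ((u x)\<^sup>2 + (norm x)\<^sup>2 * (norm (G x))\<^sup>2)
        \<le> ennreal K * (indicator (cball 0 \<beta>) x * ennreal ((u x)\<^sup>2 + (norm (G x))\<^sup>2))"
      proof (cases "norm x \<in> {\<alpha>..\<beta>}")
        case True
        have 1: "1 / norm x ^ (CARD('n) - 1) \<le> 1 / \<alpha> ^ (CARD('n) - 1)"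
          using True ab by (intro frac_le power_mono) auto
        have "(norm x)\<^sup>2 * (norm (G x))\<^sup>2 \<le> \<beta>\<^sup>2 * (norm (G x))\<^sup>2" using True by (intro mult_right_mono power_mono) auto
        moreover have "0 \<le> \<beta>\<^sup>2 * (u x)\<^sup>2" by simp
        moreover have "(1 + \<beta>\<^sup>2) * ((u x)\<^sup>2 + (norm (G x))\<^sup>2) = (u x)\<^sup>2 + \<beta>\<^sup>2 * (u x)\<^sup>2 + (norm (G x))\<^sup>2 + \<beta>\<^sup>2 * (norm (G x))\<^sup>2"
          by (simp add: algebra_simps)
        ultimately have 2: "(u x)\<^sup>2 + (norm x)\<^sup>2 * (norm (G x))\<^sup>2 \<le> (1 + \<beta>\<^sup>2) * ((u x)\<^sup>2 + (norm (G x))\<^sup>2)"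
          using zero_le_power2[of "norm (G x)"] by linarith
        have "(1 / norm x ^ (CARD('n) - 1)) * ((u x)\<^sup>2 + (norm x)\<^sup>2 * (norm (G x))\<^sup>2) \<le> (1 / \<alpha> ^ (CARD('n) - 1)) * ((1 + \<beta>\<^sup>2) * ((u x)\<^sup>2 + (norm (G x))\<^sup>2))"
          using 1 2 ab by (intro mult_mono) auto
        hence "ennreal ((1 / norm x ^ (CARD('n) - 1)) * ((u x)\<^sup>2 + (norm x)\<^sup>2 * (norm (G x))\<^sup>2)) \<le> ennreal (K * ((u x)\<^sup>2 + (norm (G x))\<^sup>2))"
          by (intro ennreal_leI) (simp add: K_def)
        thus ?thesis using True ab by (subst (asm) (1 2) ennreal_mult) (auto simp: K_def)
      qed simp
    qed auto
    also have "\<dots> = ennreal C * (ennreal K * (\<integral>\<^sup>+x. (indicator (cball 0 \<beta>) x * ennreal ((u x)\<^sup>2 + (norm (G x))\<^sup>2)) \<partial>lborel))"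
    proof -
      have [measurable]: "(\<lambda>x. indicator (cball 0 \<beta>) x * ennreal ((u x)\<^sup>2 + (norm (G x))\<^sup>2)) \<in> borel_measurable lborel"
        by (intro borel_measurable_times_ennreal borel_measurable_indicator) auto
      show ?thesis
        apply (subst nn_integral_cmult)
        subgoal by measurable
        by (rule refl)
    qed
    also have "\<dots> < \<infinity>" using fin[OF ab(2)] by (auto simp: ennreal_mult_less_top)
    finally show "(\<integral>\<^sup>+s. indicator {\<alpha>..\<beta>} s * Q s \<partial>lborel) < \<infinity>" .
  qed auto
  thus ?thesis
  proof eventually_elim
    case (elim s)
    show ?case
    proof
      assume s: "0 < s \<and> s < R"
      have "energy_in_ball a G s \<le> Q s" using elim s by blast
      also have "\<dots> \<le> ennreal (C / c1 + C / c2) * ?SU s + ennreal (C / c1 + C / c2) * (ennreal (s\<^sup>2) * ?SG s)"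
        unfolding Q_def using s c C by (simp, intro add_mono mult_right_mono ennreal_leI) auto
      also have "\<dots> = ennreal (slice_const TYPE('n) L) * (?SU s + ennreal (s\<^sup>2) * ?SG s)"
        by (simp add: slice_const_def C_def c1_def c2_def distrib_left)
      finally show "energy_in_ball a G s \<le> ennreal (slice_const TYPE('n) L) * (?SU s + ennreal (s\<^sup>2) * ?SG s)" .
    qed
  qed
qed

section \<open>The Poincare inequality for weak subsolutions\<close>

lemma sphere_integral_mono: "(\<And>x. h x \<le> h' x) \<Longrightarrow> sphere_integral \<alpha> \<beta> h s \<le> sphere_integral \<alpha> \<beta> h' s"
  unfolding sphere_integral_def by (intro nn_integral_mono mult_left_mono) auto

lemma sphere_integral_cong_sphere:
  assumes "0 < \<alpha>" "0 < s" "\<And>x. norm x = s \<Longrightarrow> h x = h' x"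
  shows "sphere_integral \<alpha> \<beta> h s = sphere_integral \<alpha> \<beta> h' s"
  unfolding sphere_integral_def
proof (rule nn_integral_cong, goal_cases)
  case (1 x)
  show ?case
  proof (cases "x \<in> shell \<alpha> \<beta>")
    case True
    hence "norm x > 0" using assms by (auto simp: shell_def)
    hence "norm ((s / norm x) *\<^sub>R x) = s" using assms by simp
    thus ?thesis using assms(3) by simp
  qed simp
qed

lemma sphere_integral_add:
  assumes [measurable]: "h \<in> borel_measurable borel" "h' \<in> borel_measurable borel"
  shows "sphere_integral \<alpha> \<beta> (\<lambda>x. h x + h' x) s = sphere_integral \<alpha> \<beta> h s + sphere_integral \<alpha> \<beta> h' s"
  unfolding sphere_integral_def distrib_left by (rule nn_integral_add) measurable

lemma sphere_integral_cmult:
  assumes [measurable]: "h \<in> borel_measurable borel"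
  shows "sphere_integral \<alpha> \<beta> (\<lambda>x. c * h x) s = c * sphere_integral \<alpha> \<beta> h s"
  unfolding sphere_integral_def by (subst nn_integral_cmult[symmetric]) (auto simp: mult_ac)

lemma sphere_integral_const: "sphere_integral \<alpha> \<beta> (\<lambda>x::'a::euclidean_space. c) s = emeasure lborel (shell \<alpha> \<beta> :: 'a set) * c"
  unfolding sphere_integral_def by (subst nn_integral_multc) auto

lemma emeasure_shell_finite: "emeasure lborel (shell \<alpha> \<beta> :: 'a::euclidean_space set) < \<infinity>"
  by (rule emeasure_bounded_finite) (auto simp: shell_def bounded_iff)

definition oscillation :: "('a::euclidean_space \<Rightarrow> real) \<Rightarrow> real \<Rightarrow> ennreal" where
  "oscillation u s = sphere_integral (1/2) 1 (\<lambda>x. sphere_integral (1/2) 1 (\<lambda>y. ennreal ((u x - u y)\<^sup>2)) s) s"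

lemma sphere_integral_measurable_pair [measurable (raw)]:
  assumes [measurable]: "(\<lambda>(x, y). h x y) \<in> borel_measurable (borel \<Otimes>\<^sub>M borel)"
  shows "(\<lambda>x. sphere_integral \<alpha> \<beta> (h x) s) \<in> borel_measurable borel"
  unfolding sphere_integral_def by measurable

text \<open>Stability of the oscillation under errors that are small in the mean square on the sphere.\<close>

lemma oscillation_perturb:
  assumes [measurable]: "u \<in> borel_measurable borel" "f \<in> borel_measurable (borel :: 'a::euclidean_space measure)"
  shows "oscillation u s \<le> 6 * (emeasure lborel (shell (1/2) 1 :: 'a set) * sphere_integral (1/2) 1 (\<lambda>x. ennreal ((f x - u x)\<^sup>2)) s) + 3 * oscillation f s"
proof -
  define A where "A x = ennreal ((f x - u x)\<^sup>2)" for x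
  define B where "B x y = ennreal ((f x - f y)\<^sup>2)" for x y
  have [measurable]: "A \<in> borel_measurable borel" "(\<lambda>(x,y). B x y) \<in> borel_measurable (borel \<Otimes>\<^sub>M borel)"
    unfolding A_def B_def by measurable
  have [measurable]: "\<And>x. B x \<in> borel_measurable borel" unfolding B_def by measurable
  let ?M = "emeasure lborel (shell (1/2) 1 :: 'a set)"
  have pt: "ennreal ((u x - u y)\<^sup>2) \<le> 3 * A x + (3 * B x y + 3 * A y)" for x y
  proof -
    from square_sum3_le[of "u x - f x" "f x - f y" "f y - u y"]
    have "(u x - u y)\<^sup>2 \<le> 3 * (f x - u x)\<^sup>2 + (3 * (f x - f y)\<^sup>2 + 3 * (f y - u y)\<^sup>2)"
      by (simp add: power2_commute[of "u x" "f x"])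
    hence "ennreal ((u x - u y)\<^sup>2) \<le> ennreal (3 * (f x - u x)\<^sup>2 + (3 * (f x - f y)\<^sup>2 + 3 * (f y - u y)\<^sup>2))" by (rule ennreal_leI)
    thus ?thesis by (simp add: A_def B_def ennreal_plus ennreal_mult)
  qed
  have "oscillation u s \<le> sphere_integral (1/2) 1 (\<lambda>x. sphere_integral (1/2) 1 (\<lambda>y. 3 * A x + (3 * B x y + 3 * A y)) s) s"
    unfolding oscillation_def by (intro sphere_integral_mono pt)
  also have "\<dots> = sphere_integral (1/2) 1 (\<lambda>x. ?M * (3 * A x) + (3 * sphere_integral (1/2) 1 (B x) s + 3 * sphere_integral (1/2) 1 A s)) s"
    by (simp add: sphere_integral_add sphere_integral_const sphere_integral_cmult)
  also have "\<dots> = ?M * (3 * sphere_integral (1/2) 1 A s) + (3 * sphere_integral (1/2) 1 (\<lambda>x. sphere_integral (1/2) 1 (B x) s) s + ?M * (3 * sphere_integral (1/2) 1 A s))"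
    by (simp add: sphere_integral_add sphere_integral_const sphere_integral_cmult)
  also have "\<dots> = 6 * (?M * sphere_integral (1/2) 1 A s) + 3 * oscillation f s"
  proof -
    have 6: "6 * X = 3 * X + 3 * X" for X :: ennreal by (simp add: distrib_right[symmetric])
    show ?thesis unfolding oscillation_def B_def 6[of "?M * sphere_integral (1/2) 1 A s"]
      by (simp only: mult.left_commute[of ?M] add_ac)
  qed
  finally show ?thesis by (simp add: A_def[abs_def])
qed

lemma liminf_less_imp_ex:
  fixes X :: "nat \<Rightarrow> ennreal"
  assumes "liminf X < y" shows "\<exists>n. X n < y"
proof (rule ccontr)
  assume "\<nexists>n. X n < y"
  hence "y \<le> liminf X" by (intro Liminf_bounded always_eventually) (auto simp: not_less)
  thus False using assms by simp
qed

text \<open>By polar coordinates and Fatou's lemma, mollified functions with mean square error tending to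
  zero in the ball have errors on almost every sphere whose lower limit is zero. On such a sphere the
  inequality for smooth functions passes to \<open>u\<close> with a larger constant.\<close>

lemma weak_sphere_poincare:
  assumes N: "CARD('n::finite) \<ge> 2"
  shows "\<exists>C>0. \<forall>(a::'n \<Rightarrow> real) R u G. centered_subsolution a R u G \<longrightarrow>
    (AE s in lborel. 0 < s \<and> s < R \<longrightarrow> oscillation u s \<le> ennreal (C * s\<^sup>2) * sphere_integral (1/8) 1 (\<lambda>x. ennreal ((norm (G x))\<^sup>2)) s)"
proof -
  have dim: "DIM(real^'n) \<ge> 2" using N by simp
  obtain C where C: "C > 0" and poin0: "\<forall>(f::real^'n \<Rightarrow> real) g s. s > 0 \<longrightarrow> f \<in> borel_measurable borel \<longrightarrow> g \<in> borel_measurable borel \<longrightarrow>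
    (\<forall>x. norm x = s \<longrightarrow> (f has_derivative (\<lambda>v. g x \<bullet> v)) (at x)) \<longrightarrow> continuous_on (sphere 0 s) g \<longrightarrow>
    sphere_integral (1/2) 1 (\<lambda>x. sphere_integral (1/2) 1 (\<lambda>y. ennreal ((f x - f y)\<^sup>2)) s) s
      \<le> ennreal (C * s\<^sup>2) * sphere_integral (1/8) 1 (\<lambda>x. ennreal ((norm (g x))\<^sup>2)) s"
    using sphere_poincare[OF dim] by (elim exE conjE)
  have poin: "\<And>(f::real^'n \<Rightarrow> real) g s. s > 0 \<Longrightarrow> f \<in> borel_measurable borel \<Longrightarrow> g \<in> borel_measurable borel \<Longrightarrow>
    (\<And>x. norm x = s \<Longrightarrow> (f has_derivative (\<lambda>v. g x \<bullet> v)) (at x)) \<Longrightarrow> continuous_on (sphere 0 s) g \<Longrightarrow>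
    oscillation f s \<le> ennreal (C * s\<^sup>2) * sphere_integral (1/8) 1 (\<lambda>x. ennreal ((norm (g x))\<^sup>2)) s"
    unfolding oscillation_def by (rule poin0[rule_format]) auto
  show ?thesis
  proof (intro exI[of _ "6 * C"] conjI allI impI)
    show "6 * C > 0" using C by simp
    fix a :: "'n \<Rightarrow> real" and R u G assume W: "centered_subsolution a R u G"
    have [measurable]: "u \<in> borel_measurable borel" "G \<in> borel_measurable borel" using W by (auto simp: centered_subsolution_def)
    let ?SG = "sphere_integral (1/8) 1 (\<lambda>x. ennreal ((norm (G x))\<^sup>2))"
    let ?M = "emeasure lborel (shell (1/2) 1 :: (real^'n) set)"
    have main: "AE s in lborel. 0 < s \<and> s < r \<longrightarrow> oscillation u s \<le> ennreal (6 * C * s\<^sup>2) * ?SG s" if r: "0 < r" "r < R" for r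
    proof -
      define P where "P n f g \<longleftrightarrow> f \<in> borel_measurable borel \<and> g \<in> borel_measurable borel \<and>
        (\<forall>x\<in>ball 0 r. (f has_derivative (\<lambda>v. g x \<bullet> v)) (at x)) \<and> continuous_on (ball 0 r) g \<and>
        (\<integral>\<^sup>+x. indicator (ball 0 r) x * ennreal ((f x - u x)\<^sup>2 + (norm (g x - G x))\<^sup>2) \<partial>lborel) < ennreal (1 / Suc n)" for n :: nat and f g
      have "\<exists>p. P n (fst p) (snd p)" for n
      proof -
        have "1 / Suc n > (0::real)" by simp
        from W r this show ?thesis
        proof (rule mollified_subsolution)
          fix f g
          assume "f \<in> borel_measurable borel" "g \<in> borel_measurable borel"
            "\<And>x. x \<in> ball 0 r \<Longrightarrow> (f has_derivative (\<lambda>v. g x \<bullet> v)) (at x)" "continuous_on (ball 0 r) g"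
            "(\<integral>\<^sup>+x. indicator (ball 0 r) x * ennreal ((f x - u x)\<^sup>2 + (norm (g x - G x))\<^sup>2) \<partial>lborel) < ennreal (1 / Suc n)"
          hence "P n f g" unfolding P_def by (intro conjI ballI)
          thus "\<exists>p. P n (fst p) (snd p)" by (intro exI[of _ "(f, g)"]) simp
        qed
      qed
      then obtain p where p: "\<And>n. P n (fst (p n)) (snd (p n))" using choice[of "\<lambda>n q. P n (fst q) (snd q)"] by blast
      define f where "f n = fst (p n)" for n
      define g where "g n = snd (p n)" for n
      have fg: "\<And>n. f n \<in> borel_measurable borel" "\<And>n. g n \<in> borel_measurable borel"
        "\<And>n x. x \<in> ball 0 r \<Longrightarrow> (f n has_derivative (\<lambda>v. g n x \<bullet> v)) (at x)" "\<And>n. continuous_on (ball 0 r) (g n)"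
        "\<And>n. (\<integral>\<^sup>+x. indicator (ball 0 r) x * ennreal ((f n x - u x)\<^sup>2 + (norm (g n x - G x))\<^sup>2) \<partial>lborel) < ennreal (1 / Suc n)"
        using p unfolding f_def[symmetric] g_def[symmetric] by (simp_all only: P_def simp_thms)
      note [measurable] = fg(1,2)
      \<comment> \<open>errors are controlled in the ball of radius \<open>r\<close>, hence on the spheres with \<open>s < r\<close>\<close>
      define h1 where "h1 n x = (if norm x < r then ennreal ((f n x - u x)\<^sup>2) else 0)" for n x
      define h2 where "h2 n x = (if norm x < r then ennreal ((norm (g n x - G x))\<^sup>2) else 0)" for n x
      have [measurable]: "h1 n \<in> borel_measurable borel" "h2 n \<in> borel_measurable borel" for n
        unfolding h1_def h2_def by measurable
      define E where "E n s = sphere_integral (1/2) 1 (h1 n) s + sphere_integral (1/8) 1 (h2 n) s" for n s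
      have [measurable]: "E n \<in> borel_measurable borel" for n unfolding E_def by measurable
      define c1 where "c1 = polar_const TYPE(real^'n) (1/2) 1"
      define c2 where "c2 = polar_const TYPE(real^'n) (1/8) 1"
      have c: "c1 > 0" "c2 > 0" unfolding c1_def c2_def by (auto intro!: polar_const_ennreal(2))
      let ?k = "\<lambda>s::real. indicator {0<..} s * ennreal (s ^ (DIM(real^'n) - 1))"
      have intE: "(\<integral>\<^sup>+s. ?k s * E n s \<partial>lborel) \<le> ennreal (c1 + c2) * ennreal (1 / Suc n)" for n
      proof -
        have "(\<integral>\<^sup>+s. ?k s * E n s \<partial>lborel) = (\<integral>\<^sup>+s. ?k s * sphere_integral (1/2) 1 (h1 n) s + ?k s * sphere_integral (1/8) 1 (h2 n) s \<partial>lborel)"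
          unfolding E_def by (simp add: distrib_left)
        also have "\<dots> = (\<integral>\<^sup>+s. ?k s * sphere_integral (1/2) 1 (h1 n) s \<partial>lborel) + (\<integral>\<^sup>+s. ?k s * sphere_integral (1/8) 1 (h2 n) s \<partial>lborel)"
          by (rule nn_integral_add) measurable
        also have "\<dots> = ennreal c1 * (\<integral>\<^sup>+x. h1 n x \<partial>lborel) + ennreal c2 * (\<integral>\<^sup>+x. h2 n x \<partial>lborel)"
          unfolding c1_def c2_def by (subst (1 2) polar_nn_integral) auto
        also have "\<dots> \<le> ennreal (c1 + c2) * (\<integral>\<^sup>+x. h1 n x \<partial>lborel) + ennreal (c1 + c2) * (\<integral>\<^sup>+x. h2 n x \<partial>lborel)"
          using c by (intro add_mono mult_right_mono ennreal_leI) auto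
        also have "\<dots> = ennreal (c1 + c2) * (\<integral>\<^sup>+x. h1 n x + h2 n x \<partial>lborel)"
          by (subst nn_integral_add) (auto simp: distrib_left)
        also have "(\<integral>\<^sup>+x. h1 n x + h2 n x \<partial>lborel) = (\<integral>\<^sup>+x. indicator (ball 0 r) x * ennreal ((f n x - u x)\<^sup>2 + (norm (g n x - G x))\<^sup>2) \<partial>lborel)"
          by (intro nn_integral_cong) (auto simp: h1_def h2_def ennreal_plus)
        finally show ?thesis using fg(5)[of n] by (meson less_imp_le mult_left_mono order_trans zero_le)
      qed
      have "(\<integral>\<^sup>+s. liminf (\<lambda>n. ?k s * E n s) \<partial>lborel) \<le> liminf (\<lambda>n. \<integral>\<^sup>+s. ?k s * E n s \<partial>lborel)"
        by (rule nn_integral_liminf) measurable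
      also have "\<dots> \<le> liminf (\<lambda>n. ennreal (c1 + c2) * ennreal (1 / Suc n))"
        by (intro Liminf_mono always_eventually allI intE)
      also have "(\<lambda>n. ennreal (c1 + c2) * ennreal (1 / Suc n)) \<longlonglongrightarrow> ennreal (c1 + c2) * ennreal 0"
        using LIMSEQ_inverse_real_of_nat by (intro ennreal_tendsto_cmult tendsto_ennrealI) (auto simp: inverse_eq_divide)
      hence "liminf (\<lambda>n. ennreal (c1 + c2) * ennreal (1 / Suc n)) = 0"
        by (subst lim_imp_Liminf) auto
      finally have "(\<integral>\<^sup>+s. liminf (\<lambda>n. ?k s * E n s) \<partial>lborel) = 0" by simp
      hence "AE s in lborel. liminf (\<lambda>n. ?k s * E n s) = 0"
        by (subst (asm) nn_integral_0_iff_AE) auto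
      thus ?thesis
      proof eventually_elim
        case (elim s)
        show ?case
        proof (intro impI)
          assume s: "0 < s \<and> s < r"
          define k where "k = s ^ (DIM(real^'n) - 1)"
          have k: "k > 0" using s by (simp add: k_def)
          have lim: "liminf (\<lambda>n. ennreal k * E n s) = 0" using elim s by (simp add: k_def)
          obtain m where m: "?M = ennreal m" "m \<ge> 0"
            using emeasure_shell_finite[of "1/2" 1, where 'a="real^'n"] by (cases ?M) auto
          define K where "K = 6 * m + 6 * C * s\<^sup>2 + 1"
          have K: "K > 0" unfolding K_def using m C by (intro add_nonneg_pos add_nonneg_nonneg) auto
          have est: "oscillation u s \<le> ennreal (6 * C * s\<^sup>2) * ?SG s + ennreal K * E n s" for n
          proof -
            have "oscillation u s \<le> 6 * (?M * sphere_integral (1/2) 1 (\<lambda>x. ennreal ((f n x - u x)\<^sup>2)) s) + 3 * oscillation (f n) s"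
              by (rule oscillation_perturb) measurable
            also have "sphere_integral (1/2) 1 (\<lambda>x. ennreal ((f n x - u x)\<^sup>2)) s = sphere_integral (1/2) 1 (h1 n) s"
              using s by (intro sphere_integral_cong_sphere) (auto simp: h1_def)
            also have "oscillation (f n) s \<le> ennreal (C * s\<^sup>2) * sphere_integral (1/8) 1 (\<lambda>x. ennreal ((norm (g n x))\<^sup>2)) s"
            proof (rule poin)
              show "continuous_on (sphere 0 s) (g n)" using s by (intro continuous_on_subset[OF fg(4)]) auto
              show "(f n has_derivative (\<lambda>v. g n x \<bullet> v)) (at x)" if "norm x = s" for x using s that by (intro fg(3)) auto
            qed (use s in auto)
            also have "sphere_integral (1/8) 1 (\<lambda>x. ennreal ((norm (g n x))\<^sup>2)) s \<le> sphere_integral (1/8) 1 (\<lambda>x. 2 * ennreal ((norm (G x))\<^sup>2) + 2 * ennreal ((norm (g n x - G x))\<^sup>2)) s"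
            proof (rule sphere_integral_mono)
              fix x
              have "norm (g n x) \<le> norm (G x) + norm (g n x - G x)" by (rule norm_triangle_sub)
              hence "(norm (g n x))\<^sup>2 \<le> (norm (G x) + norm (g n x - G x))\<^sup>2" by (intro power_mono) auto
              also have "\<dots> \<le> 2 * (norm (G x))\<^sup>2 + 2 * (norm (g n x - G x))\<^sup>2"
                using zero_le_power2[of "norm (G x) - norm (g n x - G x)"] by (simp add: power2_eq_square algebra_simps)
              finally have "ennreal ((norm (g n x))\<^sup>2) \<le> ennreal (2 * (norm (G x))\<^sup>2 + 2 * (norm (g n x - G x))\<^sup>2)" by (rule ennreal_leI)
              thus "ennreal ((norm (g n x))\<^sup>2) \<le> 2 * ennreal ((norm (G x))\<^sup>2) + 2 * ennreal ((norm (g n x - G x))\<^sup>2)"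
                by (simp add: ennreal_plus ennreal_mult)
            qed
            also have "\<dots> = 2 * ?SG s + 2 * sphere_integral (1/8) 1 (\<lambda>x. ennreal ((norm (g n x - G x))\<^sup>2)) s"
              by (subst sphere_integral_add) (auto simp: sphere_integral_cmult)
            also have "sphere_integral (1/8) 1 (\<lambda>x. ennreal ((norm (g n x - G x))\<^sup>2)) s = sphere_integral (1/8) 1 (h2 n) s"
              using s by (intro sphere_integral_cong_sphere) (auto simp: h2_def)
            finally have 1: "oscillation u s \<le> 6 * (?M * sphere_integral (1/2) 1 (h1 n) s) + 3 * (ennreal (C * s\<^sup>2) * (2 * ?SG s + 2 * sphere_integral (1/8) 1 (h2 n) s))"
              by (simp add: mult_left_mono add_left_mono add_mono)
            have e6: "6 * ?M = ennreal (6 * m)" "3 * ennreal (C * s\<^sup>2) * 2 = ennreal (6 * C * s\<^sup>2)"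
              using m C by (simp_all add: ennreal_mult) (simp add: mult_ac ennreal_numeral[symmetric] ennreal_mult[symmetric] del: ennreal_numeral)
            have "6 * (?M * X) + 3 * (ennreal (C * s\<^sup>2) * (2 * Y + 2 * Z)) = (6 * ?M) * X + ((3 * ennreal (C * s\<^sup>2) * 2) * Y + (3 * ennreal (C * s\<^sup>2) * 2) * Z)" for X Y Z
              by (simp only: distrib_left mult.assoc mult.left_commute[of _ 2])
            with 1 have "oscillation u s \<le> ennreal (6 * m) * sphere_integral (1/2) 1 (h1 n) s + (ennreal (6 * C * s\<^sup>2) * ?SG s + ennreal (6 * C * s\<^sup>2) * sphere_integral (1/8) 1 (h2 n) s)"
              by (simp only: e6)
            also have "\<dots> \<le> ennreal K * sphere_integral (1/2) 1 (h1 n) s + (ennreal (6 * C * s\<^sup>2) * ?SG s + ennreal K * sphere_integral (1/8) 1 (h2 n) s)"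
              using m C by (intro add_mono mult_right_mono ennreal_leI) (auto simp: K_def)
            also have "\<dots> = ennreal (6 * C * s\<^sup>2) * ?SG s + ennreal K * E n s"
              by (simp add: E_def distrib_left add_ac)
            finally show ?thesis .
          qed
          show "oscillation u s \<le> ennreal (6 * C * s\<^sup>2) * ?SG s"
          proof (rule ennreal_le_epsilon)
            fix e :: real assume e: "e > 0"
            have "0 < ennreal (e * k / K)" using e k K by simp
            hence "\<exists>n. ennreal k * E n s < ennreal (e * k / K)"
              by (intro liminf_less_imp_ex) (simp only: lim)
            then obtain n where n: "ennreal k * E n s < ennreal (e * k / K)" by (elim exE)
            have "ennreal K * E n s = ennreal (K / k) * (ennreal k * E n s)"
              using k K by (simp add: mult.assoc[symmetric] ennreal_mult[symmetric])
            also have "\<dots> \<le> ennreal (K / k) * ennreal (e * k / K)" by (intro mult_left_mono less_imp_le[OF n]) simp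
            also have "\<dots> = ennreal e" using e k K by (simp add: ennreal_mult[symmetric])
            finally show "oscillation u s \<le> ennreal (6 * C * s\<^sup>2) * ?SG s + ennreal e"
              using est[of n] by (meson add_left_mono order_trans)
          qed
        qed
      qed
    qed
    have "AE s in lborel. \<forall>r\<in>\<rat>. 0 < r \<and> r < R \<longrightarrow> 0 < s \<and> s < r \<longrightarrow> oscillation u s \<le> ennreal (6 * C * s\<^sup>2) * ?SG s"
      by (subst AE_ball_countable[OF countable_rat]) (use main in auto)
    thus "AE s in lborel. 0 < s \<and> s < R \<longrightarrow> oscillation u s \<le> ennreal (6 * C * s\<^sup>2) * ?SG s"
    proof eventually_elim
      case (elim s)
      show ?case
      proof
        assume s: "0 < s \<and> s < R"
        then obtain r where "r \<in> \<rat>" "s < r" "r < R" using Rats_dense_in_real by blast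
        thus "oscillation u s \<le> ennreal (6 * C * s\<^sup>2) * ?SG s" using elim s by auto
      qed
    qed
  qed
qed

section \<open>One phase\<close>

lemma sphere_integral_mono_sphere:
  assumes "0 < \<alpha>" "0 < s" "\<And>x. norm x = s \<Longrightarrow> h x \<le> h' x"
  shows "sphere_integral \<alpha> \<beta> h s \<le> sphere_integral \<alpha> \<beta> h' s"
  unfolding sphere_integral_def
proof (rule nn_integral_mono, goal_cases)
  case (1 x)
  show ?case
  proof (cases "x \<in> shell \<alpha> \<beta>")
    case True
    hence "norm x > 0" using assms by (auto simp: shell_def)
    hence "norm ((s / norm x) *\<^sub>R x) = s" using assms by simp
    thus ?thesis using assms(3) by (simp add: mult_left_mono)
  qed simp
qed

definition slice_energy :: "('n::finite \<Rightarrow> real) \<Rightarrow> (real^'n \<Rightarrow> real^'n) \<Rightarrow> real \<Rightarrow> ennreal" where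
  "slice_energy a G s = ennreal (s ^ (CARD('n) - 1) / polar_const TYPE(real^'n) (1/8) 1) * sphere_integral (1/8) 1 (\<lambda>x. ennreal (energy a (G x) * kernel a 0 x)) s"

lemma slice_energy_measurable [measurable]:
  assumes [measurable]: "G \<in> borel_measurable borel"
  shows "slice_energy a G \<in> borel_measurable borel"
  unfolding slice_energy_def[abs_def] by measurable

text \<open>The slice energy is the radial density of the energy in balls.\<close>

lemma energy_in_ball_split:
  fixes a :: "'n::finite \<Rightarrow> real"
  assumes [measurable]: "G \<in> borel_measurable borel" and st: "0 < s" "s \<le> t"
  shows "energy_in_ball a G t = energy_in_ball a G s + (\<integral>\<^sup>+\<tau>. indicator {s..<t} \<tau> * slice_energy a G \<tau> \<partial>lborel)"
proof -
  let ?e = "\<lambda>x. ennreal (energy a (G x) * kernel a 0 x)"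
  define c where "c = polar_const TYPE(real^'n) (1/8) 1"
  have c: "c > 0" unfolding c_def by (auto intro!: polar_const_ennreal(2))
  define h where "h x = (if s \<le> norm x \<and> norm x < t then ?e x else 0)" for x
  have [measurable]: "h \<in> borel_measurable borel" unfolding h_def by measurable
  have "energy_in_ball a G t = (\<integral>\<^sup>+x. (if norm x < s then ?e x else 0) + h x \<partial>lborel)"
    unfolding energy_in_ball_def using st by (intro nn_integral_cong) (auto simp: h_def indicator_def)
  also have "\<dots> = (\<integral>\<^sup>+x. (if norm x < s then ?e x else 0) \<partial>lborel) + (\<integral>\<^sup>+x. h x \<partial>lborel)"
    by (rule nn_integral_add) measurable
  also have "(\<integral>\<^sup>+x. (if norm x < s then ?e x else 0) \<partial>lborel) = energy_in_ball a G s"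
    unfolding energy_in_ball_def by (intro nn_integral_cong) (auto simp: indicator_def)
  also have "(\<integral>\<^sup>+x. h x \<partial>lborel) = ennreal (1 / c) * (ennreal c * (\<integral>\<^sup>+x. h x \<partial>lborel))"
    using c by (simp add: mult.assoc[symmetric] ennreal_mult[symmetric])
  also have "ennreal c * (\<integral>\<^sup>+x. h x \<partial>lborel) = (\<integral>\<^sup>+\<tau>. indicator {0<..} \<tau> * ennreal (\<tau> ^ (CARD('n) - 1)) * sphere_integral (1/8) 1 h \<tau> \<partial>lborel)"
    unfolding c_def by (subst polar_nn_integral[symmetric]) auto
  also have "ennreal (1 / c) * \<dots> = (\<integral>\<^sup>+\<tau>. ennreal (1 / c) * (indicator {0<..} \<tau> * ennreal (\<tau> ^ (CARD('n) - 1)) * sphere_integral (1/8) 1 h \<tau>) \<partial>lborel)"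
    by (rule nn_integral_cmult[symmetric]) measurable
  also have "\<dots> = (\<integral>\<^sup>+\<tau>. indicator {s..<t} \<tau> * slice_energy a G \<tau> \<partial>lborel)"
  proof (rule nn_integral_cong, goal_cases)
    case (1 \<tau>)
    show ?case
    proof (cases "\<tau> > 0")
      case True
      have "sphere_integral (1/8) 1 h \<tau> = sphere_integral (1/8) 1 (\<lambda>x. indicator {s..<t} \<tau> * ?e x) \<tau>"
        using True by (intro sphere_integral_cong_sphere) (auto simp: h_def indicator_def)
      also have "\<dots> = indicator {s..<t} \<tau> * sphere_integral (1/8) 1 ?e \<tau>" by (rule sphere_integral_cmult) measurable
      finally have 1: "sphere_integral (1/8) 1 h \<tau> = indicator {s..<t} \<tau> * sphere_integral (1/8) 1 ?e \<tau>" .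
      have e2: "ennreal (1 / c) * ennreal (\<tau> ^ (CARD('n) - 1)) = ennreal (\<tau> ^ (CARD('n) - 1) / c)"
        using True c by (simp add: ennreal_mult[symmetric])
      have "ennreal (1 / c) * (indicator {0<..} \<tau> * ennreal (\<tau> ^ (CARD('n) - 1)) * sphere_integral (1/8) 1 h \<tau>)
        = (ennreal (1 / c) * ennreal (\<tau> ^ (CARD('n) - 1))) * (indicator {s..<t} \<tau> * sphere_integral (1/8) 1 ?e \<tau>)"
        using True unfolding 1 by (simp add: mult.assoc)
      also have "\<dots> = indicator {s..<t} \<tau> * slice_energy a G \<tau>"
        unfolding e2 slice_energy_def c_def[symmetric] by (rule mult.left_commute)
      finally show ?thesis .
    next
      case False
      thus ?thesis using st by (auto simp: indicator_def)
    qed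
  qed
  finally show ?thesis .
qed

lemma energy_in_ball_mono: "s \<le> t \<Longrightarrow> energy_in_ball a G s \<le> energy_in_ball a G t"
  unfolding energy_in_ball_def by (intro nn_integral_mono mult_right_mono) (auto simp: indicator_def)

text \<open>Because \<open>a i \<ge> 1\<close>, the kernel is at least \<open>norm x powr (2 - N)\<close> and the energy at least the
  square of the norm.\<close>

lemma slice_energy_lower_bound:
  fixes a :: "'n::finite \<Rightarrow> real"
  assumes [measurable]: "G \<in> borel_measurable borel" and N: "CARD('n) \<ge> 2" and a: "\<And>i. 1 \<le> a i" and s: "s > 0"
  shows "ennreal (s / polar_const TYPE(real^'n) (1/8) 1) * sphere_integral (1/8) 1 (\<lambda>x. ennreal ((norm (G x))\<^sup>2)) s \<le> slice_energy a G s"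
proof -
  define c where "c = polar_const TYPE(real^'n) (1/8) 1"
  have c: "c > 0" unfolding c_def by (auto intro!: polar_const_ennreal(2))
  define p where "p = (2 - real CARD('n)) / 2"
  have p0: "p \<le> 0" using N by (simp add: p_def)
  have a0: "a i > 0" for i using a(1)[of i] by linarith
  have low: "s powr (2 * p) \<le> kernel a 0 x" if x: "norm x = s" for x :: "real^'n"
  proof -
    have "(\<Sum>i\<in>UNIV. (x $ i)\<^sup>2 / a i) \<le> (\<Sum>i\<in>UNIV. (x $ i)\<^sup>2)"
      by (rule sum_mono) (use a a0 in \<open>simp add: divide_le_eq mult_le_cancel_left1\<close>)
    hence le: "(\<Sum>i\<in>UNIV. (x $ i)\<^sup>2 / a i) \<le> s\<^sup>2" using x norm_square_sum_cart[of x] by simp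
    have "x \<noteq> 0" using x s by auto
    hence pos: "0 < (\<Sum>i\<in>UNIV. (x $ i)\<^sup>2 / a i)" by (rule weighted_square_sum_pos[OF _ a])
    have "(s\<^sup>2) powr p \<le> kernel a 0 x" unfolding kernel_def p_def[symmetric] using p0 pos le by (intro powr_mono2') auto
    moreover have "(s\<^sup>2) powr p = s powr (2 * p)" using s by (simp add: powr_powr[symmetric] powr_numeral)
    ultimately show ?thesis by simp
  qed
  have "ennreal (s powr (2 * p)) * sphere_integral (1/8) 1 (\<lambda>x. ennreal ((norm (G x))\<^sup>2)) s
     = sphere_integral (1/8) 1 (\<lambda>x. ennreal (s powr (2 * p)) * ennreal ((norm (G x))\<^sup>2)) s"
    by (subst sphere_integral_cmult) auto
  also have "\<dots> \<le> sphere_integral (1/8) 1 (\<lambda>x. ennreal (energy a (G x) * kernel a 0 x)) s"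
  proof (rule sphere_integral_mono_sphere)
    fix x :: "real^'n" assume x: "norm x = s"
    have "(norm (G x))\<^sup>2 \<le> energy a (G x)"
      unfolding norm_square_sum_cart energy_def by (rule sum_mono) (use mult_right_mono[OF a] in fastforce)
    hence "(norm (G x))\<^sup>2 * s powr (2 * p) \<le> energy a (G x) * kernel a 0 x"
      using low[OF x] by (intro mult_mono energy_nonneg a) auto
    thus "ennreal (s powr (2 * p)) * ennreal ((norm (G x))\<^sup>2) \<le> ennreal (energy a (G x) * kernel a 0 x)"
      by (subst ennreal_mult[symmetric]) (auto intro!: ennreal_leI simp: mult.commute)
  qed (use s in auto)
  finally have "ennreal (s ^ (CARD('n) - 1) / c) * (ennreal (s powr (2 * p)) * sphere_integral (1/8) 1 (\<lambda>x. ennreal ((norm (G x))\<^sup>2)) s)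
     \<le> ennreal (s ^ (CARD('n) - 1) / c) * sphere_integral (1/8) 1 (\<lambda>x. ennreal (energy a (G x) * kernel a 0 x)) s"
    by (rule mult_left_mono) simp
  moreover have "ennreal (s ^ (CARD('n) - 1) / c) * ennreal (s powr (2 * p)) = ennreal (s / c)"
  proof -
    have "s ^ (CARD('n) - 1) * s powr (2 * p) = s"
    proof -
      have "s ^ (CARD('n) - 1) = s powr (real CARD('n) - 1)" using s N by (simp add: powr_realpow[symmetric] of_nat_diff)
      hence "s ^ (CARD('n) - 1) * s powr (2 * p) = s powr (real CARD('n) - 1 + 2 * p)" by (simp only: powr_add)
      also have "real CARD('n) - 1 + 2 * p = 1" by (simp add: p_def field_simps)
      finally show ?thesis using s by simp
    qed
    thus ?thesis using s c by (simp add: ennreal_mult[symmetric])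
  qed
  ultimately show ?thesis unfolding slice_energy_def c_def[symmetric] by (simp add: mult.assoc[symmetric])
qed

definition slice_zeros :: "('a::euclidean_space \<Rightarrow> real) \<Rightarrow> real \<Rightarrow> 'a set" where
  "slice_zeros u s = {x \<in> shell (1/2) 1. u ((s / norm x) *\<^sub>R x) = 0}"

lemma slice_zeros_measurable [measurable]:
  assumes [measurable]: "u \<in> borel_measurable borel" shows "slice_zeros u s \<in> sets borel"
  unfolding slice_zeros_def by measurable

lemma slice_zeros_emeasure: 
  assumes "u \<in> borel_measurable borel"
  shows "emeasure lborel (slice_zeros u s) = ennreal (measure lborel (slice_zeros u s))"
proof -
  have "emeasure lborel (slice_zeros u s) \<le> emeasure lborel (shell (1/2) 1 :: 'a set)"
    by (rule emeasure_mono) (auto simp: slice_zeros_def)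
  also have "\<dots> < \<infinity>" by (rule emeasure_shell_finite)
  finally show ?thesis by (intro emeasure_eq_ennreal_measure) auto
qed

lemma shell_measure_pos: "measure lborel (shell (1/2) 1 :: 'a::euclidean_space set) > 0"
proof -
  obtain b :: 'a where b: "b \<in> Basis" using nonempty_Basis by blast
  have sub: "ball ((3/4) *\<^sub>R b) (1/8) \<subseteq> shell (1/2) 1"
  proof
    fix z assume "z \<in> ball ((3/4) *\<^sub>R b) (1/8)"
    hence "norm (z - (3/4) *\<^sub>R b) < 1/8" by (simp add: dist_norm norm_minus_commute)
    moreover have "norm ((3/4) *\<^sub>R b) = 3/4" using b by simp
    moreover have "norm z \<le> norm ((3/4) *\<^sub>R b) + norm (z - (3/4) *\<^sub>R b)" by (rule norm_triangle_sub)
    moreover have "norm ((3/4) *\<^sub>R b) \<le> norm z + norm (z - (3/4) *\<^sub>R b)"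
      using norm_triangle_sub[of "(3/4) *\<^sub>R b" z] by (simp add: norm_minus_commute)
    ultimately show "z \<in> shell (1/2) 1" unfolding shell_def by simp
  qed
  have "0 < emeasure lborel (ball ((3/4) *\<^sub>R b) (1/8))" by (subst emeasure_ball) (auto simp: unit_ball_vol_pos)
  also have "\<dots> \<le> emeasure lborel (shell (1/2) 1 :: 'a set)" by (rule emeasure_mono[OF sub]) auto
  finally show ?thesis using emeasure_shell_finite[of "1/2" 1, where 'a='a]
    by (simp add: measure_def enn2real_positive_iff)
qed

text \<open>If \<open>u\<close> vanishes on a set \<open>Z\<close> of directions, the oscillation of \<open>u\<close> is at least the measure of \<open>Z\<close>
  times the integral of \<open>u\<^sup>2\<close>. When \<open>Z\<close> is at least half of the sphere, the Poincare inequality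
  bounds that integral by the gradient, and the right side of \<open>energy_le_slice\<close> becomes a multiple
  of \<open>s * slice_energy a G s\<close>.\<close>

lemma one_phase_estimate:
  assumes N: "CARD('n::finite) \<ge> 2" and L: "L \<ge> 1"
  shows "\<exists>K\<ge>1. \<forall>(a::'n \<Rightarrow> real) R u G. (\<forall>i. 1 \<le> a i \<and> a i \<le> L) \<longrightarrow> centered_subsolution a R u G \<longrightarrow>
    (AE s in lborel. 0 < s \<and> s < R \<and> measure lborel (shell (1/2) 1 :: (real^'n) set) \<le> 2 * measure lborel (slice_zeros u s) \<longrightarrow>
       energy_in_ball a G s \<le> ennreal (K * s) * slice_energy a G s)"
proof -
  obtain C where C: "C > 0" and poin: "\<forall>(a::'n \<Rightarrow> real) R u G. centered_subsolution a R u G \<longrightarrow>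
    (AE s in lborel. 0 < s \<and> s < R \<longrightarrow> oscillation u s \<le> ennreal (C * s\<^sup>2) * sphere_integral (1/8) 1 (\<lambda>x. ennreal ((norm (G x))\<^sup>2)) s)"
    using weak_sphere_poincare[OF N] by (elim exE conjE)
  define m where "m = measure lborel (shell (1/2) 1 :: (real^'n) set)"
  have m: "m > 0" unfolding m_def by (rule shell_measure_pos)
  define c where "c = polar_const TYPE(real^'n) (1/8) 1"
  have c: "c > 0" unfolding c_def by (auto intro!: polar_const_ennreal(2))
  define S where "S = slice_const TYPE('n) L"
  have S: "S \<ge> 0" unfolding S_def slice_const_def using L caccioppoli_const_pos[of L, where 'n='n] c
    by (intro add_nonneg_nonneg divide_nonneg_nonneg less_imp_le[OF polar_const_ennreal(2)]) auto
  \<comment> \<open>the summand \<open>1\<close> ensures \<open>K \<ge> 1\<close>; the factor \<open>c\<close> cancels the one in \<open>slice_energy\<close>\<close>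
  define K where "K = 1 + S * (2 * C / m + 1) * c"
  have Kb: "S * (2 * C / m + 1) \<le> K / c" using c by (simp add: K_def field_simps)
  have K1: "K \<ge> 1" unfolding K_def using S C m c by simp
  show ?thesis
  proof (intro exI[of _ K] conjI K1 allI impI)
    fix a :: "'n \<Rightarrow> real" and R u G
    assume a: "\<forall>i. 1 \<le> a i \<and> a i \<le> L" and W: "centered_subsolution a R u G"
    have [measurable]: "u \<in> borel_measurable borel" "G \<in> borel_measurable borel" using W by (auto simp: centered_subsolution_def)
    let ?SG = "sphere_integral (1/8) 1 (\<lambda>x. ennreal ((norm (G x))\<^sup>2))"
    let ?SU = "sphere_integral (1/2) 1 (\<lambda>x. ennreal ((u x)\<^sup>2))"
    have "AE s in lborel. 0 < s \<and> s < R \<longrightarrow> oscillation u s \<le> ennreal (C * s\<^sup>2) * ?SG s" using poin W by blast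
    moreover have "AE s in lborel. 0 < s \<and> s < R \<longrightarrow> energy_in_ball a G s \<le> ennreal S * (?SU s + ennreal (s\<^sup>2) * ?SG s)"
      unfolding S_def by (rule energy_le_slice[OF N _ _ W]) (use a in auto)
    ultimately show "AE s in lborel. 0 < s \<and> s < R \<and> measure lborel (shell (1/2) 1 :: (real^'n) set) \<le> 2 * measure lborel (slice_zeros u s) \<longrightarrow>
       energy_in_ball a G s \<le> ennreal (K * s) * slice_energy a G s"
    proof eventually_elim
      case (elim s)
      show ?case
      proof
        assume s: "0 < s \<and> s < R \<and> measure lborel (shell (1/2) 1 :: (real^'n) set) \<le> 2 * measure lborel (slice_zeros u s)"
        let ?Z = "slice_zeros u s"
        have "emeasure lborel ?Z * ?SU s = sphere_integral (1/2) 1 (\<lambda>x. emeasure lborel ?Z * ennreal ((u x)\<^sup>2)) s"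
          by (subst sphere_integral_cmult) auto
        also have "\<dots> \<le> oscillation u s"
          unfolding oscillation_def
        proof (rule sphere_integral_mono)
          fix x
          have "emeasure lborel ?Z * ennreal ((u x)\<^sup>2) = (\<integral>\<^sup>+y. indicator ?Z y * ennreal ((u x)\<^sup>2) \<partial>lborel)"
            by (subst nn_integral_multc) auto
          also have "\<dots> \<le> sphere_integral (1/2) 1 (\<lambda>y. ennreal ((u x - u y)\<^sup>2)) s"
            unfolding sphere_integral_def by (intro nn_integral_mono) (auto simp: slice_zeros_def indicator_def)
          finally show "emeasure lborel ?Z * ennreal ((u x)\<^sup>2) \<le> sphere_integral (1/2) 1 (\<lambda>y. ennreal ((u x - u y)\<^sup>2)) s" .
        qed
        also have "\<dots> \<le> ennreal (C * s\<^sup>2) * ?SG s" using elim s by blast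
        finally have 1: "emeasure lborel ?Z * ?SU s \<le> ennreal (C * s\<^sup>2) * ?SG s" .
        have "ennreal (m / 2) \<le> emeasure lborel ?Z" using s unfolding m_def
          by (subst slice_zeros_emeasure) (auto intro!: ennreal_leI)
        hence "ennreal (m / 2) * ?SU s \<le> ennreal (C * s\<^sup>2) * ?SG s"
          using 1 by (meson mult_right_mono order_trans zero_le)
        hence "ennreal (2 / m) * (ennreal (m / 2) * ?SU s) \<le> ennreal (2 / m) * (ennreal (C * s\<^sup>2) * ?SG s)"
          by (rule mult_left_mono) simp
        hence SU: "?SU s \<le> ennreal (2 * C / m * s\<^sup>2) * ?SG s"
          using m C by (simp add: mult.assoc[symmetric] ennreal_mult[symmetric])
        have "energy_in_ball a G s \<le> ennreal S * (?SU s + ennreal (s\<^sup>2) * ?SG s)" using elim s by blast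
        also have "\<dots> \<le> ennreal S * (ennreal (2 * C / m * s\<^sup>2) * ?SG s + ennreal (s\<^sup>2) * ?SG s)"
          by (intro mult_left_mono add_right_mono SU) simp
        also have "\<dots> = ennreal (S * (2 * C / m + 1) * s\<^sup>2) * ?SG s"
        proof -
          have "ennreal S * (ennreal (2 * C / m * s\<^sup>2) * X + ennreal (s\<^sup>2) * X) = ennreal (S * (2 * C / m * s\<^sup>2 + s\<^sup>2)) * X" for X
            using S C m by (simp add: ennreal_mult ennreal_plus distrib_right mult.assoc del: ennreal_plus[symmetric])
          moreover have "S * (2 * C / m * s\<^sup>2 + s\<^sup>2) = S * (2 * C / m + 1) * s\<^sup>2"
            by (simp only: distrib_left distrib_right mult_1 mult.assoc)
          ultimately show ?thesis by (simp only:)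
        qed
        also have "\<dots> \<le> ennreal (K / c * s\<^sup>2) * ?SG s"
          by (intro mult_right_mono ennreal_leI Kb) auto
        also have "\<dots> = ennreal (K * s) * (ennreal (s / c) * ?SG s)"
          using s K1 c by (simp add: mult.assoc[symmetric] ennreal_mult[symmetric] power2_eq_square)
        also have "\<dots> \<le> ennreal (K * s) * slice_energy a G s"
          unfolding c_def using s a by (intro mult_left_mono slice_energy_lower_bound N) auto
        finally show "energy_in_ball a G s \<le> ennreal (K * s) * slice_energy a G s" .
      qed
    qed
  qed
qed

section \<open>Two phases\<close>

text \<open>The zero sets of \<open>u\<close> and \<open>v\<close> cover almost every sphere up to a null set, so one of them fills half
  of it and \<open>one_phase_estimate\<close> applies to that function. Writing \<open>F\<close>, \<open>E\<close> for the energies and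
  \<open>f\<close>, \<open>e\<close> for their densities, \<open>F t * E t \<ge> F s * E s + \<integral> (F s * e + E s * f)\<close>, and by
  monotonicity the integrand is at least \<open>F s * E s / (K * t)\<close>.\<close>

lemma two_phase_growth:
  assumes N: "CARD('n::finite) \<ge> 2" and L: "L \<ge> 1"
  shows "\<exists>K\<ge>1. \<forall>(a::'n \<Rightarrow> real) b R u v G V. (\<forall>i. 1 \<le> a i \<and> a i \<le> L) \<longrightarrow> (\<forall>i. 1 \<le> b i \<and> b i \<le> L) \<longrightarrow>
     centered_subsolution a R u G \<longrightarrow> centered_subsolution b R v V \<longrightarrow> (AE x in lborel. norm x < R \<longrightarrow> u x * v x = 0) \<longrightarrow>
     (\<forall>s t. 0 < s \<longrightarrow> s \<le> t \<longrightarrow> t < R \<longrightarrow>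
       ennreal (1 + (t - s) / (K * t)) * (energy_in_ball a G s * energy_in_ball b V s) \<le> energy_in_ball a G t * energy_in_ball b V t)"
proof -
  obtain K where K: "K \<ge> 1" and one: "\<forall>(a::'n \<Rightarrow> real) R u G. (\<forall>i. 1 \<le> a i \<and> a i \<le> L) \<longrightarrow> centered_subsolution a R u G \<longrightarrow>
    (AE s in lborel. 0 < s \<and> s < R \<and> measure lborel (shell (1/2) 1 :: (real^'n) set) \<le> 2 * measure lborel (slice_zeros u s) \<longrightarrow>
       energy_in_ball a G s \<le> ennreal (K * s) * slice_energy a G s)"
    using one_phase_estimate[OF N L] by (elim exE conjE)
  show ?thesis
  proof (intro exI[of _ K] conjI K allI impI)
    fix a b :: "'n \<Rightarrow> real" and R u v G V s t
    assume a: "\<forall>i. 1 \<le> a i \<and> a i \<le> L" and b: "\<forall>i. 1 \<le> b i \<and> b i \<le> L"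
      and W: "centered_subsolution a R u G" "centered_subsolution b R v V" and uv: "AE x in lborel. norm x < R \<longrightarrow> u x * v x = 0"
      and st: "0 < s" "s \<le> t" "t < R"
    have [measurable]: "u \<in> borel_measurable borel" "G \<in> borel_measurable borel" "v \<in> borel_measurable borel" "V \<in> borel_measurable borel"
      using W by (auto simp: centered_subsolution_def)
    let ?F = "energy_in_ball a G" and ?E = "energy_in_ball b V"
    let ?f = "slice_energy a G" and ?e = "slice_energy b V"
    let ?ann = "shell (1/2) 1 :: (real^'n) set"
    \<comment> \<open>polar coordinates turn \<open>u * v = 0\<close> almost everywhere into the same on almost every sphere\<close>
    define h where "h x = (if norm x < R \<and> u x * v x \<noteq> 0 then 1 else 0 :: ennreal)" for x
    have [measurable]: "h \<in> borel_measurable borel" unfolding h_def by measurable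
    have "(\<integral>\<^sup>+x. h x \<partial>lborel) = 0"
      by (subst nn_integral_0_iff_AE) (use uv in \<open>auto simp: h_def elim!: eventually_mono\<close>)
    hence "(\<integral>\<^sup>+s. indicator {0<..} s * ennreal (s ^ (DIM(real^'n) - 1)) * sphere_integral (1/2) 1 h s \<partial>lborel) = 0"
      by (subst polar_nn_integral) auto
    hence "AE s in lborel. indicator {0<..} s * ennreal (s ^ (DIM(real^'n) - 1)) * sphere_integral (1/2) 1 h s = 0"
      by (subst (asm) nn_integral_0_iff_AE) auto
    hence zero: "AE s in lborel. 0 < s \<and> s < R \<longrightarrow> 
       measure lborel ?ann \<le> 2 * measure lborel (slice_zeros u s) \<or> measure lborel ?ann \<le> 2 * measure lborel (slice_zeros v s)"
    proof eventually_elim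
      case (elim s)
      show ?case
      proof
        assume s: "0 < s \<and> s < R"
        define P where "P = {x \<in> ?ann. u ((s / norm x) *\<^sub>R x) * v ((s / norm x) *\<^sub>R x) \<noteq> 0}"
        have [measurable]: "P \<in> sets borel" unfolding P_def by measurable
        have "sphere_integral (1/2) 1 h s = 0" using elim s by auto
        moreover have "sphere_integral (1/2) 1 h s = sphere_integral (1/2) 1 (\<lambda>x. if u x * v x \<noteq> 0 then 1 else 0) s"
          using s by (intro sphere_integral_cong_sphere) (auto simp: h_def)
        moreover have "sphere_integral (1/2) 1 (\<lambda>x. if u x * v x \<noteq> 0 then 1 else 0) s = (\<integral>\<^sup>+x. indicator P x \<partial>lborel)"
          unfolding sphere_integral_def P_def by (intro nn_integral_cong) (auto simp: indicator_def)
        ultimately have P0: "emeasure lborel P = 0" by simp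
        have "emeasure lborel ?ann \<le> emeasure lborel (slice_zeros u s \<union> slice_zeros v s \<union> P)"
          by (rule emeasure_mono) (auto simp: slice_zeros_def P_def)
        also have "\<dots> \<le> emeasure lborel (slice_zeros u s \<union> slice_zeros v s) + emeasure lborel P"
          by (rule emeasure_subadditive) auto
        also have "\<dots> = emeasure lborel (slice_zeros u s \<union> slice_zeros v s)" by (simp add: P0)
        also have "\<dots> \<le> emeasure lborel (slice_zeros u s) + emeasure lborel (slice_zeros v s)"
          by (rule emeasure_subadditive) auto
        also have "\<dots> = ennreal (measure lborel (slice_zeros u s) + measure lborel (slice_zeros v s))"
          by (subst (1 2) slice_zeros_emeasure) auto
        finally have "ennreal (measure lborel ?ann) \<le> ennreal (measure lborel (slice_zeros u s) + measure lborel (slice_zeros v s))"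
          using emeasure_shell_finite[of "1/2" 1, where 'a="real^'n"] by (subst (asm) emeasure_eq_ennreal_measure) auto
        hence "measure lborel ?ann \<le> measure lborel (slice_zeros u s) + measure lborel (slice_zeros v s)"
          by (subst (asm) ennreal_le_iff) auto
        thus "measure lborel ?ann \<le> 2 * measure lborel (slice_zeros u s) \<or> measure lborel ?ann \<le> 2 * measure lborel (slice_zeros v s)"
          by linarith
      qed
    qed
    have oneu: "AE s in lborel. 0 < s \<and> s < R \<and> measure lborel ?ann \<le> 2 * measure lborel (slice_zeros u s) \<longrightarrow> ?F s \<le> ennreal (K * s) * ?f s"
      by (rule one[rule_format, OF _ W(1)]) (use a in auto)
    have onev: "AE s in lborel. 0 < s \<and> s < R \<and> measure lborel ?ann \<le> 2 * measure lborel (slice_zeros v s) \<longrightarrow> ?E s \<le> ennreal (K * s) * ?e s"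
      by (rule one[rule_format, OF _ W(2)]) (use b in auto)
    have Kt: "K * t > 0" using K st by auto
    have pt: "AE \<tau> in lborel. indicator {s..<t} \<tau> * (ennreal (1 / (K * t)) * (?F s * ?E s)) \<le> indicator {s..<t} \<tau> * (?F s * ?e \<tau> + ?E s * ?f \<tau>)"
      using zero oneu onev
    proof eventually_elim
      case (elim \<tau>)
      show ?case
      proof (cases "\<tau> \<in> {s..<t}")
        case True
        hence \<tau>: "0 < \<tau>" "\<tau> < R" "s \<le> \<tau>" "\<tau> \<le> t" using st by auto
        have cancel: "ennreal (1 / (K * t)) * X \<le> Y" if "X \<le> ennreal (K * \<tau>) * Y" for X Y
        proof -
          have "ennreal (1 / (K * t)) * X \<le> ennreal (1 / (K * t)) * (ennreal (K * t) * Y)"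
            using \<tau> K by (intro mult_left_mono order_trans[OF that] mult_right_mono ennreal_leI) auto
          also have "\<dots> = Y"
          proof -
            have "ennreal (1 / X) * (ennreal X * Y) = Y" if "X > 0" for X :: real
              using that by (simp add: mult.assoc[symmetric] ennreal_mult[symmetric])
            from this[OF Kt] show ?thesis .
          qed
          finally show ?thesis .
        qed
        have "ennreal (1 / (K * t)) * (?F s * ?E s) \<le> ?F s * ?e \<tau> + ?E s * ?f \<tau>"
        proof (cases "measure lborel ?ann \<le> 2 * measure lborel (slice_zeros u \<tau>)")
          case True
          hence "?F \<tau> \<le> ennreal (K * \<tau>) * ?f \<tau>" using elim \<tau> by blast
          hence "?F s \<le> ennreal (K * \<tau>) * ?f \<tau>" using energy_in_ball_mono[OF \<tau>(3)] order_trans by blast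
          hence "?E s * ?F s \<le> ?E s * (ennreal (K * \<tau>) * ?f \<tau>)" by (rule mult_left_mono) simp
          hence "?F s * ?E s \<le> ennreal (K * \<tau>) * (?E s * ?f \<tau>)" by (simp only: mult_ac)
          from cancel[OF this] show ?thesis by (rule order_trans) simp
        next
          case False
          hence "?E \<tau> \<le> ennreal (K * \<tau>) * ?e \<tau>" using elim \<tau> by blast
          hence "?E s \<le> ennreal (K * \<tau>) * ?e \<tau>" using energy_in_ball_mono[OF \<tau>(3)] order_trans by blast
          hence "?F s * ?E s \<le> ?F s * (ennreal (K * \<tau>) * ?e \<tau>)" by (rule mult_left_mono) simp
          hence "?F s * ?E s \<le> ennreal (K * \<tau>) * (?F s * ?e \<tau>)" by (simp only: mult_ac)
          from cancel[OF this] show ?thesis by (rule order_trans) simp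
        qed
        thus ?thesis using True by simp
      qed simp
    qed
    let ?If = "\<integral>\<^sup>+\<tau>. indicator {s..<t} \<tau> * ?f \<tau> \<partial>lborel" and ?Ie = "\<integral>\<^sup>+\<tau>. indicator {s..<t} \<tau> * ?e \<tau> \<partial>lborel"
    have "ennreal ((t - s) / (K * t)) * (?F s * ?E s) = (\<integral>\<^sup>+\<tau>. indicator {s..<t} \<tau> * (ennreal (1 / (K * t)) * (?F s * ?E s)) \<partial>lborel)"
      using st Kt by (subst nn_integral_multc) (auto simp: mult.assoc[symmetric] ennreal_mult[symmetric])
    also have "\<dots> \<le> (\<integral>\<^sup>+\<tau>. indicator {s..<t} \<tau> * (?F s * ?e \<tau> + ?E s * ?f \<tau>) \<partial>lborel)"
      using pt by (rule nn_integral_mono_AE)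
    also have "\<dots> = (\<integral>\<^sup>+\<tau>. ?F s * (indicator {s..<t} \<tau> * ?e \<tau>) + ?E s * (indicator {s..<t} \<tau> * ?f \<tau>) \<partial>lborel)"
      by (intro nn_integral_cong) (simp add: distrib_left mult_ac)
    also have "\<dots> = ?F s * ?Ie + ?E s * ?If"
      by (subst nn_integral_add) (auto simp: nn_integral_cmult)
    finally have step: "ennreal ((t - s) / (K * t)) * (?F s * ?E s) \<le> ?F s * ?Ie + ?E s * ?If" .
    have "ennreal (1 + (t - s) / (K * t)) * (?F s * ?E s) = ?F s * ?E s + ennreal ((t - s) / (K * t)) * (?F s * ?E s)"
      using st Kt by (subst ennreal_plus) (auto simp: distrib_right)
    also have "\<dots> \<le> ?F s * ?E s + (?F s * ?Ie + ?E s * ?If)" by (intro add_left_mono step)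
    also have "\<dots> \<le> (?F s + ?If) * (?E s + ?Ie)"
    proof -
      have "(A + x) * (B + y) = (A * B + (A * y + B * x)) + x * y" for A B x y :: ennreal
        by (simp only: distrib_left distrib_right add_ac mult.commute)
      thus ?thesis by simp
    qed
    also have "\<dots> = ?F t * ?E t" using energy_in_ball_split[OF _ st(1,2), of G a] energy_in_ball_split[OF _ st(1,2), of V b] by simp
    finally show "ennreal (1 + (t - s) / (K * t)) * (?F s * ?E s) \<le> ?F t * ?E t" .
  qed
qed

text \<open>On \<open>[0, 1]\<close> one has \<open>exp y \<le> 1 + 2 * y\<close> and \<open>1 - exp (- l) \<ge> l / 2\<close>.\<close>

lemma exponential_growth_bound:
  fixes l K :: real
  assumes K: "K \<ge> 1" and l: "0 \<le> l" "l \<le> 1"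
  shows "exp (l / (4 * K)) \<le> 1 + (1 - exp (- l)) / K"
proof -
  define y where "y = l / (4 * K)"
  have "l \<le> 4 * K" using K l by linarith
  hence y: "0 \<le> y" "y \<le> 1" using K l by (auto simp: y_def field_simps)
  have "exp y \<le> 1 + y + y\<^sup>2" using y by (rule exp_bound)
  also have "y\<^sup>2 \<le> y" using y by (simp add: power2_eq_square mult_left_le)
  finally have 1: "exp y \<le> 1 + 2 * y" by simp
  have "1 + l \<le> exp l" by (rule exp_ge_add_one_self)
  hence "exp (- l) \<le> 1 / (1 + l)" using l by (simp add: exp_minus field_simps)
  moreover have "1 - 1 / (1 + l) \<ge> l / 2"
  proof -
    have "l / 2 \<le> l / (1 + l)" using l by (intro divide_left_mono) auto
    also have "l / (1 + l) = 1 - 1 / (1 + l)" using l by (simp add: field_simps)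
    finally show ?thesis .
  qed
  ultimately have "l / 2 \<le> 1 - exp (- l)" by linarith
  hence "l / 2 / K \<le> (1 - exp (- l)) / K" using K by (intro divide_right_mono) auto
  moreover have "2 * y = l / 2 / K" by (simp add: y_def)
  ultimately show ?thesis using 1 unfolding y_def[symmetric] by linarith
qed

text \<open>If \<open>t\<close> is at most \<open>exp 1 * s\<close>, the growth factor is at least \<open>(t / s) powr \<gamma>\<close> by
  \<open>exponential_growth_bound\<close> with \<open>l = ln (t / s)\<close>. Larger ratios are divided into finitely many
  such steps.\<close>

lemma weighted_mono_from_growth:
  fixes H :: "real \<Rightarrow> ennreal"
  assumes K: "K \<ge> 1"
    and growth: "\<And>s t. 0 < s \<Longrightarrow> s \<le> t \<Longrightarrow> t < R \<Longrightarrow> ennreal (1 + (t - s) / (K * t)) * H s \<le> H t"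
    and st: "0 < s" "s \<le> t" "t < R"
  defines "\<gamma> \<equiv> 1 / (4 * K)"
  shows "ennreal (1 / s powr \<gamma>) * H s \<le> ennreal (1 / t powr \<gamma>) * H t"
proof -
  have local: "ennreal (1 / s powr \<gamma>) * H s \<le> ennreal (1 / t powr \<gamma>) * H t"
    if st: "0 < s" "s \<le> t" "t < R" "t \<le> exp 1 * s" for s t
  proof -
    define l where "l = ln (t / s)"
    have t0: "t > 0" using st by simp
    have "t / s \<ge> 1" "t / s \<le> exp 1" using st by (auto simp: field_simps)
    hence l: "0 \<le> l" "l \<le> 1" using ln_le_cancel_iff[of "t / s" "exp 1"] t0 st by (auto simp: l_def)
    have el: "exp (- l) = s / t" using st t0 by (simp add: l_def exp_minus)
    have "(t / s) powr \<gamma> = exp (l / (4 * K))" using st t0 by (simp add: powr_def l_def \<gamma>_def)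
    also have "\<dots> \<le> 1 + (1 - exp (- l)) / K" by (rule exponential_growth_bound[OF K l])
    also have "\<dots> = 1 + (t - s) / (K * t)" unfolding el using t0 K by (simp add: field_simps)
    finally have "ennreal ((t / s) powr \<gamma>) * H s \<le> ennreal (1 + (t - s) / (K * t)) * H s"
      by (intro mult_right_mono ennreal_leI) auto
    also have "\<dots> \<le> H t" using growth st by blast
    finally have "ennreal (1 / t powr \<gamma>) * (ennreal ((t / s) powr \<gamma>) * H s) \<le> ennreal (1 / t powr \<gamma>) * H t"
      by (rule mult_left_mono) simp
    moreover have "ennreal (1 / t powr \<gamma>) * ennreal ((t / s) powr \<gamma>) = ennreal (1 / s powr \<gamma>)"
      using st t0 by (simp add: ennreal_mult[symmetric] powr_divide)
    ultimately show ?thesis by (simp add: mult.assoc[symmetric])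
  qed
  have "\<forall>s t. 0 < s \<longrightarrow> s \<le> t \<longrightarrow> t < R \<longrightarrow> t \<le> exp 1 ^ n * s \<longrightarrow> ennreal (1 / s powr \<gamma>) * H s \<le> ennreal (1 / t powr \<gamma>) * H t" for n
  proof (induction n)
    case 0
    show ?case
    proof (intro allI impI)
      fix s t :: real assume "s \<le> t" "t \<le> exp 1 ^ 0 * s"
      hence "t = s" by simp
      thus "ennreal (1 / s powr \<gamma>) * H s \<le> ennreal (1 / t powr \<gamma>) * H t" by simp
    qed
  next
    case (Suc n)
    show ?case
    proof (intro allI impI)
      fix s t assume st: "0 < s" "s \<le> t" "t < R" "t \<le> exp 1 ^ Suc n * s"
      \<comment> \<open>one step of ratio at most \<open>exp 1\<close> from \<open>c\<close> to \<open>t\<close>; the rest is the induction hypothesis\<close>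
      define c where "c = max s (t / exp 1)"
      have "exp (1::real) \<ge> 1" by simp
      hence "t / exp 1 \<le> t" using st by (simp add: field_simps mult_le_cancel_left1)
      hence c: "s \<le> c" "c \<le> t" using st by (auto simp: c_def)
      have "(1::real) \<le> exp 1 ^ n" by simp
      hence "s \<le> exp 1 ^ n * s" using st by (simp add: mult_le_cancel_right1)
      moreover have "t / exp 1 \<le> exp 1 ^ n * s" using st by (simp add: field_simps)
      ultimately have cn: "c \<le> exp 1 ^ n * s" by (simp add: c_def)
      have ct: "t \<le> exp 1 * c"
      proof -
        have "t = exp 1 * (t / exp 1)" by simp
        also have "\<dots> \<le> exp 1 * c" by (intro mult_left_mono) (auto simp: c_def)
        finally show ?thesis .
      qed
      have "ennreal (1 / s powr \<gamma>) * H s \<le> ennreal (1 / c powr \<gamma>) * H c" using Suc c cn st by auto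
      also have "\<dots> \<le> ennreal (1 / t powr \<gamma>) * H t" using local[of c t] c ct st by auto
      finally show "ennreal (1 / s powr \<gamma>) * H s \<le> ennreal (1 / t powr \<gamma>) * H t" .
    qed
  qed
  moreover obtain n :: nat where "t / s < exp 1 ^ n"
    using real_arch_pow[of "exp 1" "t / s"] by auto
  hence "t \<le> exp 1 ^ n * s" using st by (simp add: field_simps)
  ultimately show ?thesis using st by blast
qed

section \<open>Reduction to Borel functions centred at the origin\<close>

lemma borel_representative_real:
  fixes f :: "real^'n \<Rightarrow> real"
  assumes f: "f \<in> borel_measurable (lebesgue_on S)" and S: "S \<in> sets lebesgue"
  shows "\<exists>g\<in>borel_measurable borel. AE x in lborel. x \<in> S \<longrightarrow> f x = g x"
proof -
  have SS: "S \<inter> space lebesgue \<in> sets lebesgue" using S by simp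
  have "(\<lambda>x. indicator S x *\<^sub>R f x) \<in> borel_measurable lebesgue"
    using f unfolding borel_measurable_restrict_space_iff[OF SS] .
  from completion_ex_borel_measurable_real[OF this]
  obtain g where g: "g \<in> borel_measurable lborel" "AE x in lborel. indicator S x *\<^sub>R f x = g x" by (elim bexE)
  from g(2) have "AE x in lborel. x \<in> S \<longrightarrow> f x = g x"
  proof eventually_elim
    case (elim x)
    thus ?case by (cases "x \<in> S") simp_all
  qed
  moreover have "g \<in> borel_measurable borel" using g(1) by simp
  ultimately show ?thesis by (intro bexI[of _ g])
qed

lemma borel_representative_vec:
  fixes f :: "real^'n \<Rightarrow> real^'n"
  assumes f: "f \<in> borel_measurable (lebesgue_on S)" and S: "S \<in> sets lebesgue"
  shows "\<exists>g\<in>borel_measurable borel. AE x in lborel. x \<in> S \<longrightarrow> f x = g x"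
proof -
  have "\<exists>g\<in>borel_measurable borel. AE x in lborel. x \<in> S \<longrightarrow> f x $ i = g x" for i
    by (rule borel_representative_real[OF borel_measurable_vec_nth'[OF f] S])
  hence "\<forall>i. \<exists>g. g \<in> borel_measurable borel \<and> (AE x in lborel. x \<in> S \<longrightarrow> f x $ i = g x)" unfolding Bex_def by (rule allI)
  from choice[OF this] obtain g where "\<forall>i. g i \<in> borel_measurable borel \<and> (AE x in lborel. x \<in> S \<longrightarrow> f x $ i = g i x)"
    by (elim exE)
  hence g: "\<And>i. g i \<in> borel_measurable borel" "\<And>i. AE x in lborel. x \<in> S \<longrightarrow> f x $ i = g i x"
    by (simp_all only: simp_thms)
  have "AE x in lborel. \<forall>i. x \<in> S \<longrightarrow> f x $ i = g i x" by (rule eventually_all_finite) (rule g)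
  hence "AE x in lborel. x \<in> S \<longrightarrow> f x = (\<chi> i. g i x)" by eventually_elim (auto simp: vec_eq_iff)
  moreover have "(\<lambda>x. \<chi> i. g i x) \<in> borel_measurable borel"
  proof -
    have "(\<lambda>x. \<Sum>i\<in>UNIV. g i x *\<^sub>R axis i 1 :: real^'n) \<in> borel_measurable borel"
      by (intro borel_measurable_sum borel_measurable_scaleR g borel_measurable_const)
    also have "(\<lambda>x. \<Sum>i\<in>UNIV. g i x *\<^sub>R axis i 1 :: real^'n) = (\<lambda>x. \<chi> i. g i x)"
      by (auto simp: fun_eq_iff vec_eq_iff axis_def if_distrib cong: if_cong)
    finally show ?thesis .
  qed
  ultimately show ?thesis by (intro bexI)
qed

lemma AE_lborel_translate:
  fixes c :: "'a::euclidean_space"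
  assumes "AE x in lborel. P x" shows "AE y in lborel. P (c + y)"
proof (rule AE_distrD[where M'=borel and f="(+) c"])
  show "AE x in distr lborel borel ((+) c). P x" unfolding lborel_distr_plus by (rule assms)
qed simp

lemma set_lebesgue_integral_representative:
  fixes F F1 :: "real^'n \<Rightarrow> real"
  assumes meas: "(\<lambda>x. indicator S x *\<^sub>R F x) \<in> borel_measurable lebesgue"
    and F1: "F1 \<in> borel_measurable borel" and eq: "AE x in lborel. indicator S x *\<^sub>R F x = F1 x"
  shows "(LINT x:S|lebesgue. F x) = (LINT x|lborel. F1 x)"
proof -
  have "(LINT x:S|lebesgue. F x) = (LINT x|lebesgue. F1 x)"
    unfolding set_lebesgue_integral_def
    using eq F1 by (intro integral_cong_AE meas AE_completion) (auto intro: measurable_completion)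
  also have "\<dots> = (LINT x|lborel. F1 x)" by (rule integral_completion) (use F1 in simp)
  finally show ?thesis .
qed

lemma diagonal_matrix_vector_mult:
  fixes A :: "real^'n^'n"
  assumes "\<And>i j. i \<noteq> j \<Longrightarrow> A $ i $ j = 0"
  shows "(A *v w) $ i = A $ i $ i * w $ i"
proof -
  have "(A *v w) $ i = (\<Sum>j\<in>UNIV. A $ i $ j * w $ j)" by (simp add: matrix_vector_mult_def)
  also have "\<dots> = (\<Sum>j\<in>UNIV. if j = i then A $ i $ i * w $ i else 0)"
    by (rule sum.cong) (use assms in auto)
  finally show ?thesis by simp
qed

lemma L2_loc_representative_finite:
  fixes f :: "real^'n \<Rightarrow> 'b::euclidean_space"
  assumes f: "f \<in> L2_loc S" and K: "compact K" "K \<subseteq> S" and eq: "AE x in lborel. x \<in> S \<longrightarrow> f x = f1 x"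
  shows "(\<integral>\<^sup>+x. indicator K x * ennreal ((norm (f1 x))\<^sup>2) \<partial>lborel) < \<infinity>"
proof -
  have "K \<in> sets lebesgue" using K(1) by (simp add: lmeasurable_compact fmeasurableD)
  hence "integrable lebesgue (\<lambda>x. indicator K x *\<^sub>R (norm (f x))\<^sup>2)"
    using f K by (subst integrable_restrict_space[symmetric]) (auto simp: L2_loc_def)
  hence "(\<integral>\<^sup>+x. ennreal (norm (indicator K x *\<^sub>R (norm (f x))\<^sup>2)) \<partial>lebesgue) < \<infinity>"
    by (simp only: integrable_iff_bounded)
  also have "(\<integral>\<^sup>+x. ennreal (norm (indicator K x *\<^sub>R (norm (f x))\<^sup>2)) \<partial>lebesgue) = (\<integral>\<^sup>+x. indicator K x * ennreal ((norm (f1 x))\<^sup>2) \<partial>lborel)"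
    unfolding nn_integral_completion
    by (rule nn_integral_cong_AE, use eq in eventually_elim) (use K in \<open>auto simp: indicator_def\<close>)
  finally show ?thesis .
qed

text \<open>All integrals in the definitions involve \<open>u\<close> and its weak gradient up to null sets only, so Borel
  representatives may replace them, and translation moves the centre \<open>x0\<close> to the origin. Taking the
  positive part makes the representative of \<open>u\<close> nonnegative everywhere.\<close>

lemma centered_subsolution_exists:
  fixes A :: "real^'n^'n" and x0 :: "real^'n"
  assumes S: "open S" and inside: "\<And>\<rho>. \<rho> < r0 \<Longrightarrow> cball x0 \<rho> \<subseteq> S"
    and H1: "u \<in> H1_loc S" and nonneg: "AE x in lebesgue_on S. 0 \<le> u x"
    and sub: "weak_subsolution S A u" and diag: "\<And>i j. i \<noteq> j \<Longrightarrow> A $ i $ j = 0"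
  obtains u1 G1 where "u1 \<in> borel_measurable borel" "G1 \<in> borel_measurable borel"
    "AE x in lborel. x \<in> S \<longrightarrow> u x = u1 x" "AE x in lborel. x \<in> S \<longrightarrow> weak_gradient S u x = G1 x"
    "centered_subsolution (\<lambda>i. A $ i $ i) r0 (\<lambda>y. u1 (x0 + y)) (\<lambda>y. G1 (x0 + y))"
proof -
  define G where "G = weak_gradient S u"
  have SL: "S \<in> sets lebesgue" using S by simp
  have uL2: "u \<in> L2_loc S" using H1 by (simp add: H1_loc_def)
  have GL2: "G \<in> L2_loc S" and wg: "has_weak_gradient S u G"
    unfolding G_def using weak_gradient_H1_loc[OF H1] by auto
  have um: "u \<in> borel_measurable (lebesgue_on S)" and Gm: "G \<in> borel_measurable (lebesgue_on S)"
    using uL2 GL2 by (auto simp: L2_loc_def)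
  obtain u0 where [measurable]: "u0 \<in> borel_measurable borel" and u0: "AE x in lborel. x \<in> S \<longrightarrow> u x = u0 x"
    using borel_representative_real[OF um SL] by blast
  obtain G1 where G1m[measurable]: "G1 \<in> borel_measurable borel" and G1: "AE x in lborel. x \<in> S \<longrightarrow> G x = G1 x"
    using borel_representative_vec[OF Gm SL] by blast
  define u1 where "u1 x = max 0 (u0 x)" for x
  have u1m[measurable]: "u1 \<in> borel_measurable borel" unfolding u1_def by measurable
  have "AE x in lborel. x \<in> S \<longrightarrow> 0 \<le> u x"
    using nonneg SL by (subst (asm) AE_restrict_space_iff) (auto simp: AE_completion_iff)
  with u0 have u1: "AE x in lborel. x \<in> S \<longrightarrow> u x = u1 x"
    by eventually_elim (auto simp: u1_def)
  have umi: "(\<lambda>x. indicator S x *\<^sub>R u x) \<in> borel_measurable lebesgue"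
    using um SL by (subst (asm) borel_measurable_restrict_space_iff) auto
  have Gmi: "(\<lambda>x. indicator S x *\<^sub>R G x) \<in> borel_measurable lebesgue"
    using Gm SL by (subst (asm) borel_measurable_restrict_space_iff) auto
  have Gmi': "(\<lambda>x. indicator S x * G x $ i) \<in> borel_measurable lebesgue" for i
    using borel_measurable_vec_nth'[OF Gmi, of i] by simp
  have T: "centered_subsolution (\<lambda>i. A $ i $ i) r0 (\<lambda>y. u1 (x0 + y)) (\<lambda>y. G1 (x0 + y))"
    unfolding centered_subsolution_def
  proof (intro conjI allI impI)
    show "0 \<le> u1 (x0 + y)" for y by (simp add: u1_def)
  next
    fix \<rho> assume \<rho>: "\<rho> < r0"
    note K = inside[OF \<rho>]
    have shift: "(\<integral>\<^sup>+x. indicator (cball x0 \<rho>) x * ennreal ((u1 x)\<^sup>2 + (norm (G1 x))\<^sup>2) \<partial>lborel)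
      = (\<integral>\<^sup>+x. indicator (cball 0 \<rho>) x * ennreal ((u1 (x0 + x))\<^sup>2 + (norm (G1 (x0 + x)))\<^sup>2) \<partial>lborel)"
    proof (subst nn_integral_lborel_affine[where c=1 and t=x0])
      show "(\<lambda>x. indicator (cball x0 \<rho>) x * ennreal ((u1 x)\<^sup>2 + (norm (G1 x))\<^sup>2)) \<in> borel_measurable borel"
        by (intro borel_measurable_times_ennreal borel_measurable_indicator) auto
    qed (auto intro!: nn_integral_cong simp: indicator_def dist_norm)
    have "(\<integral>\<^sup>+x. indicator (cball x0 \<rho>) x * ennreal ((u1 x)\<^sup>2 + (norm (G1 x))\<^sup>2) \<partial>lborel)
      = (\<integral>\<^sup>+x. indicator (cball x0 \<rho>) x * ennreal ((norm (u1 x))\<^sup>2) + indicator (cball x0 \<rho>) x * ennreal ((norm (G1 x))\<^sup>2) \<partial>lborel)"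
      by (intro nn_integral_cong) (simp add: ennreal_plus distrib_left)
    also have "\<dots> = (\<integral>\<^sup>+x. indicator (cball x0 \<rho>) x * ennreal ((norm (u1 x))\<^sup>2) \<partial>lborel) + (\<integral>\<^sup>+x. indicator (cball x0 \<rho>) x * ennreal ((norm (G1 x))\<^sup>2) \<partial>lborel)"
      by (rule nn_integral_add; intro borel_measurable_times_ennreal borel_measurable_indicator) auto
    also have "\<dots> < \<infinity>"
      using L2_loc_representative_finite[OF uL2 compact_cball K u1] L2_loc_representative_finite[OF GL2 compact_cball K G1]
      by simp
    finally show "(\<integral>\<^sup>+x. indicator (cball 0 \<rho>) x * ennreal ((u1 (x0 + x))\<^sup>2 + (norm (G1 (x0 + x)))\<^sup>2) \<partial>lborel) < \<infinity>"
      unfolding shift .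
  next
    fix x :: "real^'n" and \<delta> :: real and i assume \<delta>: "0 < \<delta>" "norm x + \<delta> < r0"
    define z where "z = x0 + x"
    have sub': "cball z \<delta> \<subseteq> S"
    proof -
      have "cball z \<delta> \<subseteq> cball x0 (norm x + \<delta>)"
      proof
        fix y assume "y \<in> cball z \<delta>"
        hence "norm (y - z) \<le> \<delta>" by (simp add: dist_norm norm_minus_commute)
        moreover have "norm (y - x0) \<le> norm (y - z) + norm x"
          using norm_triangle_ineq[of "y - z" x] by (simp add: z_def algebra_simps)
        ultimately show "y \<in> cball x0 (norm x + \<delta>)" by (simp add: dist_norm norm_minus_commute)
      qed
      thus ?thesis using inside[OF \<delta>(2)] by blast
    qed
    define \<phi> where "\<phi> = (\<lambda>y. bump \<delta> (y - z))"
    have \<phi>: "\<phi> \<in> test_functions S" and d\<phi>: "\<And>i y. partial_deriv i \<phi> y = bump_grad \<delta> (y - z) $ i"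
      unfolding \<phi>_def by (rule bump_test_function[OF \<delta>(1) sub'])+
    have out: "bump \<delta> (y - z) = 0" "bump_grad \<delta> (y - z) = 0" if "y \<notin> S" for y
    proof -
      have "y \<notin> cball z \<delta>" using that sub' by blast
      hence "norm (y - z) \<ge> \<delta>" by (simp add: dist_norm norm_minus_commute)
      thus "bump \<delta> (y - z) = 0" "bump_grad \<delta> (y - z) = 0" using bump_outside[of \<delta> "y - z"] \<delta> by auto
    qed
    have [measurable]: "(\<lambda>y. bump \<delta> (y - z)) \<in> borel_measurable borel" "\<And>i. (\<lambda>y. bump_grad \<delta> (y - z) $ i) \<in> borel_measurable borel"
      by measurable
    have kL: "(\<lambda>y. bump \<delta> (y - z)) \<in> borel_measurable lebesgue" "\<And>i. (\<lambda>y. bump_grad \<delta> (y - z) $ i) \<in> borel_measurable lebesgue"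
      by (auto intro!: measurable_completion)
    have eq1: "(LINT y:S|lebesgue. u y * partial_deriv i \<phi> y) = (LINT y|lborel. u1 y * bump_grad \<delta> (y - z) $ i)"
    proof (rule set_lebesgue_integral_representative)
      show "(\<lambda>y. indicator S y *\<^sub>R (u y * partial_deriv i \<phi> y)) \<in> borel_measurable lebesgue"
        using borel_measurable_times[OF umi kL(2)[of i]] by (simp add: d\<phi> mult.assoc)
      show "AE y in lborel. indicator S y *\<^sub>R (u y * partial_deriv i \<phi> y) = u1 y * bump_grad \<delta> (y - z) $ i"
        using u1 by eventually_elim (auto simp: d\<phi> out indicator_def)
    qed measurable
    have eq2: "(LINT y:S|lebesgue. G y $ i * \<phi> y) = (LINT y|lborel. G1 y $ i * bump \<delta> (y - z))"
    proof (rule set_lebesgue_integral_representative)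
      show "(\<lambda>y. indicator S y *\<^sub>R (G y $ i * \<phi> y)) \<in> borel_measurable lebesgue"
        using borel_measurable_times[OF Gmi'[of i] kL(1)] by (simp add: \<phi>_def mult.assoc)
      show "AE y in lborel. indicator S y *\<^sub>R (G y $ i * \<phi> y) = G1 y $ i * bump \<delta> (y - z)"
        using G1 by eventually_elim (auto simp: \<phi>_def out indicator_def)
    qed measurable
    have eq3: "(LINT y:S|lebesgue. (A *v G y) \<bullet> grad \<phi> y) = (LINT y|lborel. (\<Sum>i\<in>UNIV. A $ i $ i * (G1 y $ i * bump_grad \<delta> (y - z) $ i)))"
    proof (rule set_lebesgue_integral_representative)
      have e: "(A *v G y) \<bullet> grad \<phi> y = (\<Sum>i\<in>UNIV. A $ i $ i * (G y $ i * bump_grad \<delta> (y - z) $ i))" for y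
        by (simp add: inner_vec_def diagonal_matrix_vector_mult[OF diag] grad_def d\<phi> mult.assoc)
      have "(\<lambda>y. \<Sum>i\<in>UNIV. A $ i $ i * ((indicator S y * G y $ i) * bump_grad \<delta> (y - z) $ i)) \<in> borel_measurable lebesgue"
        by (intro borel_measurable_sum borel_measurable_times borel_measurable_const Gmi' kL)
      thus "(\<lambda>y. indicator S y *\<^sub>R ((A *v G y) \<bullet> grad \<phi> y)) \<in> borel_measurable lebesgue"
        by (simp add: e sum_distrib_left mult_ac)
      show "AE y in lborel. indicator S y *\<^sub>R ((A *v G y) \<bullet> grad \<phi> y) = (\<Sum>i\<in>UNIV. A $ i $ i * (G1 y $ i * bump_grad \<delta> (y - z) $ i))"
        using G1 by eventually_elim (auto simp: e out indicator_def)
    qed measurable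
    have sh: "y + x0 - z = y - x" for y by (simp add: z_def)
    show "(LINT y|lborel. u1 (x0 + y) * bump_grad \<delta> (y - x) $ i) = - (LINT y|lborel. G1 (x0 + y) $ i * bump \<delta> (y - x))"
    proof -
      have "(LINT y|lborel. u1 y * bump_grad \<delta> (y - z) $ i) = - (LINT y|lborel. G1 y $ i * bump \<delta> (y - z))"
        using wg[unfolded has_weak_gradient_def, rule_format, OF \<phi>, of i] unfolding eq1 eq2 .
      thus ?thesis
        using integral_lborel_translate[of "\<lambda>y. u1 y * bump_grad \<delta> (y - z) $ i" x0] integral_lborel_translate[of "\<lambda>y. G1 y $ i * bump \<delta> (y - z)" x0]
        by (simp add: sh add.commute)
    qed
    show "(LINT y|lborel. (\<Sum>i\<in>UNIV. A $ i $ i * (G1 (x0 + y) $ i * bump_grad \<delta> (y - x) $ i))) \<le> 0"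
    proof -
      have "\<phi> y \<ge> 0" for y by (simp add: \<phi>_def bump_nonneg)
      hence "\<forall>x. \<phi> x \<ge> 0" by simp
      from sub[unfolded weak_subsolution_def G_def[symmetric], rule_format, OF \<phi> this[rule_format]]
      have "(LINT y|lborel. (\<Sum>i\<in>UNIV. A $ i $ i * (G1 y $ i * bump_grad \<delta> (y - z) $ i))) \<le> 0"
        unfolding eq3 .
      thus ?thesis
        using integral_lborel_translate[of "\<lambda>y. (\<Sum>i\<in>UNIV. A $ i $ i * (G1 y $ i * bump_grad \<delta> (y - z) $ i))" x0]
        by (simp add: sh add.commute)
    qed
  qed measurable
  show thesis by (rule that[OF u1m G1m u1 _ T]) (use G1 in \<open>simp add: G_def\<close>)
qed

section \<open>The monotonicity formula\<close>

lemma cball_inside_ball: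
  fixes x0 :: "real^'n"
  assumes R: "R > 0" and x0: "x0 \<in> ball 0 R" and \<rho>: "\<rho> < infdist x0 (frontier (ball 0 R))"
  shows "cball x0 \<rho> \<subseteq> ball 0 R"
proof -
  obtain e :: "real^'n" where e: "norm e = 1" using vector_choose_size[of 1] by auto
  \<comment> \<open>a point of the boundary closest to the centre\<close>
  define p where "p = (if x0 = 0 then R *\<^sub>R e else (R / norm x0) *\<^sub>R x0)"
  have "norm p = R" using R e by (simp add: p_def)
  hence "p \<in> frontier (ball 0 R)" using R by (simp add: frontier_ball)
  moreover have "dist x0 p = R - norm x0"
  proof (cases "x0 = 0")
    case True thus ?thesis using R e by (simp add: p_def dist_norm)
  next
    case False
    have "x0 - p = (1 - R / norm x0) *\<^sub>R x0" using False by (simp add: p_def algebra_simps)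
    hence "dist x0 p = \<bar>1 - R / norm x0\<bar> * norm x0" by (simp add: dist_norm)
    also have "1 - R / norm x0 \<le> 0" using x0 False by (simp add: field_simps)
    hence "\<bar>1 - R / norm x0\<bar> * norm x0 = (R / norm x0 - 1) * norm x0" by simp
    also have "\<dots> = R - norm x0" using False by (simp add: field_simps)
    finally show ?thesis .
  qed
  ultimately have "infdist x0 (frontier (ball 0 R)) \<le> R - norm x0" using infdist_le by metis
  hence \<rho>': "\<rho> < R - norm x0" using \<rho> by linarith
  show ?thesis
  proof
    fix y assume "y \<in> cball x0 \<rho>"
    hence "norm (y - x0) \<le> \<rho>" by (simp add: dist_norm norm_minus_commute)
    moreover have "norm y \<le> norm x0 + norm (y - x0)" by (rule norm_triangle_sub)
    ultimately show "y \<in> ball 0 R" using \<rho>' by simp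
  qed
qed

text \<open>A common form of the two integrals of the functional: \<open>k\<close> stands for either integrand, which is
  determined by the gradient and the distance vector. The centre is excluded because quotients
  and powers take default values there.\<close>

lemma energy_integral_centered:
  fixes G G1 :: "real^'n \<Rightarrow> real^'n" and k :: "real^'n \<Rightarrow> real^'n \<Rightarrow> real"
  assumes [measurable]: "G1 \<in> borel_measurable borel" and eq: "AE x in lborel. x \<in> S \<longrightarrow> G x = G1 x"
    and sub: "ball x0 s \<subseteq> S"
    and k: "\<And>x. x \<noteq> x0 \<Longrightarrow> k (G x) (x - x0) = energy a (G x) * kernel a 0 (x - x0)"
  shows "(\<integral>\<^sup>+x\<in>ball x0 s. ennreal (k (G x) (x - x0)) \<partial>lebesgue) = energy_in_ball a (\<lambda>y. G1 (x0 + y)) s"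
proof -
  have "(\<integral>\<^sup>+x\<in>ball x0 s. ennreal (k (G x) (x - x0)) \<partial>lebesgue)
      = (\<integral>\<^sup>+x. (if norm (x - x0) < s then ennreal (energy a (G1 x) * kernel a 0 (x - x0)) else 0) \<partial>lborel)"
    unfolding nn_integral_completion
  proof (rule nn_integral_cong_AE, use eq AE_lborel_singleton[of x0] in eventually_elim)
    case (elim x)
    show ?case
    proof (cases "x \<in> ball x0 s")
      case True
      hence "G x = G1 x" using elim sub by auto
      thus ?thesis using True k[OF elim(2)] by (simp add: dist_norm norm_minus_commute)
    next
      case False thus ?thesis by (simp add: dist_norm norm_minus_commute)
    qed
  qed
  also have "\<dots> = (\<integral>\<^sup>+y. (if norm y < s then ennreal (energy a (G1 (x0 + y)) * kernel a 0 y) else 0) \<partial>lborel)"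
    by (subst nn_integral_lborel_affine[where c=1 and t=x0]) (auto intro!: nn_integral_cong)
  also have "\<dots> = energy_in_ball a (\<lambda>y. G1 (x0 + y)) s"
    unfolding energy_in_ball_def by (intro nn_integral_cong) (auto simp: indicator_def)
  finally show ?thesis .
qed

lemma kernel_one:
  assumes "x \<noteq> 0" "CARD('n) \<ge> 2"
  shows "kernel (\<lambda>_. 1) 0 (x::real^'n) = 1 / norm x ^ (CARD('n) - 2)"
proof -
  have "kernel (\<lambda>_. 1) 0 x = (norm x)\<^sup>2 powr ((2 - real CARD('n)) / 2)"
    by (simp add: kernel_def norm_square_sum_cart)
  also have "\<dots> = norm x powr (2 * ((2 - real CARD('n)) / 2))"
  proof -
    have "(norm x)\<^sup>2 = norm x powr 2" using assms by (simp add: powr_numeral)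
    thus ?thesis by (simp only: powr_powr)
  qed
  also have "2 * ((2 - real CARD('n)) / 2) = - real (CARD('n) - 2)" using assms by (simp add: of_nat_diff)
  also have "norm x powr (- real (CARD('n) - 2)) = 1 / norm x ^ (CARD('n) - 2)"
  proof -
    have "norm x > 0" using assms(1) by simp
    thus ?thesis by (simp only: powr_minus_divide powr_realpow)
  qed
  finally show ?thesis .
qed

text \<open>The second function solves the inequality for the identity matrix, so both energies fall under
  the two-phase estimate; \<open>L\<close> is the trace of \<open>A\<close>, which bounds every entry.\<close>

lemma monotonicity_formula:
  fixes A :: "real^'n^'n"
  assumes "CARD('n) \<ge> 2"
    and "\<And>i j. i \<noteq> j \<Longrightarrow> A $ i $ j = 0"
    and a1: "\<And>i. 1 \<le> A $ i $ i"
  shows "\<exists>\<nu>. 0 < \<nu> \<and> \<nu> < 2 \<and>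
    (\<forall>R u v. R > 0 \<longrightarrow>
       u \<in> H1_loc (ball 0 R) \<longrightarrow> v \<in> H1_loc (ball 0 R) \<longrightarrow>
       (AE x in lebesgue_on (ball 0 R). u x \<ge> 0 \<and> v x \<ge> 0) \<longrightarrow>
       weak_subsolution (ball 0 R) A u \<longrightarrow>
       weak_subsolution (ball 0 R) (mat 1) v \<longrightarrow>
       (AE x in lebesgue_on (ball 0 R). u x * v x = 0) \<longrightarrow>
       (\<forall>x\<^sub>0 \<in> ball 0 R.
          mono_on {0<..<infdist x\<^sub>0 (frontier (ball 0 R))}
            (J_functional A \<nu> (ball 0 R) u v x\<^sub>0)))"
proof -
  note N = assms(1) and diag = assms(2)
  define L where "L = (\<Sum>i\<in>UNIV. A $ i $ i)"
  have aL: "A $ i $ i \<le> L" for i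
    unfolding L_def using a1 by (intro member_le_sum) (auto intro: order_trans[of 0 1])
  have L1: "1 \<le> L" using a1 aL order_trans by blast
  have diag1: "(mat 1 :: real^'n^'n) $ i $ j = 0" if "i \<noteq> j" for i j using that by (simp add: mat_def)
  obtain K where K: "K \<ge> 1" and growth: "\<forall>(a::'n \<Rightarrow> real) b R u v G V. (\<forall>i. 1 \<le> a i \<and> a i \<le> L) \<longrightarrow> (\<forall>i. 1 \<le> b i \<and> b i \<le> L) \<longrightarrow>
     centered_subsolution a R u G \<longrightarrow> centered_subsolution b R v V \<longrightarrow> (AE x in lborel. norm x < R \<longrightarrow> u x * v x = 0) \<longrightarrow>
     (\<forall>s t. 0 < s \<longrightarrow> s \<le> t \<longrightarrow> t < R \<longrightarrow>
       ennreal (1 + (t - s) / (K * t)) * (energy_in_ball a G s * energy_in_ball b V s) \<le> energy_in_ball a G t * energy_in_ball b V t)"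
    using two_phase_growth[OF N L1] by (elim exE conjE)
  define \<nu> where "\<nu> = 1 / (8 * K)"
  have \<nu>: "0 < \<nu>" "\<nu> < 2" "2 * \<nu> = 1 / (4 * K)" using K by (auto simp: \<nu>_def field_simps)
  show ?thesis
  proof (intro exI[of _ \<nu>] conjI \<nu> allI impI ballI)
    fix R :: real and u v :: "real^'n \<Rightarrow> real" and x0 :: "real^'n"
    let ?S = "ball (0::real^'n) R"
    assume R: "R > 0" and u: "u \<in> H1_loc ?S" and v: "v \<in> H1_loc ?S"
      and nn: "AE x in lebesgue_on ?S. u x \<ge> 0 \<and> v x \<ge> 0"
      and su: "weak_subsolution ?S A u" and sv: "weak_subsolution ?S (mat 1) v"
      and uv: "AE x in lebesgue_on ?S. u x * v x = 0" and x0: "x0 \<in> ?S"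
    define r0 where "r0 = infdist x0 (frontier ?S)"
    have inside: "cball x0 \<rho> \<subseteq> ?S" if "\<rho> < r0" for \<rho>
      using that unfolding r0_def by (rule cball_inside_ball[OF R x0])
    have nnu: "AE x in lebesgue_on ?S. 0 \<le> u x" and nnv: "AE x in lebesgue_on ?S. 0 \<le> v x"
      using nn by (eventually_elim, simp)+
    obtain u1 G1 where [measurable]: "u1 \<in> borel_measurable borel" "G1 \<in> borel_measurable borel"
      and u1: "AE x in lborel. x \<in> ?S \<longrightarrow> u x = u1 x" and G1: "AE x in lborel. x \<in> ?S \<longrightarrow> weak_gradient ?S u x = G1 x"
      and Wu: "centered_subsolution (\<lambda>i. A $ i $ i) r0 (\<lambda>y. u1 (x0 + y)) (\<lambda>y. G1 (x0 + y))"
      by (rule centered_subsolution_exists[OF open_ball inside u nnu su diag])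
    obtain v1 V1 where [measurable]: "v1 \<in> borel_measurable borel" "V1 \<in> borel_measurable borel"
      and v1: "AE x in lborel. x \<in> ?S \<longrightarrow> v x = v1 x" and V1: "AE x in lborel. x \<in> ?S \<longrightarrow> weak_gradient ?S v x = V1 x"
      and Wv: "centered_subsolution (\<lambda>i. (mat 1 :: real^'n^'n) $ i $ i) r0 (\<lambda>y. v1 (x0 + y)) (\<lambda>y. V1 (x0 + y))"
      by (rule centered_subsolution_exists[OF open_ball inside v nnv sv diag1])
    have mat11: "(\<lambda>i. (mat 1 :: real^'n^'n) $ i $ i) = (\<lambda>_. 1)" by (simp add: mat_def)
    have "AE x in lborel. x \<in> ?S \<longrightarrow> u x * v x = 0"
      using uv by (subst (asm) AE_restrict_space_iff) (auto simp: AE_completion_iff)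
    with u1 v1 have "AE x in lborel. x \<in> ?S \<longrightarrow> u1 x * v1 x = 0" by eventually_elim auto
    from AE_lborel_translate[OF this, of x0]
    have uv1: "AE y in lborel. norm y < r0 \<longrightarrow> u1 (x0 + y) * v1 (x0 + y) = 0"
    proof eventually_elim
      case (elim y)
      show ?case
      proof
        assume "norm y < r0"
        moreover have "x0 + y \<in> cball x0 (norm y)" by (simp add: dist_norm)
        ultimately have "x0 + y \<in> ?S" using inside by blast
        thus "u1 (x0 + y) * v1 (x0 + y) = 0" using elim by blast
      qed
    qed
    define F where "F = energy_in_ball (\<lambda>i. A $ i $ i) (\<lambda>y. G1 (x0 + y))"
    define E where "E = energy_in_ball (\<lambda>_::'n. 1) (\<lambda>y. V1 (x0 + y))"
    have gr: "ennreal (1 + (t - s) / (K * t)) * (F s * E s) \<le> F t * E t" if "0 < s" "s \<le> t" "t < r0" for s t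
      unfolding F_def E_def
      by (rule growth[rule_format, OF _ _ Wu Wv[unfolded mat11] _ that]) (use a1 aL L1 uv1 in auto)
    have J: "J_functional A \<nu> ?S u v x0 s = ennreal (1 / s powr (1 / (4 * K))) * (F s * E s)" if s: "s < r0" for s
    proof -
      have bs: "ball x0 s \<subseteq> ?S" using inside[OF s] ball_subset_cball by blast
      have 1: "(\<integral>\<^sup>+ x \<in> ball x0 s. ennreal (((A *v weak_gradient ?S u x) \<bullet> weak_gradient ?S u x) * Gamma_A A (x - x0)) \<partial>lebesgue) = F s"
        unfolding F_def
      proof (rule energy_integral_centered[where k="\<lambda>w y. ((A *v w) \<bullet> w) * Gamma_A A y", OF _ G1 bs])
        show "((A *v w) \<bullet> w) * Gamma_A A y = energy (\<lambda>i. A $ i $ i) w * kernel (\<lambda>i. A $ i $ i) 0 y" for w y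
          by (simp add: inner_vec_def diagonal_matrix_vector_mult[OF diag] energy_def kernel_def Gamma_A_def power2_eq_square mult.assoc)
      qed measurable
      have 2: "(\<integral>\<^sup>+ x \<in> ball x0 s. ennreal ((norm (weak_gradient ?S v x))\<^sup>2 / norm (x - x0) ^ (CARD('n) - 2)) \<partial>lebesgue) = E s"
        unfolding E_def
      proof (rule energy_integral_centered[where k="\<lambda>w y. (norm w)\<^sup>2 / norm y ^ (CARD('n) - 2)", OF _ V1 bs])
        show "(norm w)\<^sup>2 / norm (x - x0) ^ (CARD('n) - 2) = energy (\<lambda>_. 1) w * kernel (\<lambda>_. 1) 0 (x - x0)" if "x \<noteq> x0" for w and x :: "real^'n"
          using that N by (simp add: kernel_one energy_def norm_square_sum_cart[symmetric])
      qed measurable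
      show ?thesis unfolding J_functional_def 1 2 \<nu>(3) by (simp only: mult.assoc)
    qed
    show "mono_on {0<..<infdist x0 (frontier ?S)} (J_functional A \<nu> ?S u v x0)"
      unfolding r0_def[symmetric]
    proof (rule mono_onI)
      fix s t assume "s \<in> {0<..<r0}" "t \<in> {0<..<r0}" "s \<le> t"
      hence st: "0 < s" "s \<le> t" "t < r0" by auto
      have "ennreal (1 / s powr (1 / (4 * K))) * (F s * E s) \<le> ennreal (1 / t powr (1 / (4 * K))) * (F t * E t)"
        by (rule weighted_mono_from_growth[OF K gr st])
      thus "J_functional A \<nu> ?S u v x0 s \<le> J_functional A \<nu> ?S u v x0 t"
        using J[of s] J[of t] st by simp
    qed
  qed
qed

theorem theorem1p1:
  fixes A :: "real^('n::{finite,linorder})^('n::{finite,linorder})"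
  assumes "CARD('n) \<ge> 2"
    and "\<And>i j. i \<noteq> j \<Longrightarrow> A $ i $ j = 0"
    and "A $ Min UNIV $ Min UNIV = 1"
    and "mono (\<lambda>i. A $ i $ i)"
    and "A \<noteq> mat 1"
  shows "\<exists>\<nu>. 0 < \<nu> \<and> \<nu> < 2 \<and>
    (\<forall>R u v. R > 0 \<longrightarrow>
       u \<in> H1_loc (ball 0 R) \<longrightarrow> v \<in> H1_loc (ball 0 R) \<longrightarrow>
       (AE x in lebesgue_on (ball 0 R). u x \<ge> 0 \<and> v x \<ge> 0) \<longrightarrow>
       weak_subsolution (ball 0 R) A u \<longrightarrow>
       weak_subsolution (ball 0 R) (mat 1) v \<longrightarrow>
       (AE x in lebesgue_on (ball 0 R). u x * v x = 0) \<longrightarrow>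
       (\<forall>x\<^sub>0 \<in> ball 0 R.
          mono_on {0<..<infdist x\<^sub>0 (frontier (ball 0 R))}
            (J_functional A \<nu> (ball 0 R) u v x\<^sub>0)))"
proof -
  have "1 \<le> A $ i $ i" for i
  proof -
    have "Min UNIV \<le> i" by simp
    thus ?thesis using monoD[OF assms(4), of "Min UNIV" i] assms(3) by simp
  qed
  from monotonicity_formula[OF assms(1,2) this] show ?thesis .
qed

end
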